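(* Let $H$ be a subgroup of $H(\mathbb{Z})$ which is not locally solvable, and let $\mu$ be a probability measure on $H$ such that the support of $\mu$ generates $H$ as a semigroup and $\mu$ has finite first break moment, i.e. $\mathbb{E}[Br]=\sum_{g\in H}Br(g)\mu(g)<\infty$. Then the Poisson boundary of $(H,\mu)$ is non-trivial.
   Context: $PSL_2(\mathbb{R})$ acts on $\mathbb{R}\cup\{\infty\}$ by $x\mapsto\frac{ax+b}{cx+d}$ (usual conventions at $\infty$). An element of $PSL_2(\mathbb{Z})$ is hyperbolic if the absolute value of its trace is $>2$; $P_{\mathbb{Z}}\subset\mathbb{R}$ is the set of fixed points in $\mathbb{R}\cup\{\infty\}$ of hyperbolic elements of $PSL_2(\mathbb{Z})$. $H(\mathbb{Z})$ is the group of all homeomorphisms of $\mathbb{R}\cup\{\infty\}$ that fix $\infty$ and are piecewise in $PSL_2(\mathbb{Z})$ with finitely many pieces, all endpoints of pieces lying in $P_{\mathbb{Z}}$ (this is Monod's group of piecewise projective homeomorphisms over $\mathbb{Z}$). For $g\in H(\mathbb{Z})$, $Br(g)$ is the number of break points of $g$, i.e. the ends of the pieces in its piecewise definition (points at which the left and right germs of $g$ are given by different elements of $PSL_2(\mathbb{Z})$). A group is locally solvable if all its finitely generated subgroups are solvable. Poisson boundary: for a probability measure $\mu$ on a countable group $H$, consider the random walk $x_0=e$, $x_{n+1}=y_nx_n$ with i.i.d. increments $y_n$ of law $\mu$, and let $P$ be the associated Markov measure on the trajectory space $H^{\mathbb{N}}$. Two trajectories $(x_i)$ and $(x'_i)$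 are equivalent if there exist $i_0\in\mathbb{N}$ and $k\in\mathbb{Z}$ such that $x_i=x'_{i+k}$ for all $i>i_0$. The Poisson boundary of $(H,\mu)$ is the quotient of $(H^{\mathbb{N}},P)$ by the measurable hull of this equivalence relation; it is non-trivial if it is not a single point up to null sets. When $\operatorname{supp}(\mu)$ generates $H$ as a semigroup, non-triviality is equivalent to the existence of a non-constant bounded function $f$ on $H$ with $f(g)=\sum_{h\in H}f(hg)\mu(h)$ for all $g\in H$. *)

theory Defs
  imports "HOL-Probability.Probability" "HOL-Algebra.Solvable_Groups"
begin

section \<open>The group \<open>H(\<int>)\<close>\<close>

text \<open>
  The projective line \<open>\<real> \<union> {\<infinity>}\<close> is the type \<^typ>\<open>real option\<close>, with \<^term>\<open>None\<close>
  as the point at infinity and the topology of the one-point compactification.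
\<close>

abbreviation proj_line :: "real option topology" where
  "proj_line \<equiv> Alexandroff_compactification euclideanreal"

definition moebius :: "int^2^2 \<Rightarrow> real option \<Rightarrow> real option" where
  "moebius A \<xi> = (let a = real_of_int (A $ 1 $ 1); b = real_of_int (A $ 1 $ 2);
                      c = real_of_int (A $ 2 $ 1); d = real_of_int (A $ 2 $ 2)
     in case \<xi> of
          None \<Rightarrow> if c = 0 then None else Some (a / c)
        | Some x \<Rightarrow> if c * x + d = 0 then None else Some ((a * x + b) / (c * x + d)))"

definition SL2Z :: "(int^2^2) set" where
  "SL2Z = {A. det A = 1}"

definition PSL2Z :: "(int^2^2) set set" where
  "PSL2Z = SL2Z // {(A, B). B = A \<or> B = - A}"

definition psl_map :: "(int^2^2) set \<Rightarrow> real option \<Rightarrow> real option" where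
  "psl_map p \<xi> = (THE \<eta>. \<forall>A\<in>p. moebius A \<xi> = \<eta>)"

lemma moebius_uminus: "moebius (- A) = moebius A"
proof
  fix \<xi>
  have "- (c * x) - d = 0 \<longleftrightarrow> c * x + d = 0"
    "(- (a * x) - b) / (- (c * x) - d) = (a * x + b) / (c * x + d)" for a b c d x :: real
  proof -
    show "- (c * x) - d = 0 \<longleftrightarrow> c * x + d = 0" by linarith
    show "(- (a * x) - b) / (- (c * x) - d) = (a * x + b) / (c * x + d)"
      using minus_divide_divide [of "- (a * x + b)" "- (c * x + d)"]
      by (metis minus_add_distrib minus_divide_divide uminus_add_conv_diff add.commute)
  qed
  then show "moebius (- A) \<xi> = moebius A \<xi>"
    by (cases \<xi>) (simp_all add: moebius_def)
qed

lemma PSL2Z_iff: "p \<in> PSL2Z \<longleftrightarrow> (\<exists>A\<in>SL2Z. p = {A, - A})"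
  by (auto simp: PSL2Z_def quotient_def)

lemma psl_map_eq: "psl_map {A, - A} = moebius A"
  by (auto simp: psl_map_def moebius_uminus)

definition hyperbolic :: "(int^2^2) set \<Rightarrow> bool" where
  "hyperbolic p \<longleftrightarrow> p \<in> PSL2Z \<and> (\<forall>A\<in>p. \<bar>trace A\<bar> > 2)"

definition P_Z :: "real option set" where
  "P_Z = {\<xi>. \<exists>p. hyperbolic p \<and> psl_map p \<xi> = \<xi>}"

lemma infinity_notin_P_Z: "None \<notin> P_Z"
proof
  assume "None \<in> P_Z"
  then obtain A where A: "A \<in> SL2Z" "hyperbolic {A, -A}" "moebius A None = None"
    unfolding P_Z_def using PSL2Z_iff psl_map_eq hyperbolic_def by (smt (verit) mem_Collect_eq)
  then have c: "A$2$1 = 0" by (auto simp: moebius_def split: if_splits)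
  have "A$1$1 * A$2$2 = 1" using A(1) c by (simp add: SL2Z_def det_2)
  then have "\<bar>A$1$1 + A$2$2\<bar> = 2" by (auto simp: zmult_eq_1_iff)
  moreover have "trace A = A$1$1 + A$2$2" by (simp add: trace_def sum_2)
  moreover have "\<bar>trace A\<bar> > 2" using A(2) by (auto simp: hyperbolic_def)
  ultimately show False by simp
qed

text \<open>
  The pieces are the arcs into which the circle \<open>\<real> \<union> {\<infinity>}\<close> is cut by the finite set
  \<open>F\<close> of their endpoints.  As \<open>\<infinity> \<notin> P_Z\<close>, the point \<open>\<infinity>\<close> lies in the interior of a
  piece.
\<close>

definition piecewise_PSL2Z :: "(real option \<Rightarrow> real option) \<Rightarrow> bool" where
  "piecewise_PSL2Z g \<longleftrightarrow>
     (\<exists>F. finite F \<and> F \<subseteq> P_Z \<and>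
          (\<forall>C\<in>connected_components_of (subtopology proj_line (- F)).
             \<exists>p\<in>PSL2Z. \<forall>\<xi>\<in>C. g \<xi> = psl_map p \<xi>))"

definition monod_HZ :: "(real option \<Rightarrow> real option) monoid" where
  "monod_HZ = \<lparr>carrier = {g. homeomorphic_map proj_line proj_line g \<and> g None = None
                              \<and> piecewise_PSL2Z g},
               monoid.mult = (\<circ>), one = id\<rparr>"

text \<open>
  The circle is oriented so that \<open>\<infinity>\<close> is approached from its left along \<open>+\<infinity>\<close> and
  from its right along \<open>-\<infinity>\<close>.
\<close>

definition left_nhds :: "real option \<Rightarrow> real option filter" where
  "left_nhds \<xi> = filtermap Some (case \<xi> of None \<Rightarrow> at_top | Some x \<Rightarrow> at_left x)"

definition right_nhds :: "real option \<Rightarrow> real option filter" where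
  "right_nhds \<xi> = filtermap Some (case \<xi> of None \<Rightarrow> at_bot | Some x \<Rightarrow> at_right x)"

definition break_points :: "(real option \<Rightarrow> real option) \<Rightarrow> real option set" where
  "break_points g =
     {\<xi>. \<exists>p\<in>PSL2Z. \<exists>q\<in>PSL2Z. p \<noteq> q \<and>
           (\<forall>\<^sub>F \<eta> in left_nhds \<xi>. g \<eta> = psl_map p \<eta>) \<and>
           (\<forall>\<^sub>F \<eta> in right_nhds \<xi>. g \<eta> = psl_map q \<eta>)}"

definition Br :: "(real option \<Rightarrow> real option) \<Rightarrow> nat" where
  "Br g = card (break_points g)"

section \<open>Group-theoretic notions\<close>

definition locally_solvable :: "('a, 'b) monoid_scheme \<Rightarrow> bool" where
  "locally_solvable G \<longleftrightarrow>
     (\<forall>S. finite S \<and> S \<subseteq> carrier G \<longrightarrow> solvable (subgroup_generated G S))"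

inductive_set semigroup_generate :: "('a, 'b) monoid_scheme \<Rightarrow> 'a set \<Rightarrow> 'a set"
  for G (structure) and S where
  incl: "s \<in> S \<Longrightarrow> s \<in> semigroup_generate G S"
| mult: "s \<in> semigroup_generate G S \<Longrightarrow> t \<in> semigroup_generate G S
          \<Longrightarrow> s \<otimes> t \<in> semigroup_generate G S"

section \<open>Random walks and the Poisson boundary\<close>

primrec walk :: "('a, 'b) monoid_scheme \<Rightarrow> (nat \<Rightarrow> 'a) \<Rightarrow> nat \<Rightarrow> 'a" where
  "walk G y 0 = \<one>\<^bsub>G\<^esub>"
| "walk G y (Suc n) = y n \<otimes>\<^bsub>G\<^esub> walk G y n"

text \<open>
  A probability measure on the group is a \<open>pmf\<close> supported on the carrier.  Restricting it to
  the carrier makes trajectories range over \<open>carrier G\<close> rather than over the whole type.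
\<close>

definition walk_measure :: "('a, 'b) monoid_scheme \<Rightarrow> 'a pmf \<Rightarrow> (nat \<Rightarrow> 'a) measure" where
  "walk_measure G \<mu> =
     distr (\<Pi>\<^sub>M n\<in>UNIV. restrict_space (measure_pmf \<mu>) (carrier G))
           (\<Pi>\<^sub>M n\<in>UNIV. count_space (carrier G))
           (walk G)"

lemma prob_space_walk_measure:
  assumes "Group.monoid G" "countable (carrier G)" "set_pmf \<mu> \<subseteq> carrier G"
  shows "prob_space (walk_measure G \<mu>)"
proof -
  interpret Group.monoid G by fact
  let ?M = "restrict_space (measure_pmf \<mu>) (carrier G)"
  have sp: "space ?M = carrier G" by (simp add: space_restrict_space)
  have se: "sets ?M = sets (count_space (carrier G))" by (auto simp: sets_restrict_space)
  have "emeasure ?M (carrier G) = 1" using assms(3)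
    by (simp add: emeasure_restrict_space measure_pmf.emeasure_eq_1_AE AE_measure_pmf_iff subset_iff)
  then have "prob_space ?M" using sp by (intro prob_spaceI) simp
  then interpret P: product_prob_space "\<lambda>_. ?M" "UNIV :: nat set" 
    by (simp add: product_prob_space_def product_prob_space_axioms_def product_sigma_finite_def prob_space_imp_sigma_finite)
  have m: "(\<lambda>y. walk G y n) \<in> measurable (PiM UNIV (\<lambda>_::nat. ?M)) (count_space (carrier G))" for n
  proof (induction n)
    case 0 then show ?case by simp
  next
    case (Suc n)
    have y: "(\<lambda>y. y n) \<in> measurable (PiM UNIV (\<lambda>_::nat. ?M)) (count_space (carrier G))"
      using measurable_component_singleton[of n UNIV "\<lambda>_. ?M"] by (subst measurable_cong_sets[OF refl se, symmetric]) blast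
    have "(\<lambda>y. (y n, walk G y n)) \<in> measurable (PiM UNIV (\<lambda>_::nat. ?M)) (count_space (carrier G) \<Otimes>\<^sub>M count_space (carrier G))"
      using y Suc by (rule measurable_Pair)
    then have "(\<lambda>y. (y n, walk G y n)) \<in> measurable (PiM UNIV (\<lambda>_::nat. ?M)) (count_space (carrier G \<times> carrier G))"
      by (simp add: pair_measure_countable assms)
    from measurable_compose[OF this, of "\<lambda>(a,b). a \<otimes>\<^bsub>G\<^esub> b" "count_space (carrier G)"]
    show ?case by (auto simp: case_prod_beta Pi_iff)
  qed
  have "walk G \<in> measurable (PiM UNIV (\<lambda>_::nat. ?M)) (\<Pi>\<^sub>M n\<in>UNIV. count_space (carrier G))"
    by (rule measurable_PiM_single') (use m in \<open>auto simp: measurable_def\<close>)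
  then show ?thesis unfolding walk_measure_def by (rule P.prob_space_distr)
qed

definition traj_equiv :: "('a, 'b) monoid_scheme \<Rightarrow> ((nat \<Rightarrow> 'a) \<times> (nat \<Rightarrow> 'a)) set" where
  "traj_equiv G =
     {(x, x'). range x \<subseteq> carrier G \<and> range x' \<subseteq> carrier G \<and>
        (\<exists>(i0 :: nat) (k :: int). \<forall>i>i0. 0 \<le> int i + k \<and> x i = x' (nat (int i + k)))}"

lemma equiv_traj_equiv: "equiv (space (walk_measure G \<mu>)) (traj_equiv G)"
  unfolding equiv_def
proof (intro conjI)
  show "traj_equiv G \<subseteq> space (walk_measure G \<mu>) \<times> space (walk_measure G \<mu>)"
    by (auto simp: walk_measure_def space_PiM PiE_def traj_equiv_def)
  show "refl_on (space (walk_measure G \<mu>)) (traj_equiv G)"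
    by (auto simp: refl_on_def walk_measure_def space_PiM PiE_def traj_equiv_def Pi_iff intro!: exI[of _ 0] exI[of _ "0::int"])
  show "sym (traj_equiv G)"
  proof (rule symI)
    fix x x' assume "(x,x') \<in> traj_equiv G"
    then obtain i0 k where h: "range x \<subseteq> carrier G" "range x' \<subseteq> carrier G" 
      "\<forall>i>(i0::nat). 0 \<le> int i + k \<and> x i = x' (nat (int i + k))" by (auto simp: traj_equiv_def)
    have "0 \<le> int i + - k \<and> x' i = x (nat (int i + - k))" if "i > i0 + nat k" for i
      using h(3)[rule_format, of "nat (int i - k)"] that by auto
    then show "(x',x) \<in> traj_equiv G" using h unfolding traj_equiv_def by blast
  qed
  show "trans (traj_equiv G)"
  proof (rule transI)
    fix x y z assume a: "(x,y) \<in> traj_equiv G" "(y,z) \<in> traj_equiv G"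
    obtain i0 k where h: "\<forall>i>(i0::nat). 0 \<le> int i + k \<and> x i = y (nat (int i + k))" using a by (auto simp: traj_equiv_def)
    obtain i1 l where h': "\<forall>i>(i1::nat). 0 \<le> int i + l \<and> y i = z (nat (int i + l))" using a by (auto simp: traj_equiv_def)
    have "0 \<le> int i + (k+l) \<and> x i = z (nat (int i + (k+l)))" if "i > i0 + i1 + nat (-k)" for i
      using h[rule_format, of i] h'[rule_format, of "nat (int i + k)"] that by (auto simp: algebra_simps)
    then show "(x,z) \<in> traj_equiv G" using a unfolding traj_equiv_def by blast
  qed
qed

text \<open>
  The boundary is the set of equivalence classes with the quotient \<open>\<sigma>\<close>-algebra and the
  image of the Markov measure.  Its measurable sets are exactly the measurable unions of
  equivalence classes, i.e. those of the measurable hull; points which they do not separate are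
  not identified, since this does not affect the measure algebra.
\<close>

definition poisson_boundary :: "('a, 'b) monoid_scheme \<Rightarrow> 'a pmf \<Rightarrow> (nat \<Rightarrow> 'a) set measure" where
  "poisson_boundary G \<mu> =
     (let P = walk_measure G \<mu>; \<Omega> = space P // traj_equiv G; cls = (\<lambda>x. traj_equiv G `` {x})
      in distr P (sigma \<Omega> {B. B \<subseteq> \<Omega> \<and> cls -` B \<inter> space P \<in> sets P}) cls)"

lemma poisson_boundary_facts:
  fixes G \<mu>
  defines "P \<equiv> walk_measure G \<mu>"
  shows sets_poisson_boundary: "sets (poisson_boundary G \<mu>) = {B. B \<subseteq> space P // traj_equiv G \<and> \<Union>B \<in> sets P}"
    and measurable_poisson_boundary: "(\<lambda>x. traj_equiv G `` {x}) \<in> measurable P (poisson_boundary G \<mu>)"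
proof -
  let ?c = "\<lambda>x. traj_equiv G `` {x}" let ?O = "space P // traj_equiv G"
  let ?S = "{B. B \<subseteq> ?O \<and> ?c -` B \<inter> space P \<in> sets P}"
  have s: "sigma_algebra ?O ?S"
    unfolding sigma_algebra_iff2
  proof (intro conjI ballI allI impI)
    show "?S \<subseteq> Pow ?O" by auto
    show "{} \<in> ?S" by simp
    fix B assume "B \<in> ?S"
    moreover have "?c -` (?O - B) \<inter> space P = space P - (?c -` B \<inter> space P)" by (auto simp: quotientI)
    ultimately show "?O - B \<in> ?S" by auto
  next
    fix A :: "nat \<Rightarrow> _" assume "range A \<subseteq> ?S"
    moreover have "?c -` (\<Union>i. A i) \<inter> space P = (\<Union>i. ?c -` A i \<inter> space P)" by auto
    moreover have "(\<Union>i. ?c -` A i \<inter> space P) \<in> sets P" using \<open>range A \<subseteq> ?S\<close> by (intro sets.countable_UN) auto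
    ultimately show "(\<Union>i. A i) \<in> ?S" by fastforce
  qed
  have e: "equiv (space P) (traj_equiv G)" unfolding P_def by (rule equiv_traj_equiv)
  have u: "?c -` B \<inter> space P = \<Union>B" if "B \<subseteq> ?O" for B
  proof (intro equalityI subsetI)
    fix x assume "x \<in> ?c -` B \<inter> space P" then show "x \<in> \<Union>B" using equiv_class_self[OF e, of x] by blast
  next
    fix x assume "x \<in> \<Union>B"
    then obtain b where b: "b \<in> B" "x \<in> b" by auto
    have "b \<in> ?O" using b that by blast
    then obtain z where z: "b = ?c z" by (rule quotientE)
    have zx: "(z, x) \<in> traj_equiv G" using b(2) unfolding z by simp
    have "?c x = b" using equiv_class_eq[OF e zx] z by simp
    moreover have "x \<in> space P" using equiv_class_eq_iff[OF e] zx by blast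
    ultimately show "x \<in> ?c -` B \<inter> space P" using b(1) by simp
  qed
  have st: "sets (poisson_boundary G \<mu>) = ?S"
    unfolding poisson_boundary_def Let_def P_def[symmetric]
    using sigma_algebra.sets_measure_of_eq[OF s] by simp
  have "?S = {B. B \<subseteq> ?O \<and> \<Union>B \<in> sets P}"
    by (rule Collect_cong, rule conj_cong[OF refl], subst u, assumption, rule refl)
  with st show "sets (poisson_boundary G \<mu>) = {B. B \<subseteq> ?O \<and> \<Union>B \<in> sets P}"
    by simp
  have "space (poisson_boundary G \<mu>) = ?O"
    unfolding poisson_boundary_def Let_def P_def[symmetric]
    using s by (simp add: space_measure_of_conv)
  then show "?c \<in> measurable P (poisson_boundary G \<mu>)"
    unfolding measurable_def st by (simp add: quotientI)
qed

text \<open>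
  Up to null sets, a probability space is a point if and only if its measurable sets all have
  measure \<open>0\<close> or \<open>1\<close>.  Almost sure equality to a single equivalence class would be the wrong
  condition, as classes are in general null sets even if the boundary is trivial.
\<close>

definition nontrivial_boundary :: "('a, 'b) monoid_scheme \<Rightarrow> 'a pmf \<Rightarrow> bool" where
  "nontrivial_boundary G \<mu> \<longleftrightarrow>
     (\<exists>B\<in>sets (poisson_boundary G \<mu>).
        0 < measure (poisson_boundary G \<mu>) B \<and> measure (poisson_boundary G \<mu>) B < 1)"

end

theory Submission
  imports Defs
begin

text \<open>
  The jump of the logarithmic derivative of \<open>g\<close> at \<open>x\<close> is an additive cocycle which is nonzero only
  at break points.  Along the random walk its value at a fixed \<open>x\<close> changes only when the orbit of
  \<open>x\<close> meets a break point of the next increment.  If two elements of \<open>H\<close> play ping-pong on a set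
  containing \<open>x\<close>, the Schreier graph of the orbit of \<open>x\<close> carries the finite energy flow of a
  binary tree, hence the induced walk on it is transient with bounded Green function; together with
  the finite first break moment and Borel--Cantelli, the cocycle at \<open>x\<close> converges almost surely.
  Its limit is an invariant function, and it is not almost surely constant as soon as some element
  of \<open>H\<close> fixes \<open>x\<close> with nonzero jump, since multiplying by this element shifts the limit.

  If no such \<open>x\<close> admits a ping-pong pair, then a finitely generated subgroup is solvable: a
  nontrivial element of the \<open>n\<close>-th derived subgroup yields a nested sequence of \<open>n\<close> points with
  nonzero jump lying in distinct orbits, whereas such points lie in the finitely many orbits of the
  break points of the generators.
\<close>

section \<open>Non-solvable groups acting on the line\<close>

text \<open>Two facts about germs in \<open>PSL2Z\<close> drive the solvability half. Germs fixing a
  common point commute, so commutators act trivially beside it. And a nontrivial germ with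
  derivative 1 at a fixed point is parabolic, with rational fixed point, whereas points of
  \<open>P_Z\<close> are irrational; so the jump detects every element that is trivial just left of
  a fixed point but not just right of it. These are axioms of \<open>line_action\<close>, with
  \<open>C\<close> for the jump.

  What remains is that each group element permutes points and so preserves counting measure: pairing
  the Green equation with the Green function itself bounds its differences along every generator.
  Increments multiply on the left, so the step from time \<open>n\<close> changes the cocycle at
  \<open>x\<close> by the value of the increment at the current orbit point. Summed over all points,
  the probability that an increment has a nonzero jump there is the expected number of its jumps, at
  most E[Br]; a Green function bounded uniformly over points thus makes the expected number of
  changes finite.\<close>

locale line_action = Group.group G for G (structure) +
  fixes act :: "'a \<Rightarrow> real \<Rightarrow> real"
    and C :: "'a \<Rightarrow> real \<Rightarrow> real"
  assumes act_mult: "g \<in> carrier G \<Longrightarrow> h \<in> carrier G \<Longrightarrow> act (g \<otimes> h) x = act g (act h x)"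
    and act_one: "act \<one> x = x"
    and act_mono: "g \<in> carrier G \<Longrightarrow> x < y \<Longrightarrow> act g x < act g y"
    and act_faithful: "g \<in> carrier G \<Longrightarrow> (\<And>x. act g x = x) \<Longrightarrow> g = \<one>"
    and fixed_accumulate: "g \<in> carrier G \<Longrightarrow> \<exists>\<^sub>F t in at_left x. act g t = t
          \<Longrightarrow> \<forall>\<^sub>F t in at_left x. act g t = t"
    and right_germs_commute: "g \<in> carrier G \<Longrightarrow> h \<in> carrier G \<Longrightarrow> act g x = x \<Longrightarrow> act h x = x
          \<Longrightarrow> \<forall>\<^sub>F t in at_right x. act g (act h t) = act h (act g t)"
    and germs_commute_at_bot: "g \<in> carrier G \<Longrightarrow> h \<in> carrier G
          \<Longrightarrow> \<forall>\<^sub>F t in at_bot. act g (act h t) = act h (act g t)"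
    and C_mult: "g \<in> carrier G \<Longrightarrow> h \<in> carrier G \<Longrightarrow> C (g \<otimes> h) x = C g (act h x) + C h x"
    and finite_C: "g \<in> carrier G \<Longrightarrow> finite {x. C g x \<noteq> 0}"
    and C_nonzero: "g \<in> carrier G \<Longrightarrow> act g x = x \<Longrightarrow> \<forall>\<^sub>F t in at_left x. act g t = t
          \<Longrightarrow> \<not> (\<forall>\<^sub>F t in at_right x. act g t = t) \<Longrightarrow> C g x \<noteq> 0"
begin

section \<open>Order-preserving actions and their germs\<close>

lemma act_inv [simp]:
  assumes "g \<in> carrier G"
  shows "act (inv g) (act g x) = x" "act g (act (inv g) x) = x"
  using assms act_mult[of "inv g" g x] act_mult[of g "inv g" x] act_one by auto

lemma act_less_iff [simp]: "g \<in> carrier G \<Longrightarrow> act g x < act g y \<longleftrightarrow> x < y"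
  by (metis act_mono less_asym less_irrefl linorder_less_linear)

lemma act_le_iff [simp]: "g \<in> carrier G \<Longrightarrow> act g x \<le> act g y \<longleftrightarrow> x \<le> y"
  using act_less_iff[of g y x] by (simp add: not_less[symmetric])

lemma act_eq_iff [simp]: "g \<in> carrier G \<Longrightarrow> act g x = act g y \<longleftrightarrow> x = y"
  by (metis act_inv(1))

lemma act_less_inv_iff: "g \<in> carrier G \<Longrightarrow> act g x < y \<longleftrightarrow> x < act (inv g) y"
  by (metis act_inv(2) act_less_iff)

lemma act_le_inv_iff: "g \<in> carrier G \<Longrightarrow> act g x \<le> y \<longleftrightarrow> x \<le> act (inv g) y"
  by (metis act_inv(2) act_le_iff)

lemma act_eq_inv_iff: "g \<in> carrier G \<Longrightarrow> act g x = y \<longleftrightarrow> x = act (inv g) y"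
  by (metis act_inv(1,2))

text \<open>Monotonicity does the work of continuity: if \<open>g\<close> moves \<open>x\<close>
  down, a fixed point \<open>t\<close> with \<open>act g x < t < x\<close> would satisfy
  \<open>t = act g t < act g x\<close>; if it moves \<open>x\<close> up, the same applies to
  \<open>inv g\<close>.\<close>

lemma fixed_at_left_limit:
  assumes g: "g \<in> carrier G" and f: "\<exists>\<^sub>F t in at_left x. act g t = t"
  shows "act g x = x"
proof -
  have ex: "\<exists>t. y < t \<and> t < x \<and> act g t = t" if "y < x" for y
    using f that unfolding frequently_def eventually_at_left_field by (metis le_less_trans not_less)
  show ?thesis
  proof (rule ccontr)
    assume "act g x \<noteq> x"
    then consider "act g x < x" | "act (inv g) x < x" using act_less_inv_iff[OF g, of x x]
      by (metis act_inv(2) act_less_iff g linorder_cases)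
    then show False
    proof cases
      case 1 then show False using ex[of "act g x"] g by (metis act_less_iff less_asym)
    next
      case 2 then show False using ex[of "act (inv g) x"] g by (metis act_inv(2) act_less_iff less_asym)
    qed
  qed
qed

lemma filterlim_act_at_right:
  assumes g: "g \<in> carrier G" and "act g x = x"
  shows "filterlim (act g) (at_right x) (at_right x)"
  unfolding filterlim_iff eventually_at_right_field
proof (intro allI impI)
  fix P assume "\<exists>b>x. \<forall>y>x. y < b \<longrightarrow> P y"
  then obtain b where b: "b > x" "\<And>y. x < y \<Longrightarrow> y < b \<Longrightarrow> P y" by blast
  show "\<exists>b>x. \<forall>y>x. y < b \<longrightarrow> P (act g y)"
  proof (intro exI[of _ "act (inv g) b"] conjI allI impI)
    show "act (inv g) b > x" using b(1) assms by (metis act_less_inv_iff)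
    fix y assume "x < y" "y < act (inv g) b"
    then show "P (act g y)" using assms b(2) act_less_inv_iff[OF g] act_less_iff[OF g] by metis
  qed
qed

lemma filterlim_act_at_bot:
  assumes g: "g \<in> carrier G"
  shows "filterlim (act g) at_bot at_bot"
  unfolding filterlim_at_bot eventually_at_bot_linorder
  using act_le_inv_iff[OF g] by blast

text \<open>In a commutator of \<open>g\<close> and \<open>h\<close> the factor
  \<open>inv g \<otimes> inv h\<close> acts first and stays inside the filter by \<open>lim\<close>,
  so \<open>g\<close> and \<open>h\<close> may be exchanged at the moved point. The filters in use
  are \<open>at_right p\<close> and \<open>at_bot\<close>.\<close>

lemma derived_germ_trivial:
  assumes L: "subgroup L G"
    and lim: "\<And>l. l \<in> L \<Longrightarrow> filterlim (act l) F F"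
    and comm: "\<And>l m. l \<in> L \<Longrightarrow> m \<in> L \<Longrightarrow> \<forall>\<^sub>F t in F. act l (act m t) = act m (act l t)"
    and k: "k \<in> derived G L"
  shows "\<forall>\<^sub>F t in F. act k t = t"
proof -
  define R where "R = {g \<in> carrier G. \<forall>\<^sub>F t in F. act g t = t}"
  have car: "L \<subseteq> carrier G" using subgroup.subset[OF L] .
  have "subgroup R G"
  proof (rule subgroupI)
    show "R \<subseteq> carrier G" by (auto simp: R_def)
    show "R \<noteq> {}" using act_one by (auto simp: R_def)
    fix a assume a: "a \<in> R"
    then show "inv a \<in> R" unfolding R_def
      by (auto elim!: eventually_mono) (metis act_inv(1))
    fix b assume b: "b \<in> R"
    have "\<forall>\<^sub>F t in F. act a t = t \<and> act b t = t" using a b by (auto simp: R_def intro: eventually_conj)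
    then show "a \<otimes> b \<in> R" using a b unfolding R_def
      by (auto elim!: eventually_mono simp: act_mult)
  qed
  moreover have "derived_set G L \<subseteq> R"
  proof
    fix x assume "x \<in> derived_set G L"
    then obtain g h where gh: "g \<in> L" "h \<in> L" and x: "x = g \<otimes> h \<otimes> inv g \<otimes> inv h" by auto
    have c: "g \<in> carrier G" "h \<in> carrier G" using gh car by auto
    have m: "inv g \<otimes> inv h \<in> L" using gh L by (simp add: subgroup.m_closed subgroup.m_inv_closed)
    from filterlim_iff[THEN iffD1, OF lim[OF m], rule_format, OF comm[OF gh]]
    have "\<forall>\<^sub>F t in F. act x t = t"
    proof eventually_elim
      case (elim t)
      have "act x t = act g (act h (act (inv g \<otimes> inv h) t))" using c by (simp add: x act_mult)
      also have "\<dots> = act h (act g (act (inv g \<otimes> inv h) t))" using elim by simp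
      also have "\<dots> = t" using c by (simp add: act_mult)
      finally show ?case .
    qed
    then show "x \<in> R" using c by (simp add: R_def x)
  qed
  ultimately have "derived G L \<subseteq> R" unfolding derived_def by (rule generate_subgroup_incl[rotated])
  then show ?thesis using k by (auto simp: R_def)
qed

section \<open>Break points of stabilisers, and ping-pong\<close>

text \<open>By \<open>C_nonzero\<close>, these points are fixed by elements with nonzero jump. The
  one-sided form is what scanning an element from the left produces, see
  \<open>first_break\<close>.\<close>

definition Phi :: "real set" where
  "Phi = {x. \<exists>g\<in>carrier G. act g x = x \<and> (\<forall>\<^sub>F t in at_left x. act g t = t)
              \<and> \<not> (\<forall>\<^sub>F t in at_right x. act g t = t)}"

definition ping_pong :: "real \<Rightarrow> bool" where
  "ping_pong x \<longleftrightarrow> (\<exists>a\<in>carrier G. \<exists>b\<in>carrier G. \<exists>I. x \<in> I \<and> act a ` I \<subseteq> I \<and> act b ` I \<subseteq> I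
                       \<and> act a ` I \<inter> act b ` I = {})"

lemma eventually_at_left_act:
  assumes g: "g \<in> carrier G" and P: "\<forall>\<^sub>F t in at_left x. P t"
  shows "\<forall>\<^sub>F t in at_left (act g x). P (act (inv g) t)"
proof -
  obtain b where b: "b < x" "\<And>t. b < t \<Longrightarrow> t < x \<Longrightarrow> P t"
    using P unfolding eventually_at_left_field by blast
  show ?thesis unfolding eventually_at_left_field
  proof (intro exI[of _ "act g b"] conjI allI impI)
    show "act g b < act g x" using b(1) g by simp
    fix t assume "act g b < t" "t < act g x"
    then show "P (act (inv g) t)" using g b(2) by (metis act_inv(2) act_less_iff)
  qed
qed

lemma eventually_at_right_act:
  assumes g: "g \<in> carrier G" and P: "\<forall>\<^sub>F t in at_right x. P t"
  shows "\<forall>\<^sub>F t in at_right (act g x). P (act (inv g) t)"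
proof -
  obtain b where b: "b > x" "\<And>t. x < t \<Longrightarrow> t < b \<Longrightarrow> P t"
    using P unfolding eventually_at_right_field by blast
  show ?thesis unfolding eventually_at_right_field
  proof (intro exI[of _ "act g b"] conjI allI impI)
    show "act g b > act g x" using b(1) g by simp
    fix t assume "act g x < t" "t < act g b"
    then show "P (act (inv g) t)" using g b(2) by (metis act_inv(2) act_less_iff)
  qed
qed

lemma Phi_act:
  assumes "x \<in> Phi" and h: "h \<in> carrier G"
  shows "act h x \<in> Phi"
proof -
  obtain g where g: "g \<in> carrier G" "act g x = x" "\<forall>\<^sub>F t in at_left x. act g t = t"
    "\<not> (\<forall>\<^sub>F t in at_right x. act g t = t)" using assms by (auto simp: Phi_def)
  let ?k = "h \<otimes> g \<otimes> inv h"
  have k: "?k \<in> carrier G" using g h by simp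
  have e: "act ?k t = t \<longleftrightarrow> act g (act (inv h) t) = act (inv h) t" for t
    using g(1) h by (simp add: act_mult act_eq_inv_iff)
  have "act ?k (act h x) = act h x" using g h by (simp add: act_mult)
  moreover have "\<forall>\<^sub>F t in at_left (act h x). act ?k t = t"
    unfolding e using eventually_at_left_act[OF h g(3)] .
  moreover have "\<not> (\<forall>\<^sub>F t in at_right (act h x). act ?k t = t)"
  proof
    assume "\<forall>\<^sub>F t in at_right (act h x). act ?k t = t"
    from eventually_at_right_act[OF inv_closed[OF h] this]
    have "\<forall>\<^sub>F t in at_right x. act ?k (act h t) = act h t" using h by simp
    then show False using g(4) h unfolding e by simp
  qed
  ultimately show ?thesis using k unfolding Phi_def by blast
qed

text \<open>The infimum \<open>z\<close> of the points beyond \<open>y\<close> that \<open>k\<close>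
  moves is the required point: everything between \<open>y\<close> and \<open>z\<close> is fixed,
  hence so is \<open>z\<close>, and a trivial right germ at \<open>z\<close> would make the infimum
  larger.\<close>

lemma first_break:
  assumes k: "k \<in> carrier G" and "y < w" and idl: "\<And>t. y < t \<Longrightarrow> t < w \<Longrightarrow> act k t = t"
    and v: "act k v \<noteq> v" "y < v"
  shows "\<exists>z\<in>Phi. y < z \<and> z \<le> v"
proof -
  define A where "A = {t. y < t \<and> act k t \<noteq> t}"
  define z where "z = Inf A"
  have bd: "bdd_below A" unfolding A_def by (auto intro!: bdd_belowI[of _ y])
  have vA: "v \<in> A" using v by (simp add: A_def)
  have "w \<le> t" if "t \<in> A" for t using that idl[of t] unfolding A_def by (auto simp: not_less[symmetric])
  then have wz: "w \<le> z" unfolding z_def using vA by (intro cInf_greatest) auto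
  have yz: "y < z" using wz \<open>y < w\<close> by simp
  have zv: "z \<le> v" unfolding z_def using vA bd by (rule cInf_lower)
  have idz: "act k t = t" if "y < t" "t < z" for t
    using that cInf_lower[OF _ bd, of t] unfolding z_def A_def by (auto simp: not_le[symmetric])
  have left: "\<forall>\<^sub>F t in at_left z. act k t = t"
    unfolding eventually_at_left_field using yz idz by blast
  have fz: "act k z = z"
    by (rule fixed_at_left_limit[OF k]) (intro eventually_frequently left, simp)
  have "\<not> (\<forall>\<^sub>F t in at_right z. act k t = t)"
  proof
    assume "\<forall>\<^sub>F t in at_right z. act k t = t"
    then obtain b where b: "b > z" "\<And>t. z < t \<Longrightarrow> t < b \<Longrightarrow> act k t = t"
      unfolding eventually_at_right_field by blast
    have "b \<le> t" if "t \<in> A" for t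
    proof (rule ccontr)
      assume "\<not> b \<le> t"
      then have "act k t = t" using that fz b(2)[of t] idz[of t] unfolding A_def
        by (cases t z rule: linorder_cases) auto
      then show False using that by (simp add: A_def)
    qed
    then have "b \<le> z" unfolding z_def using vA by (intro cInf_greatest) auto
    then show False using b by simp
  qed
  then show ?thesis using k fz left yz zv unfolding Phi_def by blast
qed

section \<open>Orbits pushed down to a common fixed point\<close>

text \<open>\<open>p\<close> is meant as the infimum of an \<open>L\<close>-orbit and
  \<open>q\<close> as a point of that orbit, see \<open>hull_left_Inf_orbit\<close>.\<close>

definition hull_left :: "'a set \<Rightarrow> real \<Rightarrow> real \<Rightarrow> bool" where
  "hull_left L p q \<longleftrightarrow> subgroup L G \<and> (\<forall>l\<in>L. act l p = p) \<and> p < q \<and>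
     (\<forall>y z. p < y \<longrightarrow> y < q \<longrightarrow> p < z \<longrightarrow> (\<exists>l\<in>L. act l y < z))"

text \<open>If \<open>p < g p < q\<close>, suitable elements of \<open>L\<close> and \<open>L g\<close> play ping-pong on a short interval
  \<open>[p, d]\<close>, into which \<open>L\<close> moves any point of \<open>Phi\<close> in \<open>[p, q)\<close>.  If there is no such point, then \<open>L\<close> and
  \<open>g\<close> fix the supremum \<open>P\<close> of \<open>Phi\<close> below \<open>p\<close>, so their commutators are trivial just
  after \<open>P\<close> and can only become nontrivial at a point of \<open>Phi\<close> after \<open>P\<close>.\<close>

lemma hull_left_avoids_orbit:
  assumes hl: "hull_left L p q" and L_bot: "\<And>l. l \<in> L \<Longrightarrow> \<forall>\<^sub>F t in at_bot. act l t = t"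
    and no_pp: "\<And>x. x \<in> Phi \<Longrightarrow> \<not> ping_pong x"
    and g: "g \<in> carrier G" and gp: "p < act g p" "act g p < q"
  shows False
proof -
  have L: "subgroup L G" and fix_p: "\<And>l. l \<in> L \<Longrightarrow> act l p = p"
    and sh: "\<And>y z. p < y \<Longrightarrow> y < q \<Longrightarrow> p < z \<Longrightarrow> \<exists>l\<in>L. act l y < z" and pq: "p < q"
    using hl unfolding hull_left_def by blast+
  have Lc: "l \<in> L \<Longrightarrow> l \<in> carrier G" for l using subgroup.subset[OF L] by blast
  have Lp: "p < act l x \<longleftrightarrow> p < x" "p \<le> act l x \<longleftrightarrow> p \<le> x" if "l \<in> L" for l x
    using fix_p[OF that] act_less_iff[OF Lc[OF that]] act_le_iff[OF Lc[OF that]] by metis+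
  have noPhi: "Phi \<inter> {p..<q} = {}"
  proof (rule ccontr)
    assume "Phi \<inter> {p..<q} \<noteq> {}"
    then obtain x where x: "x \<in> Phi" "p \<le> x" "x < q" by auto
    \<comment> \<open>With \<open>d\<close> below \<open>act (inv g) q\<close>, the point
      \<open>act g d\<close> stays below \<open>q\<close>, within reach of \<open>L\<close>.\<close>
    have "p < min q (act (inv g) q)" using pq gp(2) act_less_inv_iff[OF g] by simp
    then obtain d where d: "p < d" "d < q" "d < act (inv g) q" using dense by (metis min_less_iff_conj)
    have gd: "act g d < q" using d act_less_inv_iff[OF g] by simp
    have "p < act g d" using gp(1) d(1) g by (meson act_less_iff less_trans)
    \<comment> \<open>\<open>m\<close> pulls the image of \<open>[p, d]\<close> under
      \<open>g\<close> back below \<open>d\<close>. Its left end stays above \<open>p\<close>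
      because \<open>m\<close> fixes \<open>p\<close>, which leaves room for \<open>n\<close> to
      squeeze \<open>[p, d]\<close> underneath.\<close>
    then obtain m where m: "m \<in> L" "act m (act g d) < d" using sh gd d by blast
    have mgp: "p < act m (act g p)" using Lp[OF m(1)] gp by simp
    then obtain n where n: "n \<in> L" "act n d < act m (act g p)" using sh d by blast
    let ?I = "{p..d}"
    have "act n ` ?I \<subseteq> {p..act n d}" using Lp[OF n(1)] Lc[OF n(1)] by auto
    moreover have "act (m \<otimes> g) ` ?I \<subseteq> {act m (act g p)..act m (act g d)}"
      using Lc[OF m(1)] g by (auto simp: act_mult)
    moreover have "act n d < d" using n(2) m g d(1) Lc by (meson act_less_iff less_trans)
    ultimately have I: "act n ` ?I \<subseteq> ?I" "act (m \<otimes> g) ` ?I \<subseteq> ?I" "act n ` ?I \<inter> act (m \<otimes> g) ` ?I = {}"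
      using n(2) mgp m(2) by force+
    have mg: "m \<otimes> g \<in> carrier G" "n \<in> carrier G" using Lc m n g by auto
    have "\<exists>l\<in>L. act l x \<in> ?I"
    proof (cases "x = p")
      case True then show ?thesis using m(1) fix_p d by auto
    next
      case False
      then obtain l where "l \<in> L" "act l x < d" using sh x d by (metis less_eq_real_def)
      then show ?thesis using Lp x by (intro bexI[of _ l]) auto
    qed
    then obtain l where l: "l \<in> L" "act l x \<in> ?I" by blast
    have "ping_pong (act l x)" unfolding ping_pong_def using I mg l(2) by blast
    then show False using no_pp[OF Phi_act[OF x(1) Lc[OF l(1)]]] by blast
  qed
  obtain l where l: "l \<in> L" "act l (act g p) < act g p" using sh[OF gp gp(1)] by blast
  define A where "A = Phi \<inter> {..<p}"
  define P where "P = Sup A"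
  have bd: "bdd_above A" unfolding A_def by (auto intro!: bdd_aboveI[of _ p])
  \<comment> \<open>\<open>l\<close> is trivial near minus infinity and moves
    \<open>act g p\<close>, so its first break lies in \<open>Phi\<close> at or below
    \<open>act g p\<close>, and \<open>noPhi\<close> puts it below \<open>p\<close>.\<close>
  have ne: "A \<noteq> {}"
  proof -
    obtain s where s: "\<And>t. t \<le> s \<Longrightarrow> act l t = t"
      using L_bot[OF l(1)] unfolding eventually_at_bot_linorder by blast
    let ?w = "min s (act g p)"
    obtain z where "z \<in> Phi" "z \<le> act g p"
      using first_break[OF Lc[OF l(1)], of "?w - 1" ?w "act g p"] s l(2) by force
    then have "z \<in> A" using noPhi gp(2) unfolding A_def by force
    then show ?thesis by blast
  qed
  have Pp: "P \<le> p" unfolding P_def using ne by (intro cSup_least) (auto simp: A_def)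
  \<comment> \<open>\<open>Phi\<close> is invariant and avoids \<open>[p, q)\<close>, so any
    \<open>h\<close> carrying \<open>p\<close> into this interval preserves the part of
    \<open>Phi\<close> below \<open>p\<close>, hence its supremum. This covers \<open>g\<close> and
    \<open>l\<close> alike.\<close>
  have fixP: "act h P = P" if h: "h \<in> carrier G" and hp: "p \<le> act h p" "act h p < q" for h
  proof (rule antisym)
    have "x \<le> act (inv h) P" if x: "x \<in> A" for x
    proof -
      have "act h x < act h p" using x h by (simp add: A_def)
      then have "act h x \<in> A" using x noPhi hp Phi_act[OF _ h, of x] unfolding A_def by force
      then have "act h x \<le> P" unfolding P_def using bd by (rule cSup_upper)
      then show ?thesis using act_le_inv_iff[OF h] by simp
    qed
    then have "P \<le> act (inv h) P" unfolding P_def using ne by (intro cSup_least) auto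
    then show "act h P \<le> P" using act_le_inv_iff[OF h] by simp
    have "x \<le> act h P" if x: "x \<in> A" for x
    proof -
      have "act (inv h) x < p" using x hp act_less_inv_iff[of "inv h" x p] h unfolding A_def by auto
      then have "act (inv h) x \<in> A" using x Phi_act[of x "inv h"] h unfolding A_def by auto
      then have "act (inv h) x \<le> P" unfolding P_def using bd by (rule cSup_upper)
      then show ?thesis using act_le_inv_iff[of "inv h"] h by simp
    qed
    then show "P \<le> act h P" unfolding P_def using ne by (intro cSup_least) auto
  qed
  have gP: "act g P = P" using fixP[OF g] gp by simp
  have lP: "act l P = P" using fixP[OF Lc[OF l(1)]] fix_p[OF l(1)] pq by simp
  have "P < p" using Pp gP gp by (cases "P = p") auto
  have lc: "l \<in> carrier G" using Lc l by blast
  obtain w where w: "w > P" "\<And>t. P < t \<Longrightarrow> t < w \<Longrightarrow> act l (act g t) = act g (act l t)"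
    using right_germs_commute[OF lc g lP gP] unfolding eventually_at_right_field by blast
  \<comment> \<open>This commutator moves \<open>p\<close>, since \<open>l\<close> fixes
    \<open>p\<close> but lowers \<open>act g p\<close>.\<close>
  let ?k = "inv (g \<otimes> l) \<otimes> (l \<otimes> g)"
  have k: "act ?k t = t \<longleftrightarrow> act l (act g t) = act g (act l t)" for t
    using g lc act_eq_inv_iff[of "inv (g \<otimes> l)"] by (simp add: act_mult)
  have "?k \<in> carrier G" using g lc by simp
  moreover have "act ?k p \<noteq> p" unfolding k using l fix_p by auto
  ultimately obtain z where "z \<in> Phi" "P < z" "z \<le> p"
    using first_break[of ?k P w p] w k \<open>P < p\<close> by blast
  then have "z \<in> A" using noPhi pq unfolding A_def by force
  then show False using cSup_upper[OF _ bd] \<open>P < z\<close> unfolding P_def by force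
qed

text \<open>\<open>L\<close> permutes the orbit of \<open>y\<close>, so it fixes the infimum, which
  exists because all of \<open>L\<close> is trivial below some common \<open>s\<close>. The infimum
  is not attained since \<open>l0\<close> moves \<open>y\<close>. Orbit points
  \<open>act k y\<close> come arbitrarily near it, and \<open>k \<otimes> inv m\<close> carries
  everything below \<open>act m y\<close> beneath such a point.\<close>

lemma hull_left_Inf_orbit:
  assumes L: "subgroup L G" and bot: "\<forall>\<^sub>F t in at_bot. \<forall>l\<in>L. act l t = t"
    and l0: "l0 \<in> L" "act l0 y \<noteq> y" and m: "m \<in> L"
  defines "p \<equiv> Inf ((\<lambda>l. act l y) ` L)"
  shows "hull_left L p (act m y)" and "p \<le> act m y" and "\<forall>l\<in>L. act l p = p"
    and "\<And>e. (\<And>l. l \<in> L \<Longrightarrow> act l e = e) \<Longrightarrow> e \<le> y \<Longrightarrow> e \<le> p"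
proof -
  have Lc: "l \<in> L \<Longrightarrow> l \<in> carrier G" for l using subgroup.subset[OF L] by blast
  have Lm: "l \<in> L \<Longrightarrow> m \<in> L \<Longrightarrow> l \<otimes> m \<in> L" "l \<in> L \<Longrightarrow> inv l \<in> L" for l m
    using L by (simp_all add: subgroup.m_closed subgroup.m_inv_closed)
  let ?O = "(\<lambda>l. act l y) ` L"
  have ne: "?O \<noteq> {}" using l0 by auto
  have low: "e \<le> p" if "\<And>l. l \<in> L \<Longrightarrow> act l e = e" "e \<le> y" for e
    unfolding p_def
  proof (rule cInf_greatest[OF ne])
    fix x assume "x \<in> ?O"
    then obtain l where "l \<in> L" "x = act l y" by auto
    then show "e \<le> x" using that act_le_iff[OF Lc, of l e y] by simp
  qed
  then show "\<And>e. (\<And>l. l \<in> L \<Longrightarrow> act l e = e) \<Longrightarrow> e \<le> y \<Longrightarrow> e \<le> p" .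
  obtain s where s: "\<And>t l. t \<le> s \<Longrightarrow> l \<in> L \<Longrightarrow> act l t = t"
    using bot unfolding eventually_at_bot_linorder by blast
  have "s \<le> y" using s[of y l0] l0 by (cases "y \<le> s") auto
  have bd: "bdd_below ?O"
    using act_le_iff[OF Lc, of _ s y] s[of s] \<open>s \<le> y\<close> by (auto intro!: bdd_belowI[of _ s])
  have le: "p \<le> act l y" if "l \<in> L" for l unfolding p_def using bd that by (intro cInf_lower) auto
  show "p \<le> act m y" using le m .
  have inv_le: "act l p \<le> p" if "l \<in> L" for l
  proof -
    have "act l p \<le> act k y" if "k \<in> L" for k
      using le[of "inv l \<otimes> k"] Lm \<open>l \<in> L\<close> that Lc by (simp add: act_le_inv_iff act_mult)
    then show ?thesis unfolding p_def using ne by (intro cInf_greatest) auto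
  qed
  show fixp: "\<forall>l\<in>L. act l p = p"
  proof
    fix l assume l: "l \<in> L"
    show "act l p = p" using inv_le[OF l] inv_le[OF Lm(2)[OF l]] act_le_inv_iff[of "inv l" p p] Lc[OF l]
      by (intro antisym) simp_all
  qed
  have "p < act m y"
  proof (rule ccontr)
    assume "\<not> p < act m y"
    then have "act m y = p" using le[OF m] by simp
    then have "y = p" using fixp Lm(2)[OF m] act_eq_inv_iff[OF Lc[OF m]] by simp
    then show False using fixp l0 by auto
  qed
  moreover have "\<exists>l\<in>L. act l x < z" if "p < x" "x < act m y" "p < z" for x z
  proof -
    obtain k where k: "k \<in> L" "act k y < z"
      using cInf_lessD[OF ne, of z] \<open>p < z\<close> unfolding p_def by auto
    have "act (k \<otimes> inv m) x < act k y"
      using that(2) Lc m k by (simp add: act_mult act_less_inv_iff)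
    then show ?thesis using k Lm m by (intro bexI[of _ "k \<otimes> inv m"]) auto
  qed
  ultimately show "hull_left L p (act m y)" unfolding hull_left_def using L fixp by blast
qed


lemma generate_fixed:
  assumes "S \<subseteq> carrier G" "\<And>s. s \<in> S \<Longrightarrow> act s x = x" "l \<in> generate G S"
  shows "act l x = x"
  using assms(3)
proof (induction rule: generate.induct)
  case (inv h) then show ?case using assms(1,2) act_eq_inv_iff[of h x x] by force
next
  case (eng h1 h2) then show ?case using generate_in_carrier[OF assms(1)] by (simp add: act_mult)
qed (use assms act_one in auto)

section \<open>The last break before a moved point\<close>

text \<open>Only the interior of the common fixed-point set counts, so isolated common fixed points
  before \<open>x\<close> are ignored.\<close>

definition last_fixed :: "'a set \<Rightarrow> real \<Rightarrow> real" where
  "last_fixed S x = Sup {t. t < x \<and> (\<forall>\<^sub>F r in nhds t. \<forall>s\<in>S. act s r = r)}"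

text \<open>The set \<open>U\<close> of the proof is open to the right, so it cannot contain its
  supremum \<open>e\<close>, and it accumulates at \<open>e\<close> from the left. Then
  \<open>fixed_accumulate\<close> upgrades the accumulating fixed points to trivial left germs,
  while trivial right germs would put \<open>e\<close> into \<open>U\<close>.\<close>

lemma last_fixed:
  assumes S: "finite S" "S \<subseteq> carrier G" and bot: "\<And>s. s \<in> S \<Longrightarrow> \<forall>\<^sub>F t in at_bot. act s t = t"
    and s0: "s0 \<in> S" "act s0 x \<noteq> x"
  defines "e \<equiv> last_fixed S x"
  shows "e < x" and "s \<in> S \<Longrightarrow> act s e = e" and "s \<in> S \<Longrightarrow> \<forall>\<^sub>F t in at_left e. act s t = t"
    and "\<exists>s\<in>S. \<not> (\<forall>\<^sub>F t in at_right e. act s t = t)"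
    and "\<And>t. e < t \<Longrightarrow> t < x \<Longrightarrow> \<not> (\<forall>\<^sub>F r in nhds t. \<forall>s\<in>S. act s r = r)"
    and "\<And>t. t < x \<Longrightarrow> \<forall>\<^sub>F r in nhds t. \<forall>s\<in>S. act s r = r \<Longrightarrow> t < e"
proof -
  define U where "U = {t. t < x \<and> (\<forall>\<^sub>F r in nhds t. \<forall>s\<in>S. act s r = r)}"
  have e: "e = Sup U" by (simp add: e_def last_fixed_def U_def)
  have bd: "bdd_above U" unfolding U_def by (auto intro!: bdd_aboveI[of _ x])
  have up: "t \<le> e" if "t \<in> U" for t unfolding e using that bd by (rule cSup_upper)
  have fixU: "act s t = t" if "t \<in> U" "s \<in> S" for s t
    using that eventually_nhds_x_imp_x[of _ t] unfolding U_def by blast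
  have right_U: "\<exists>b>t. \<forall>r. t < r \<and> r < b \<longrightarrow> r \<in> U" if "t \<in> U" for t
  proof -
    have "\<forall>\<^sub>F r in nhds t. \<forall>\<^sub>F r' in nhds r. \<forall>s\<in>S. act s r' = r'"
      using that by (simp add: U_def eventually_eventually)
    moreover have "\<forall>\<^sub>F r in nhds t. r < x" using that by (intro eventually_nhds_in_open[of "{..<x}", simplified]) (auto simp: U_def)
    ultimately have "\<forall>\<^sub>F r in nhds t. r \<in> U" by eventually_elim (simp add: U_def)
    then have "\<forall>\<^sub>F r in at_right t. r \<in> U" by (auto simp: eventually_at_filter elim: eventually_mono)
    then show ?thesis unfolding eventually_at_right_field by auto
  qed
  have "\<forall>\<^sub>F t in at_bot. \<forall>s\<in>S. act s t = t" using bot S by (simp add: eventually_ball_finite)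
  then obtain b where b: "\<And>t s. t \<le> b \<Longrightarrow> s \<in> S \<Longrightarrow> act s t = t" unfolding eventually_at_bot_linorder by blast
  have "min b x - 1 \<in> U"
  proof -
    have "\<forall>\<^sub>F r in nhds (min b x - 1). r < b" by (intro eventually_nhds_in_open[of "{..<b}", simplified]) auto
    then have "\<forall>\<^sub>F r in nhds (min b x - 1). \<forall>s\<in>S. act s r = r" by eventually_elim (simp add: b)
    then show ?thesis by (simp add: U_def min_def)
  qed
  then have ne: "U \<noteq> {}" by blast
  have eU: "e \<notin> U"
  proof
    assume "e \<in> U"
    then obtain b where b: "b > e" "\<And>r. e < r \<Longrightarrow> r < b \<Longrightarrow> r \<in> U" using right_U by blast
    then show False using up[of "(e + b) / 2"] by force
  qed
  have acc: "\<exists>\<^sub>F t in at_left e. t \<in> U"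
    unfolding frequently_def eventually_at_left_field
  proof
    assume "\<exists>b<e. \<forall>y>b. y < e \<longrightarrow> y \<notin> U"
    then obtain b where b: "b < e" "\<And>y. b < y \<Longrightarrow> y < e \<Longrightarrow> y \<notin> U" by blast
    obtain y where "y \<in> U" "b < y" using less_cSupD[OF ne] b(1) unfolding e by blast
    then show False using up[of y] eU b(2)[of y] by (cases "y = e") auto
  qed
  have fr: "\<exists>\<^sub>F t in at_left e. act s t = t" if "s \<in> S" for s
    using frequently_elim1[OF acc] fixU[OF _ that] .
  show fe: "act s e = e" if "s \<in> S" for s using fixed_at_left_limit[OF _ fr] that S by blast
  show le: "\<forall>\<^sub>F t in at_left e. act s t = t" if "s \<in> S" for s using fixed_accumulate[OF _ fr] that S by blast
  have "e \<le> x" unfolding e using ne by (intro cSup_least) (auto simp: U_def)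
  then show ex: "e < x" using fe s0 by (cases "e = x") auto
  show "\<exists>s\<in>S. \<not> (\<forall>\<^sub>F t in at_right e. act s t = t)"
  proof (rule ccontr)
    assume "\<not> ?thesis"
    then have "\<forall>\<^sub>F t in at_right e. \<forall>s\<in>S. act s t = t" using S by (simp add: eventually_ball_finite)
    moreover have "\<forall>\<^sub>F t in at_left e. \<forall>s\<in>S. act s t = t" using S le by (simp add: eventually_ball_finite)
    ultimately have "\<forall>\<^sub>F t in at e. \<forall>s\<in>S. act s t = t" by (simp add: eventually_at_split)
    then have "\<forall>\<^sub>F t in nhds e. \<forall>s\<in>S. act s t = t" using fe by (simp add: eventually_nhds_conv_at)
    then show False using eU ex by (simp add: U_def)
  qed
  show "\<not> (\<forall>\<^sub>F r in nhds t. \<forall>s\<in>S. act s r = r)" if "e < t" "t < x" for t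
    using up[of t] that by (auto simp: U_def)
  show "t < e" if "t < x" "\<forall>\<^sub>F r in nhds t. \<forall>s\<in>S. act s r = r" for t
    using up[of t] eU that by (cases "t = e") (auto simp: U_def)
qed

text \<open>Let \<open>e = last_fixed S x\<close>, \<open>g e = y\<close> and \<open>c\<close> the infimum of the \<open>L\<close>-orbit of \<open>y\<close>.  Either this orbit
  passes \<open>g c\<close>, contradicting \<open>hull_left_avoids_orbit\<close> for \<open>c\<close>, or the supremum \<open>D\<close> of the orbit of \<open>e\<close>
  under \<open>g\<^sup>-\<^sup>1 L g\<close> is at most \<open>c\<close>; then that group moves the left end of an \<open>L\<close>-orbit reaching up
  to \<open>D\<close> into its own hull.\<close>

lemma last_fixed_not_in_orbit:
  assumes S: "finite S" "S \<subseteq> carrier G" and bot: "\<And>s. s \<in> S \<Longrightarrow> \<forall>\<^sub>F t in at_bot. act s t = t"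
    and s0: "s0 \<in> S" "act s0 x \<noteq> x"
    and no_pp: "\<And>x. x \<in> Phi \<Longrightarrow> \<not> ping_pong x"
    and y: "last_fixed S x < y" "y < x" and l0: "l0 \<in> generate G S" "act l0 y \<noteq> y"
    and g: "g \<in> carrier G"
  shows "act g (last_fixed S x) \<noteq> y"
proof
  define e where "e = last_fixed S x"
  note lf = last_fixed[OF S bot s0, folded e_def]
  assume gey: "act g (last_fixed S x) = y"
  define L where "L = generate G S"
  have L: "subgroup L G" unfolding L_def by (rule generate_is_subgroup[OF S(2)])
  have Lc: "l \<in> L \<Longrightarrow> l \<in> carrier G" for l using subgroup.subset[OF L] by blast
  have ge: "act g e = y" and ey: "e < y" using gey y by (simp_all add: e_def)
  have "\<forall>\<^sub>F t in at_bot. \<forall>s\<in>S. act s t = t" using bot S by (simp add: eventually_ball_finite)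
  then have Lbot: "\<forall>\<^sub>F t in at_bot. \<forall>l\<in>L. act l t = t"
    by (rule eventually_mono) (auto simp: L_def intro: generate_fixed[OF S(2)])
  have Lbot': "l \<in> L \<Longrightarrow> \<forall>\<^sub>F t in at_bot. act l t = t" for l
    using Lbot by (rule eventually_mono) blast
  have Le: "l \<in> L \<Longrightarrow> act l e = e" for l unfolding L_def using generate_fixed[OF S(2) lf(2)] by blast
  note avoid = hull_left_avoids_orbit[OF _ Lbot' no_pp]
  note hull = hull_left_Inf_orbit[OF L Lbot]
  have l0L: "l0 \<in> L" using l0 by (simp add: L_def)
  define c where "c = Inf ((\<lambda>l. act l y) ` L)"
  note c = hull[OF l0L l0(2), folded c_def]
  have ec: "e \<le> c" using c(4)[OF l0L Le] ey by simp
  have one: "\<one> \<in> L" using L by (rule subgroup.one_closed)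
  have cy: "c < y"
    using c(1)[OF one] by (simp add: hull_left_def act_one)
  have gc: "c < act g c" using cy ge ec act_le_iff[OF g, of e c] by simp
  have nogap: "act l y \<le> act g c" if "l \<in> L" for l
  proof (rule ccontr)
    assume "\<not> act l y \<le> act g c"
    then show False using avoid[OF c(1)[OF that] _ _ g gc] by simp
  qed
  \<comment> \<open>The conjugate of \<open>L\<close> by \<open>inv g\<close>. It carries
    \<open>e\<close> to the preimages under \<open>g\<close> of the \<open>L\<close>-orbit of
    \<open>y\<close>, and by \<open>nogap\<close> these lie at or below \<open>c\<close>.\<close>
  define M where "M = (\<lambda>l. inv g \<otimes> l \<otimes> g) ` L"
  have Mc: "m \<in> carrier G" if "m \<in> M" for m using that g Lc by (auto simp: M_def)
  have Mle: "act m e \<le> c" if m: "m \<in> M" for m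
  proof -
    obtain l where l: "l \<in> L" "m = inv g \<otimes> l \<otimes> g" using m by (auto simp: M_def)
    have "act m e = act (inv g) (act l y)" using l g Lc by (simp add: act_mult ge)
    also have "\<dots> \<le> c" using nogap[OF l(1)] g act_le_inv_iff[of "inv g"] by simp
    finally show ?thesis .
  qed
  have Mm: "m \<otimes> n \<in> M" if mn: "m \<in> M" "n \<in> M" for m n
  proof -
    obtain k l where k: "k \<in> L" "m = inv g \<otimes> k \<otimes> g" and l: "l \<in> L" "n = inv g \<otimes> l \<otimes> g"
      using mn by (auto simp: M_def)
    have "m \<otimes> n = inv g \<otimes> (k \<otimes> l) \<otimes> g"
      unfolding k(2) l(2) using Lc[OF k(1)] Lc[OF l(1)] g
      by (simp add: m_assoc) (simp add: m_assoc[of g "inv g", symmetric])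
    then show ?thesis using k l subgroup.m_closed[OF L] by (auto simp: M_def)
  qed
  define D where "D = Sup ((\<lambda>m. act m e) ` M)"
  have Mne: "(\<lambda>m. act m e) ` M \<noteq> {}" using one by (auto simp: M_def)
  have bdM: "bdd_above ((\<lambda>m. act m e) ` M)" using Mle by (auto intro!: bdd_aboveI[of _ c])
  have Dc: "D \<le> c" unfolding D_def using Mne Mle by (intro cSup_least) auto
  have MD: "act m e \<le> D" if "m \<in> M" for m unfolding D_def using that bdM by (intro cSup_upper) auto
  have Mex: "\<exists>m\<in>M. w < act m e" if "w < D" for w
    using less_cSupD[OF Mne, of w] that unfolding D_def by auto
  have Mlt: "act m w < D" if m: "m \<in> M" and w: "w < D" for m w
  proof -
    obtain n where n: "n \<in> M" "w < act n e" using Mex[OF w] by blast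
    have "act m w < act m (act n e)" using n Mc[OF m] by simp
    also have "\<dots> \<le> D" using MD[OF Mm[OF m n(1)]] Mc m n by (simp add: act_mult)
    finally show ?thesis .
  qed
  have eD: "e < D"
  proof -
    have "\<exists>l\<in>L. y < act l y"
    proof (cases "y < act l0 y")
      case False
      then have "act l0 y < y" using l0 by simp
      then have "y < act (inv l0) y" using act_less_inv_iff[OF Lc[OF l0L]] by simp
      then show ?thesis using subgroup.m_inv_closed[OF L l0L] by blast
    qed (use l0L in blast)
    then obtain l where l: "l \<in> L" "y < act l y" by blast
    have "e < act (inv g) (act l y)" using l(2) ge act_less_inv_iff[OF g, of e "act l y"] by simp
    also have "\<dots> = act (inv g \<otimes> l \<otimes> g) e" using l g Lc by (simp add: act_mult ge)
    also have "\<dots> \<le> D" using MD l by (auto simp: M_def)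
    finally show ?thesis .
  qed
  show False
  proof (cases "\<exists>l\<in>L. act l D \<noteq> D")
    case True
    then obtain l1 where l1: "l1 \<in> L" "act l1 D \<noteq> D" by blast
    define u where "u = Inf ((\<lambda>l. act l D) ` L)"
    note u = hull[OF l1, folded u_def]
    have hu: "hull_left L u D" using u(1)[OF one] by (simp add: act_one)
    then have uD: "u < D" by (simp add: hull_left_def)
    have eu: "e \<le> u" using u(4)[OF one Le] eD by simp
    obtain m where m: "m \<in> M" "u < act m e" using Mex[OF uD] by blast
    have "u < act m u" using m eu Mc[OF m(1)] by (meson act_le_iff less_le_trans)
    then show False using avoid[OF hu _ _ Mc[OF m(1)]] Mlt[OF m(1) uD] by blast
  next
    case False
    have Dx: "D < x" using Dc cy y by simp
    \<comment> \<open>When \<open>L\<close> fixes \<open>D\<close>, the orbit of \<open>D\<close>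
      gives no hull. Some \<open>s\<close> still has a nontrivial left germ at \<open>D\<close>,
      since no point between \<open>e\<close> and \<open>x\<close> has a neighbourhood fixed by
      \<open>S\<close>.\<close>
    have "\<exists>s\<in>S. \<not> (\<forall>\<^sub>F t in at_left D. act s t = t)"
    proof (rule ccontr)
      assume "\<not> ?thesis"
      then have "\<forall>\<^sub>F t in at_left D. \<forall>s\<in>S. act s t = t" using S by (simp add: eventually_ball_finite)
      then obtain b where b: "b < D" "\<And>t s. b < t \<Longrightarrow> t < D \<Longrightarrow> s \<in> S \<Longrightarrow> act s t = t"
        unfolding eventually_at_left_field by blast
      obtain t where t: "max b e < t" "t < D" using dense[of "max b e" D] b eD by auto
      have "\<forall>\<^sub>F r in nhds t. r \<in> {b<..<D}" using t by (intro eventually_nhds_in_open) auto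
      then have "\<forall>\<^sub>F r in nhds t. \<forall>s\<in>S. act s r = r" by eventually_elim (use b in auto)
      then show False using lf(5)[of t] t Dx by auto
    qed
    then obtain s where s: "s \<in> S" "\<not> (\<forall>\<^sub>F t in at_left D. act s t = t)" by blast
    have sL: "s \<in> L" using s by (auto simp: L_def intro: generate.incl)
    have "\<forall>\<^sub>F t in at_left D. act s t \<noteq> t"
      using fixed_accumulate[of s D] s S unfolding frequently_def by blast
    then obtain z where z: "z < D" "\<And>t. z < t \<Longrightarrow> t < D \<Longrightarrow> act s t \<noteq> t"
      unfolding eventually_at_left_field by blast
    obtain m where m: "m \<in> M" "z < act m e" using Mex[OF z(1)] by blast
    have "max (max z e) (act m z) < D" using z eD Mlt[OF m(1) z(1)] by simp
    \<comment> \<open>The infimum \<open>u\<close> of the orbit of \<open>t\<close> is fixed by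
      \<open>s\<close>, which moves every point between \<open>z\<close> and \<open>D\<close>; hence
      \<open>u \<le> z < act m e \<le> act m u \<le> act m z < t\<close>.\<close>
    then obtain t where t: "max (max z e) (act m z) < t" "t < D" using dense by blast
    have st: "act s t \<noteq> t" using z t by simp
    define u where "u = Inf ((\<lambda>l. act l t) ` L)"
    note u = hull[OF sL st, folded u_def]
    have hu: "hull_left L u t" using u(1)[OF one] by (simp add: act_one)
    then have ut: "u < t" by (simp add: hull_left_def)
    have eu: "e \<le> u" using u(4)[OF one Le] t by simp
    have "u \<le> z"
    proof (rule ccontr)
      assume "\<not> u \<le> z"
      then show False using z(2)[of u] ut t u(3)[OF one] sL by auto
    qed
    then have "u < act m u" using m eu Mc[OF m(1)] by (meson act_le_iff le_less_trans less_le_trans)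
    moreover have "act m u < t" using \<open>u \<le> z\<close> t Mc[OF m(1)] by (meson act_le_iff le_less_trans max.strict_boundedE)
    ultimately show False using avoid[OF hu _ _ Mc[OF m(1)]] by blast
  qed
qed

section \<open>Finitely generated pieces of the derived series\<close>

lemma generate_finite_support:
  assumes "x \<in> generate G A"
  shows "\<exists>B. finite B \<and> B \<subseteq> A \<and> x \<in> generate G B"
  using assms
proof (induction rule: generate.induct)
  case one then show ?case using generate.one by blast
next
  case (incl h) then show ?case by (intro exI[of _ "{h}"]) (auto intro: generate.incl)
next
  case (inv h) then show ?case by (intro exI[of _ "{h}"]) (auto intro: generate.inv)
next
  case (eng h1 h2)
  then obtain B1 B2 where "finite B1" "B1 \<subseteq> A" "h1 \<in> generate G B1" "finite B2" "B2 \<subseteq> A" "h2 \<in> generate G B2"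
    by blast
  then show ?case
    using mono_generate[of B1 "B1 \<union> B2"] mono_generate[of B2 "B1 \<union> B2"]
    by (intro exI[of _ "B1 \<union> B2"]) (auto intro!: generate.eng)
qed

lemma derived_finite_support:
  assumes "finite T" "T \<subseteq> derived G L"
  shows "\<exists>S. finite S \<and> S \<subseteq> L \<and> T \<subseteq> derived G (generate G S)"
proof -
  have one: "\<exists>S. finite S \<and> S \<subseteq> L \<and> x \<in> derived G (generate G S)" if x: "x \<in> derived G L" for x
  proof -
    obtain B where B: "finite B" "B \<subseteq> derived_set G L" "x \<in> generate G B"
      using generate_finite_support x unfolding derived_def by meson
    have "\<forall>b\<in>B. \<exists>h k. h \<in> L \<and> k \<in> L \<and> b = h \<otimes> k \<otimes> inv h \<otimes> inv k" using B(2) by blast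
    then obtain h k where hk: "\<And>b. b \<in> B \<Longrightarrow> h b \<in> L \<and> k b \<in> L \<and> b = h b \<otimes> k b \<otimes> inv (h b) \<otimes> inv (k b)"
      by metis
    let ?S = "h ` B \<union> k ` B"
    have "B \<subseteq> derived_set G (generate G ?S)"
    proof
      fix b assume b: "b \<in> B"
      then have "h b \<in> generate G ?S" "k b \<in> generate G ?S" by (auto intro: generate.incl)
      then show "b \<in> derived_set G (generate G ?S)" using hk[OF b] by blast
    qed
    then have "x \<in> derived G (generate G ?S)" using B(3) mono_generate unfolding derived_def by blast
    then show ?thesis using B(1) hk by (intro exI[of _ ?S]) auto
  qed
  have "\<forall>x\<in>T. \<exists>S. finite S \<and> S \<subseteq> L \<and> x \<in> derived G (generate G S)" using one assms by blast
  then obtain f where f: "\<And>x. x \<in> T \<Longrightarrow> finite (f x) \<and> f x \<subseteq> L \<and> x \<in> derived G (generate G (f x))" by metis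
  have "x \<in> derived G (generate G (\<Union>(f ` T)))" if "x \<in> T" for x
    using f[OF that] mono_derived[OF mono_generate, of "f x" "\<Union>(f ` T)"] that by blast
  then show ?thesis using f assms(1) by (intro exI[of _ "\<Union>(f ` T)"]) auto
qed

text \<open>Replaces the derived series by finite sets, because \<open>last_fixed\<close> controls
  the germs of finitely many elements only. They are chosen backwards from \<open>T\<close>:
  membership in a derived subgroup is witnessed by finitely many elements.\<close>

lemma derived_chain:
  assumes "finite T" "T \<subseteq> (derived G ^^ n) (carrier G)"
  shows "\<exists>S. S n = T \<and> (\<forall>i\<le>n. finite (S i) \<and> S i \<subseteq> carrier G)
             \<and> (\<forall>i<n. S (Suc i) \<subseteq> derived G (generate G (S i)))"
  using assms
proof (induction n arbitrary: T)
  case 0 then show ?case by (intro exI[of _ "\<lambda>_. T"]) auto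
next
  case (Suc n)
  obtain T' where T': "finite T'" "T' \<subseteq> (derived G ^^ n) (carrier G)" "T \<subseteq> derived G (generate G T')"
    using derived_finite_support[OF Suc.prems(1), of "(derived G ^^ n) (carrier G)"] Suc.prems(2) by auto
  obtain S where S: "S n = T'" "\<forall>i\<le>n. finite (S i) \<and> S i \<subseteq> carrier G"
    "\<forall>i<n. S (Suc i) \<subseteq> derived G (generate G (S i))" using Suc.IH[OF T'(1,2)] by blast
  have Tc: "T \<subseteq> carrier G" using Suc.prems(2) exp_of_derived_in_carrier[of "carrier G" "Suc n"] by blast
  show ?case
    by (rule exI[of _ "S(Suc n := T)"]) (use S T' Tc Suc.prems in \<open>auto simp: le_Suc_eq less_Suc_eq\<close>)
qed

section \<open>From a long derived series to a ping-pong pair\<close>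

theorem not_solvable_imp_ping_pong:
  assumes S0: "finite S0" "S0 \<subseteq> carrier G" "carrier G = generate G S0"
    and ns: "\<not> solvable G"
  shows "\<exists>x\<in>Phi. ping_pong x"
proof (rule ccontr)
  assume "\<not> ?thesis"
  then have no_pp: "\<And>x. x \<in> Phi \<Longrightarrow> \<not> ping_pong x" by blast
  define B where "B = (\<Union>s\<in>S0. {x. C s x \<noteq> 0})"
  have finB: "finite B" unfolding B_def using S0 finite_C by auto
  have C1: "C \<one> x = 0" for x using C_mult[of \<one> \<one> x] act_one by simp
  have Cinv: "C (inv g) (act g x) = - C g x" if "g \<in> carrier G" for g x
    using C_mult[of "inv g" g x] that C1 by simp
  \<comment> \<open>By the cocycle identity, a nonzero value on a product comes from a nonzero value
    on a factor at a point of the same orbit.\<close>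
  have to_B: "\<exists>h\<in>carrier G. act h x \<in> B" if "C g x \<noteq> 0" "g \<in> generate G S0" for g x
    using that(2,1)
  proof (induction arbitrary: x rule: generate.induct)
    case one then show ?case using C1 by simp
  next
    case (incl h) then show ?case by (intro bexI[of _ \<one>]) (auto simp: B_def act_one)
  next
    case (inv h)
    then have "h \<in> carrier G" using S0 by blast
    then have "C h (act (inv h) x) \<noteq> 0" using Cinv[of h "act (inv h) x"] inv.prems by simp
    then show ?case using inv \<open>h \<in> carrier G\<close> by (intro bexI[of _ "inv h"]) (auto simp: B_def)
  next
    case (eng h1 h2)
    have c: "h1 \<in> carrier G" "h2 \<in> carrier G" using eng.hyps S0(3) by auto
    show ?case
    proof (cases "C h2 x = 0")
      case True
      then have "C h1 (act h2 x) \<noteq> 0" using eng.prems C_mult[OF c, of x] by simp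
      then obtain h where "h \<in> carrier G" "act h (act h2 x) \<in> B" using eng.IH(1) by blast
      then show ?thesis using c by (intro bexI[of _ "h \<otimes> h2"]) (auto simp: act_mult)
    qed (use eng.IH(2) in blast)
  qed
  \<comment> \<open>One more than the number of orbits that can meet \<open>B\<close>, for the
    pigeonhole argument at the end.\<close>
  define n where "n = Suc (card B)"
  have sub: "subgroup ((derived G ^^ n) (carrier G)) G" by (rule exp_of_derived_is_subgroup[OF subgroup_self])
  obtain h where h: "h \<in> (derived G ^^ n) (carrier G)" "h \<noteq> \<one>"
    using ns[unfolded solvable_iff_trivial_derived_seq] subgroup.one_closed[OF sub] by blast
  have hc: "h \<in> carrier G" using h sub by (meson subgroup.mem_carrier)
  then obtain x where x: "act h x \<noteq> x" using act_faithful h by blast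
  obtain S where Sn: "S n = {h}" and S: "\<And>i. i \<le> n \<Longrightarrow> finite (S i)" "\<And>i. i \<le> n \<Longrightarrow> S i \<subseteq> carrier G"
    and Sd: "\<And>i. i < n \<Longrightarrow> S (Suc i) \<subseteq> derived G (generate G (S i))"
    using derived_chain[of "{h}" n] h by auto
  define L where "L i = generate G (S i)" for i
  have L: "subgroup (L i) G" if "i \<le> n" for i unfolding L_def using S that generate_is_subgroup by blast
  have Lc: "l \<in> carrier G" if "l \<in> L i" "i \<le> n" for l i using L that by (meson subgroup.mem_carrier)
  have step: "S (Suc i) \<subseteq> derived G (L i)" "L (Suc i) \<subseteq> L i" if "i < n" for i
  proof -
    show 1: "S (Suc i) \<subseteq> derived G (L i)" using Sd[OF that] by (simp add: L_def)
    have "derived G (L i) \<subseteq> L i" using derived_incl[OF _ L] that by simp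
    then show "L (Suc i) \<subseteq> L i" unfolding L_def[of "Suc i"] using 1 L[of i] that
      by (intro generate_subgroup_incl) auto
  qed
  have Lmono: "L j \<subseteq> L i" if "i \<le> j" "j \<le> n" for i j
    using that by (induction j rule: dec_induct) (use step(2) in \<open>force dest: Suc_le_lessD\<close>)+
  \<comment> \<open>Index 0 is excluded: its elements may act nontrivially near minus infinity, and
    only the derived subgroup is known to be trivial there.\<close>
  have bot: "\<forall>\<^sub>F t in at_bot. act s t = t" if i: "1 \<le> i" "i \<le> n" "s \<in> S i" for i s
  proof -
    obtain j where j: "i = Suc j" "j < n" using i by (cases i) auto
    show ?thesis
      by (rule derived_germ_trivial[OF L[of j]])
        (use j i step[of j] Lc in \<open>auto intro: filterlim_act_at_bot germs_commute_at_bot\<close>)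
  qed
  \<comment> \<open>\<open>h\<close> moves \<open>x\<close> and belongs to every
    \<open>L i\<close>.\<close>
  have ex_move: "\<exists>s\<in>S i. act s x \<noteq> x" if "i \<le> n" for i
  proof (rule ccontr)
    assume "\<not> ?thesis"
    then have "act l x = x" if "l \<in> L i" for l
      using generate_fixed[OF S(2)[OF \<open>i \<le> n\<close>]] that unfolding L_def by blast
    moreover have "h \<in> L i" using Lmono[OF that order_refl] Sn by (auto simp: L_def intro: generate.incl)
    ultimately show False using x by blast
  qed
  define e where "e i = last_fixed (S i) x" for i
  have lf: "e i < x" "\<And>s. s \<in> S i \<Longrightarrow> act s (e i) = e i"
    "\<And>s. s \<in> S i \<Longrightarrow> \<forall>\<^sub>F t in at_left (e i). act s t = t"
    "\<exists>s\<in>S i. \<not> (\<forall>\<^sub>F t in at_right (e i). act s t = t)"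
    "\<And>t. t < x \<Longrightarrow> \<forall>\<^sub>F r in nhds t. \<forall>s\<in>S i. act s r = r \<Longrightarrow> t < e i"
    if i: "1 \<le> i" "i \<le> n" for i
  proof -
    obtain s where s: "s \<in> S i" "act s x \<noteq> x" using ex_move i by blast
    note * = last_fixed[OF S(1)[OF i(2)] S(2)[OF i(2)] bot[OF i] s, folded e_def]
    show "e i < x" "\<And>s. s \<in> S i \<Longrightarrow> act s (e i) = e i"
    "\<And>s. s \<in> S i \<Longrightarrow> \<forall>\<^sub>F t in at_left (e i). act s t = t"
    "\<exists>s\<in>S i. \<not> (\<forall>\<^sub>F t in at_right (e i). act s t = t)"
    "\<And>t. t < x \<Longrightarrow> \<forall>\<^sub>F r in nhds t. \<forall>s\<in>S i. act s r = r \<Longrightarrow> t < e i"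
      using * by blast+
  qed
  have right_triv: "\<forall>\<^sub>F t in at_right p. act s t = t"
    if "i < n" "s \<in> S (Suc i)" "\<And>l. l \<in> L i \<Longrightarrow> act l p = p" for i s p
    by (rule derived_germ_trivial[OF L[of i]])
      (use that step[of i] Lc in \<open>auto intro: filterlim_act_at_right right_germs_commute\<close>)
  have fixL: "act l (e i) = e i" if "1 \<le> i" "i \<le> n" "l \<in> L i" for i l
    using that generate_fixed[OF S(2)[OF that(2)] lf(2)[OF that(1,2)]] unfolding L_def by blast
  \<comment> \<open>\<open>L i\<close> fixes \<open>e i\<close> and is trivial just left of it;
    right germs commute there, so \<open>S (Suc i)\<close>, lying in the derived subgroup, is
    trivial on a full neighbourhood of \<open>e i\<close>.\<close>
  have e_Suc: "e i < e (Suc i)" if i: "1 \<le> i" "i < n" for i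
  proof -
    have i': "1 \<le> i" "i \<le> n" using i by auto
    have "\<forall>\<^sub>F r in nhds (e i). act s r = r" if s: "s \<in> S (Suc i)" for s
    proof -
      have sL: "s \<in> L i" using step(2)[OF i(2)] s by (auto simp: L_def intro: generate.incl)
      have "\<forall>\<^sub>F t in at_left (e i). \<forall>s\<in>S i. act s t = t"
        using lf(3)[OF i'] S(1)[OF i'(2)] by (simp add: eventually_ball_finite)
      then have "\<forall>\<^sub>F t in at_left (e i). act s t = t"
        by eventually_elim (use sL in \<open>auto simp: L_def intro: generate_fixed[OF S(2)[OF i'(2)]]\<close>)
      moreover have "\<forall>\<^sub>F t in at_right (e i). act s t = t" using right_triv[OF i(2) s] fixL[OF i'] by blast
      ultimately show ?thesis using fixL[OF i' sL] by (simp add: eventually_nhds_conv_at eventually_at_split)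
    qed
    then have "\<forall>\<^sub>F r in nhds (e i). \<forall>s\<in>S (Suc i). act s r = r"
      using S(1)[of "Suc i"] i by (simp add: eventually_ball_finite)
    then show ?thesis using lf(5)[of "Suc i" "e i"] lf(1)[OF i'] i by simp
  qed
  have e_mono: "e i < e k" if "1 \<le> i" "i < k" "k \<le> n" for i k
  proof -
    have "Suc i \<le> k" using that by simp
    then show ?thesis using that(3)
    proof (induction k rule: dec_induct)
      case base then show ?case using e_Suc that(1) by simp
    next
      case (step m) then show ?case using e_Suc[of m] that(1) by simp
    qed
  qed
  have distinct: "act g (e i) \<noteq> e k" if ik: "1 \<le> i" "i < k" "k \<le> n" and g: "g \<in> carrier G" for i k g
  proof -
    have i: "1 \<le> i" "i \<le> n" and k: "1 \<le> k" "k \<le> n" using ik by auto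
    obtain j where j: "k = Suc j" "j < n" "i \<le> j" using ik by (cases k) auto
    obtain s where s: "s \<in> S i" "act s x \<noteq> x" using ex_move i by blast
    \<comment> \<open>If the previous group fixed \<open>e k\<close>, then \<open>S k\<close>,
      inside its derived subgroup, would have trivial right germs at \<open>e k\<close>.\<close>
    have "\<exists>l\<in>L j. act l (e k) \<noteq> e k"
    proof (rule ccontr)
      assume "\<not> ?thesis"
      then show False using lf(4)[OF k] right_triv[OF j(2), of _ "e k"] j(1) by blast
    qed
    then obtain l where l: "l \<in> generate G (S i)" "act l (e k) \<noteq> e k"
      using Lmono[of i j] j by (auto simp: L_def)
    show ?thesis
      using last_fixed_not_in_orbit[OF S(1)[OF i(2)] S(2)[OF i(2)] bot[OF i] s no_pp _ lf(1)[OF k] l g]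
        e_mono[OF ik] unfolding e_def by blast
  qed
  have "\<exists>h\<in>carrier G. act h (e i) \<in> B" if i: "i \<in> {1..n}" for i
  proof -
    have i': "1 \<le> i" "i \<le> n" using i by auto
    obtain s where s: "s \<in> S i" "\<not> (\<forall>\<^sub>F t in at_right (e i). act s t = t)" using lf(4)[OF i'] by blast
    have sc: "s \<in> carrier G" using s S(2)[OF i'(2)] by blast
    have "C s (e i) \<noteq> 0" using C_nonzero[OF sc lf(2)[OF i' s(1)] lf(3)[OF i' s(1)] s(2)] .
    then show ?thesis using to_B sc S0(3) by blast
  qed
  then obtain k where k: "\<And>i. i \<in> {1..n} \<Longrightarrow> k i \<in> carrier G \<and> act (k i) (e i) \<in> B" by metis
  have "\<not> inj_on (\<lambda>i. act (k i) (e i)) {1..n}"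
  proof
    assume "inj_on (\<lambda>i. act (k i) (e i)) {1..n}"
    then have "card {1..n} \<le> card B" using k finB by (intro card_inj_on_le) auto
    then show False by (simp add: n_def)
  qed
  then obtain i j where ij: "i \<in> {1..n}" "j \<in> {1..n}" "i < j" "act (k i) (e i) = act (k j) (e j)"
    unfolding inj_on_def by (metis linorder_neqE_nat)
  have "act (inv (k j) \<otimes> k i) (e i) = e j" using ij k by (simp add: act_mult)
  then show False using distinct[of i j "inv (k j) \<otimes> k i"] ij k by simp
qed

end


section \<open>Random walks with a cocycle\<close>

lemma integral_bind_pmf_unit:
  fixes f :: "'b \<Rightarrow> real"
  assumes "\<And>x. 0 \<le> f x" "\<And>x. f x \<le> 1"
  shows "measure_pmf.expectation (bind_pmf p k) f = measure_pmf.expectation p (\<lambda>x. measure_pmf.expectation (k x) f)"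
proof -
  have int: "integrable (measure_pmf q) f" for q
    by (rule measure_pmf.integrable_const_bound[where B = 1]) (use assms in auto)
  have E: "0 \<le> measure_pmf.expectation q f" "measure_pmf.expectation q f \<le> 1" for q
    using assms int by (auto intro!: integral_nonneg_AE measure_pmf.integral_le_const)
  have int': "integrable (measure_pmf p) (\<lambda>x. measure_pmf.expectation (k x) f)"
    by (rule measure_pmf.integrable_const_bound[where B = 1]) (use E in auto)
  have "ennreal (measure_pmf.expectation (bind_pmf p k) f) = (\<integral>\<^sup>+x. f x \<partial>bind_pmf p k)"
    using int assms by (simp add: nn_integral_eq_integral del: nn_integral_bind_pmf)
  also have "\<dots> = (\<integral>\<^sup>+x. ennreal (measure_pmf.expectation (k x) f) \<partial>p)"
    using int assms by (simp add: nn_integral_eq_integral)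
  also have "\<dots> = ennreal (measure_pmf.expectation p (\<lambda>x. measure_pmf.expectation (k x) f))"
    using int' E by (simp add: nn_integral_eq_integral)
  finally show ?thesis using E by (simp add: integral_nonneg_AE)
qed

text \<open>Independent draws commute (\<open>bind_commute_pmf\<close>); this yields Tonelli without
  a product measure.\<close>

lemma nn_integral_pmf_swap:
  "(\<integral>\<^sup>+x. \<integral>\<^sup>+y. f x y \<partial>measure_pmf q \<partial>measure_pmf p) = (\<integral>\<^sup>+y. \<integral>\<^sup>+x. f x y \<partial>measure_pmf p \<partial>measure_pmf q)"
proof -
  have "(\<integral>\<^sup>+x. \<integral>\<^sup>+y. f x y \<partial>measure_pmf q \<partial>measure_pmf p)
      = (\<integral>\<^sup>+z. case_prod f z \<partial>measure_pmf (bind_pmf p (\<lambda>x. bind_pmf q (\<lambda>y. return_pmf (x, y)))))"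
    by simp
  also have "\<dots> = (\<integral>\<^sup>+z. case_prod f z \<partial>measure_pmf (bind_pmf q (\<lambda>y. bind_pmf p (\<lambda>x. return_pmf (x, y)))))"
    by (subst bind_commute_pmf) (rule refl)
  also have "\<dots> = (\<integral>\<^sup>+y. \<integral>\<^sup>+x. f x y \<partial>measure_pmf p \<partial>measure_pmf q)" by simp
  finally show ?thesis .
qed

text \<open>The level sets of the orbit of \<open>x\<close> under the free semigroup on \<open>a, b\<close> double in size,
  so averaging \<open>U\<close> over them interpolates between \<open>U x\<close> and \<open>0\<close>.\<close>

lemma ping_pong_poincare:
  fixes U :: "'b \<Rightarrow> real"
  assumes U: "\<And>y. 0 \<le> U y" "\<And>Y. finite Y \<Longrightarrow> sum U Y \<le> 1"
    and inj: "inj a" "inj b"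
    and I: "x \<in> I" "a ` I \<subseteq> I" "b ` I \<subseteq> I" "a ` I \<inter> b ` I = {}"
    and ka: "\<And>Y. finite Y \<Longrightarrow> L2_set (\<lambda>y. U y - U (a y)) Y \<le> k"
    and kb: "\<And>Y. finite Y \<Longrightarrow> L2_set (\<lambda>y. U y - U (b y)) Y \<le> k"
  shows "U x \<le> 4 * k"
proof -
  define Y where "Y = rec_nat {x} (\<lambda>_ Z. a ` Z \<union> b ` Z)"
  have Y0: "Y 0 = {x}" and YS: "Y (Suc n) = a ` Y n \<union> b ` Y n" for n by (simp_all add: Y_def)
  have YI: "finite (Y n) \<and> Y n \<subseteq> I" for n 
    using I(2,3) by (induction n) (use I(1) in \<open>simp add: Y0\<close>, force simp: YS)
  have dis: "a ` Y n \<inter> b ` Y n = {}" for n using YI[of n] I(4) by blast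
  have cardY: "card (Y n) = 2 ^ n" for n
    by (induction n) (use dis YI inj in \<open>auto simp: Y0 YS card_Un_disjoint card_image inj_on_subset\<close>)
  have k0: "0 \<le> k" using ka[of "{}"] by simp
  \<comment> \<open>Cauchy-Schwarz on a level of \<open>2 ^ n\<close> points.\<close>
  have L1: "(\<Sum>y\<in>Y n. \<bar>U y - U (c y)\<bar>) \<le> sqrt (2 ^ n) * k"
    if c: "\<And>Z. finite Z \<Longrightarrow> L2_set (\<lambda>y. U y - U (c y)) Z \<le> k" for c n
  proof -
    have "(\<Sum>y\<in>Y n. \<bar>1\<bar> * \<bar>U y - U (c y)\<bar>) \<le> L2_set (\<lambda>_. 1) (Y n) * L2_set (\<lambda>y. U y - U (c y)) (Y n)"
      by (rule L2_set_mult_ineq)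
    also have "\<dots> \<le> sqrt (2 ^ n) * k"
      using c[of "Y n"] YI[of n] by (intro mult_mono) (auto simp: L2_set_def cardY sum_nonneg)
    finally show ?thesis by simp
  qed
  define A where "A n = sum U (Y n)" for n
  \<comment> \<open>The error at level \<open>n\<close> is \<open>sqrt (2 ^ n)\<close> against
    \<open>2 ^ n\<close> points, a geometric sequence of ratio \<open>r\<close>. The bound
    \<open>r \<le> 3 / 4\<close> makes its sum at most 4, the constant of the conclusion.\<close>
  define r :: real where "r = sqrt (1 / 2)"
  have "sqrt (1 / 2) \<le> 3 / 4" by (rule real_le_lsqrt) (simp_all add: power2_eq_square)
  then have r: "0 \<le> r" "r \<le> 3 / 4" unfolding r_def by simp_all
  have rn: "sqrt (2 ^ n) / 2 ^ n = r ^ n" for n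
  proof -
    have "sqrt (2 ^ n) / 2 ^ n = (sqrt 2 / 2) ^ n" by (simp add: real_sqrt_power power_divide)
    also have "sqrt 2 / 2 = r" unfolding r_def by (simp add: real_sqrt_divide real_div_sqrt field_simps)
    finally show ?thesis .
  qed
  have step: "A n / 2 ^ n \<le> A (Suc n) / 2 ^ Suc n + k * r ^ n" for n
  proof -
    have "A (Suc n) = (\<Sum>y\<in>Y n. U (a y)) + (\<Sum>y\<in>Y n. U (b y))"
      unfolding A_def YS using YI[of n] dis[of n] inj
      by (simp add: sum.union_disjoint sum.reindex inj_on_subset)
    then have "2 * A n - A (Suc n) = (\<Sum>y\<in>Y n. U y - U (a y)) + (\<Sum>y\<in>Y n. U y - U (b y))"
      by (simp add: A_def sum_subtractf)
    also have "\<dots> \<le> (\<Sum>y\<in>Y n. \<bar>U y - U (a y)\<bar>) + (\<Sum>y\<in>Y n. \<bar>U y - U (b y)\<bar>)"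
      by (intro add_mono sum_mono) auto
    also have "\<dots> \<le> 2 * (sqrt (2 ^ n) * k)" using L1[of a n] L1[of b n] ka kb by auto
    finally have "A n \<le> A (Suc n) / 2 + sqrt (2 ^ n) * k" by simp
    then have "A n / 2 ^ n \<le> (A (Suc n) / 2 + sqrt (2 ^ n) * k) / 2 ^ n" by (rule divide_right_mono) simp
    also have "\<dots> = A (Suc n) / 2 ^ Suc n + k * (sqrt (2 ^ n) / 2 ^ n)" by (simp add: add_divide_distrib)
    finally show ?thesis by (simp add: rn)
  qed
  have tel: "A 0 \<le> A n / 2 ^ n + k * (\<Sum>i<n. r ^ i)" for n
  proof (induction n)
    case (Suc n) then show ?case using step[of n] by (simp add: distrib_left)
  qed simp
  have geo: "(\<Sum>i<n. r ^ i) \<le> 4" for n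
  proof -
    have "(\<Sum>i<n. r ^ i) * (1 - r) \<le> 1" using r by (simp add: sum_gp_strict)
    moreover have "(\<Sum>i<n. r ^ i) * (1 / 4) \<le> (\<Sum>i<n. r ^ i) * (1 - r)"
      using r by (intro mult_left_mono sum_nonneg) auto
    ultimately show ?thesis by simp
  qed
  have "U x \<le> (1 / 2) ^ n + 4 * k" for n
  proof -
    have "A n \<le> 1" unfolding A_def using U YI by blast
    then have "A n / 2 ^ n \<le> (1 / 2) ^ n" by (simp add: divide_right_mono power_divide)
    moreover have "k * (\<Sum>i<n. r ^ i) \<le> k * 4" using geo k0 by (intro mult_left_mono) auto
    ultimately show ?thesis using tel[of n] by (simp add: A_def Y0)
  qed
  moreover have "(\<lambda>n. (1 / 2) ^ n + 4 * k) \<longlonglongrightarrow> 0 + 4 * k"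
    by (intro tendsto_intros LIMSEQ_power_zero) simp
  ultimately show ?thesis using LIMSEQ_le_const[of _ "0 + 4 * k" "U x"] by auto
qed

lemma geometric_bind_unfold:
  assumes "p \<in> {0<..1}"
  shows "bind_pmf (geometric_pmf p) f
       = bind_pmf (bernoulli_pmf p) (\<lambda>b. if b then f 0 else bind_pmf (geometric_pmf p) (\<lambda>n. f (Suc n)))"
proof -
  have "bind_pmf (geometric_pmf p) f = bind_pmf (bernoulli_pmf p)
      (\<lambda>b. bind_pmf (if b then return_pmf 0 else map_pmf Suc (geometric_pmf p)) f)"
    by (subst geometric_bind_pmf_unfold[OF assms]) (simp add: bind_assoc_pmf)
  also have "\<dots> = bind_pmf (bernoulli_pmf p) (\<lambda>b. if b then f 0 else bind_pmf (geometric_pmf p) (\<lambda>n. f (Suc n)))"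
    by (intro bind_pmf_cong) (auto simp: bind_return_pmf bind_map_pmf)
  finally show ?thesis .
qed

section \<open>A random walk with a finitely supported cocycle\<close>

locale cocycle_walk = Group.group G for G (structure) +
  fixes act :: "'a \<Rightarrow> 'b \<Rightarrow> 'b"
    and C :: "'a \<Rightarrow> 'b \<Rightarrow> real"
    and \<mu> :: "'a pmf"
  assumes act_mult: "g \<in> carrier G \<Longrightarrow> h \<in> carrier G \<Longrightarrow> act (g \<otimes> h) x = act g (act h x)"
    and act_one: "act \<one> x = x"
    and C_mult: "g \<in> carrier G \<Longrightarrow> h \<in> carrier G \<Longrightarrow> C (g \<otimes> h) x = C g (act h x) + C h x"
    and finite_C: "g \<in> carrier G \<Longrightarrow> finite {x. C g x \<noteq> 0}"
    and supp: "set_pmf \<mu> \<subseteq> carrier G"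
    and gen: "semigroup_generate G (set_pmf \<mu>) = carrier G"
    and moment: "integrable (measure_pmf \<mu>) (\<lambda>g. real (card {x. C g x \<noteq> 0}))"
begin

lemma act_inv:
  assumes "g \<in> carrier G"
  shows "act (inv g) (act g x) = x" "act g (act (inv g) x) = x"
  using assms act_mult[of "inv g" g x] act_mult[of g "inv g" x] act_one by auto

lemma bij_act: "g \<in> carrier G \<Longrightarrow> bij (act g)"
  using act_inv by (intro bij_betw_byWitness[where f' = "act (inv g)"]) auto

lemma inj_act: "g \<in> carrier G \<Longrightarrow> inj (act g)"
  using bij_act bij_is_inj by blast

primrec orbit_pmf :: "'b \<Rightarrow> nat \<Rightarrow> 'b pmf" where
  "orbit_pmf x 0 = return_pmf x"
| "orbit_pmf x (Suc n) = bind_pmf \<mu> (\<lambda>g. map_pmf (act g) (orbit_pmf x n))"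

text \<open>Independent draws commute, so either the last increment is split off outside or the
  first one at \<open>x\<close>; \<open>emeasure_jump\<close> conditions on the first.\<close>

lemma orbit_pmf_Suc': "orbit_pmf x (Suc n) = bind_pmf \<mu> (\<lambda>g. orbit_pmf (act g x) n)"
proof (induction n arbitrary: x)
  case (Suc n)
  have "orbit_pmf x (Suc (Suc n)) = bind_pmf \<mu> (\<lambda>g. map_pmf (act g) (bind_pmf \<mu> (\<lambda>h. orbit_pmf (act h x) n)))"
    using Suc by simp
  also have "\<dots> = bind_pmf \<mu> (\<lambda>g. bind_pmf \<mu> (\<lambda>h. map_pmf (act g) (orbit_pmf (act h x) n)))"
    by (simp add: map_bind_pmf)
  also have "\<dots> = bind_pmf \<mu> (\<lambda>h. bind_pmf \<mu> (\<lambda>g. map_pmf (act g) (orbit_pmf (act h x) n)))"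
    by (rule bind_commute_pmf)
  finally show ?case by simp
qed simp

section \<open>The Green function with killing\<close>

text \<open>The walk on the orbit stopped at an independent geometric time: its law is
  \<open>1 - l\<close> times the Green function of the walk that survives each step with probability
  \<open>l\<close>. Being a probability distribution, it is square summable even before transience
  is known.\<close>

definition green :: "real \<Rightarrow> 'b \<Rightarrow> 'b pmf" where
  "green l x = bind_pmf (geometric_pmf (1 - l)) (orbit_pmf x)"

lemma green_unfold:
  assumes "0 < l" "l < 1"
  shows "green l x = bind_pmf (bernoulli_pmf (1 - l))
           (\<lambda>b. if b then return_pmf x else bind_pmf \<mu> (\<lambda>g. map_pmf (act g) (green l x)))"
proof -
  have "bind_pmf (geometric_pmf (1 - l)) (\<lambda>n. orbit_pmf x (Suc n))
      = bind_pmf \<mu> (\<lambda>g. map_pmf (act g) (green l x))"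
    unfolding green_def orbit_pmf.simps by (subst bind_commute_pmf) (simp add: map_bind_pmf)
  then show ?thesis unfolding green_def[of l x]
    by (subst geometric_bind_unfold) (use assms in \<open>auto simp: green_def cong: if_cong\<close>)
qed

lemma expectation_green:
  assumes l: "0 < l" "l < 1" and f: "\<And>y. 0 \<le> f y" "\<And>y. f y \<le> (1::real)"
  shows "measure_pmf.expectation (green l x) f
       = (1 - l) * f x + l * measure_pmf.expectation \<mu> (\<lambda>g. measure_pmf.expectation (green l x) (\<lambda>y. f (act g y)))"
  by (subst green_unfold[OF l]) (use l in \<open>simp add: integral_bind_pmf_unit[OF f]\<close>)

lemma pmf_green:
  assumes l: "0 < l" "l < 1"
  shows "pmf (green l x) y = (1 - l) * indicator {x} y
           + l * measure_pmf.expectation \<mu> (\<lambda>g. pmf (green l x) (act (inv g) y))"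
proof -
  have "pmf (map_pmf (act g) (green l x)) y = pmf (green l x) (act (inv g) y)" if "g \<in> set_pmf \<mu>" for g
    using pmf_map_inj'[OF inj_act, of g "green l x" "act (inv g) y"] that supp act_inv(2)[of g y] by auto
  then have "measure_pmf.expectation \<mu> (\<lambda>g. pmf (map_pmf (act g) (green l x)) y)
      = measure_pmf.expectation \<mu> (\<lambda>g. pmf (green l x) (act (inv g) y))"
    by (intro integral_cong_AE) (auto simp: AE_measure_pmf_iff)
  then show ?thesis
    by (subst green_unfold[OF l]) (use l in \<open>simp add: pmf_bind indicator_def\<close>)
qed

text \<open>Maximum principle: away from \<open>x\<close>, the value at \<open>y\<close> is
  \<open>l\<close> times an average of values, so the bound
  \<open>max (pmf (green l x) x) (l ^ n)\<close> everywhere improves to the exponent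
  \<open>Suc n\<close>.\<close>

lemma pmf_green_le:
  assumes l: "0 < l" "l < 1"
  shows "pmf (green l x) y \<le> pmf (green l x) x"
proof -
  let ?U = "pmf (green l x)"
  have "\<forall>y. ?U y \<le> max (?U x) (l ^ n)" for n
  proof (induction n)
    case 0 then show ?case by (simp add: pmf_le_1 max.coboundedI2)
  next
    case (Suc n)
    show ?case
    proof
      fix y
      show "?U y \<le> max (?U x) (l ^ Suc n)"
      proof (cases "y = x")
        case False
        have "measure_pmf.expectation \<mu> (\<lambda>g. ?U (act (inv g) y)) \<le> max (?U x) (l ^ n)"
          using Suc by (intro measure_pmf.integral_le_const measure_pmf.integrable_const_bound[where B = 1])
            (auto simp: pmf_le_1)
        then have "?U y \<le> l * max (?U x) (l ^ n)"
          by (subst pmf_green[OF l]) (use False l in \<open>simp add: indicator_def\<close>)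
        also have "\<dots> = max (l * ?U x) (l ^ Suc n)" using l by (simp add: max_mult_distrib_left)
        also have "\<dots> \<le> max (?U x) (l ^ Suc n)"
          using l mult_right_mono[of l 1 "?U x"] by (intro max.mono) auto
        finally show ?thesis .
      qed auto
    qed
  qed
  then have "?U y \<le> max (?U x) (l ^ n)" for n by blast
  moreover have "(\<lambda>n. max (?U x) (l ^ n)) \<longlonglongrightarrow> max (?U x) 0"
    using l by (intro tendsto_intros LIMSEQ_power_zero) simp
  ultimately have "?U y \<le> max (?U x) 0" by (intro LIMSEQ_le_const) auto
  then show ?thesis by (simp add: max_def split: if_splits)
qed

text \<open>Since \<open>act g\<close> is a bijection, \<open>U = pmf q\<close> and its composition
  \<open>V\<close> with \<open>act g\<close> have the same norm in l2, so their squared distance is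
  twice \<open><U, U> - <U, V>\<close>. Expectations under \<open>q\<close> are pairings with
  \<open>U\<close>.\<close>

lemma sum_square_diff_le:
  fixes q :: "'b pmf"
  assumes g: "g \<in> carrier G" and Y: "finite Y"
  shows "(\<Sum>y\<in>Y. (pmf q y - pmf q (act g y))\<^sup>2)
       \<le> 2 * (measure_pmf.expectation q (pmf q) - measure_pmf.expectation q (\<lambda>y. pmf q (act g y)))"
proof -
  let ?M = "count_space (UNIV :: 'b set)" and ?U = "pmf q" and ?V = "\<lambda>y. pmf q (act g y)"
  have E: "measure_pmf.expectation q f = (\<integral>y. ?U y * f y \<partial>?M)" for f :: "'b \<Rightarrow> real"
    by (simp add: measure_pmf_eq_density integral_density)
  have iU: "integrable ?M ?U" by (rule integrable_pmf)
  have dist: "distr ?M ?M (act g) = ?M" using bij_act[OF g] by (rule distr_bij_count_space)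
  have iV: "integrable ?M ?V"
    using integrable_distr_eq[of "act g" ?M ?M ?U] iU by (simp add: dist)
  have iUU: "integrable ?M (\<lambda>y. ?U y * ?U y)"
    by (rule Bochner_Integration.integrable_bound[OF iU]) (auto simp: pmf_le_1 mult_left_le)
  have iUV: "integrable ?M (\<lambda>y. ?U y * ?V y)"
    by (rule Bochner_Integration.integrable_bound[OF iU]) (auto simp: pmf_le_1 mult_left_le)
  have iVV: "integrable ?M (\<lambda>y. ?V y * ?V y)"
    by (rule Bochner_Integration.integrable_bound[OF iV]) (auto simp: pmf_le_1 mult_left_le)
  have VV: "(\<integral>y. ?V y * ?V y \<partial>?M) = (\<integral>y. ?U y * ?U y \<partial>?M)"
    using integral_distr[of "act g" ?M ?M "\<lambda>y. ?U y * ?U y"] by (simp add: dist)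
  have sq: "(?U y - ?V y)\<^sup>2 = ?U y * ?U y + ?V y * ?V y - 2 * (?U y * ?V y)" for y
    by (simp add: power2_eq_square algebra_simps)
  have int: "integrable ?M (\<lambda>y. (?U y - ?V y)\<^sup>2)" unfolding sq using iUU iVV iUV by simp
  have "(\<Sum>y\<in>Y. (?U y - ?V y)\<^sup>2) = (\<integral>y. indicator Y y * (?U y - ?V y)\<^sup>2 \<partial>?M)"
    using Y by (subst lebesgue_integral_count_space_finite_support)
      (auto simp: indicator_def intro!: sum.mono_neutral_cong_right finite_subset[OF _ Y] split: if_splits)
  also have "\<dots> \<le> (\<integral>y. (?U y - ?V y)\<^sup>2 \<partial>?M)"
    by (rule integral_mono[OF _ int]) (auto simp: indicator_def intro!: Bochner_Integration.integrable_bound[OF int])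
  also have "\<dots> = 2 * ((\<integral>y. ?U y * ?U y \<partial>?M) - (\<integral>y. ?U y * ?V y \<partial>?M))"
    unfolding sq using iUU iVV iUV VV by simp
  finally show ?thesis by (simp add: E)
qed

text \<open>Pairing the Green equation with \<open>U\<close> itself bounds \<open>l\<close> times
  the \<open>\<mu>\<close>-average of \<open>N - J g\<close> by \<open>(1 - l) * U x\<close>. These
  differences are nonnegative on the support, so each atom \<open>s\<close> obeys the bound alone,
  at the price of a factor \<open>1 / pmf \<mu> s\<close>. Products follow from the triangle
  inequality in l2.\<close>

lemma dirichlet_bound:
  assumes "g \<in> semigroup_generate G (set_pmf \<mu>)"
  shows "\<exists>K\<ge>0. \<forall>l x Y. 0 < l \<longrightarrow> l < 1 \<longrightarrow> finite Y \<longrightarrow>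
     L2_set (\<lambda>y. pmf (green l x) y - pmf (green l x) (act g y)) Y \<le> K * sqrt ((1 - l) * pmf (green l x) x / l)"
  using assms
proof (induction rule: semigroup_generate.induct)
  case (incl s)
  have sc: "s \<in> carrier G" using incl supp by blast
  have ms: "0 < pmf \<mu> s" using incl by (simp add: pmf_positive)
  show ?case
  proof (intro exI[of _ "sqrt (2 / pmf \<mu> s)"] conjI allI impI)
    fix l :: real and x Y assume l: "0 < l" "l < 1" and Y: "finite (Y :: 'b set)"
    let ?q = "green l x" let ?U = "pmf ?q"
    define J where "J g = measure_pmf.expectation ?q (\<lambda>y. ?U (act g y))" for g
    define N where "N = measure_pmf.expectation ?q ?U"
    have J01: "0 \<le> J g" "J g \<le> 1" for g
      unfolding J_def by (auto intro!: integral_nonneg_AE measure_pmf.integral_le_const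
          measure_pmf.integrable_const_bound[where B = 1] simp: pmf_le_1)
    have N0: "0 \<le> N" unfolding N_def by (auto intro!: integral_nonneg_AE)
    have JN: "J g \<le> N" if "g \<in> carrier G" for g
      using sum_square_diff_le[OF that, of "{}" ?q] by (simp add: J_def N_def)
    have intJ: "integrable (measure_pmf \<mu>) J"
      using J01 by (intro measure_pmf.integrable_const_bound[where B = 1]) auto
    have Neq: "N = (1 - l) * ?U x + l * measure_pmf.expectation \<mu> J"
      unfolding N_def by (subst expectation_green[OF l]) (auto simp: pmf_le_1 J_def[abs_def])
    have "measure_pmf.expectation \<mu> (\<lambda>g. (N - J s) * indicator {s} g) \<le> measure_pmf.expectation \<mu> (\<lambda>g. N - J g)"
    proof (rule integral_mono_AE)
      show "integrable (measure_pmf \<mu>) (\<lambda>g. (N - J s) * indicator {s} g)"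
        by (rule measure_pmf.integrable_const_bound[where B = "\<bar>N - J s\<bar>"]) (auto simp: indicator_def)
      show "AE g in measure_pmf \<mu>. (N - J s) * indicator {s} g \<le> N - J g"
        using JN supp by (auto simp: AE_measure_pmf_iff indicator_def)
    qed (use intJ in simp)
    also have "measure_pmf.expectation \<mu> (\<lambda>g. (N - J s) * indicator {s} g) = (N - J s) * pmf \<mu> s"
      by (simp add: measure_pmf_single)
    also have "measure_pmf.expectation \<mu> (\<lambda>g. N - J g) = N - measure_pmf.expectation \<mu> J" using intJ by simp
    finally have "l * ((N - J s) * pmf \<mu> s) \<le> l * (N - measure_pmf.expectation \<mu> J)"
      using l by (intro mult_left_mono) auto
    also have "\<dots> = (1 - l) * ?U x - (1 - l) * N" using Neq by (simp add: algebra_simps)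
    also have "\<dots> \<le> (1 - l) * ?U x" using N0 l by simp
    finally have "2 * (N - J s) \<le> 2 / pmf \<mu> s * ((1 - l) * ?U x / l)" using l ms by (simp add: field_simps)
    then have "sqrt (\<Sum>y\<in>Y. (?U y - ?U (act s y))\<^sup>2) \<le> sqrt (2 / pmf \<mu> s * ((1 - l) * ?U x / l))"
      using sum_square_diff_le[OF sc Y, of ?q] by (intro real_sqrt_le_mono) (simp add: J_def N_def)
    then show "L2_set (\<lambda>y. ?U y - ?U (act s y)) Y \<le> sqrt (2 / pmf \<mu> s) * sqrt ((1 - l) * ?U x / l)"
      by (simp only: L2_set_def real_sqrt_mult[symmetric])
  qed simp
next
  case (mult s t)
  have c: "s \<in> carrier G" "t \<in> carrier G" using mult.hyps by (simp_all add: gen)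
  obtain K1 where K1: "K1 \<ge> 0" "\<And>l x Y. 0 < l \<Longrightarrow> l < 1 \<Longrightarrow> finite Y \<Longrightarrow>
     L2_set (\<lambda>y. pmf (green l x) y - pmf (green l x) (act s y)) Y \<le> K1 * sqrt ((1 - l) * pmf (green l x) x / l)"
    using mult.IH(1) by blast
  obtain K2 where K2: "K2 \<ge> 0" "\<And>l x Y. 0 < l \<Longrightarrow> l < 1 \<Longrightarrow> finite Y \<Longrightarrow>
     L2_set (\<lambda>y. pmf (green l x) y - pmf (green l x) (act t y)) Y \<le> K2 * sqrt ((1 - l) * pmf (green l x) x / l)"
    using mult.IH(2) by blast
  show ?case
  proof (intro exI[of _ "K2 + K1"] conjI allI impI)
    fix l :: real and x Y assume l: "0 < l" "l < 1" and Y: "finite (Y :: 'b set)"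
    let ?U = "pmf (green l x)"
    have "L2_set (\<lambda>y. ?U y - ?U (act (s \<otimes> t) y)) Y
        = L2_set (\<lambda>y. (?U y - ?U (act t y)) + (?U (act t y) - ?U (act s (act t y)))) Y"
      using c by (simp add: act_mult)
    also have "\<dots> \<le> L2_set (\<lambda>y. ?U y - ?U (act t y)) Y + L2_set (\<lambda>y. ?U (act t y) - ?U (act s (act t y))) Y"
      by (rule L2_set_triangle_ineq)
    also have "L2_set (\<lambda>y. ?U (act t y) - ?U (act s (act t y))) Y = L2_set (\<lambda>y. ?U y - ?U (act s y)) (act t ` Y)"
      unfolding L2_set_def using inj_on_subset[OF inj_act[OF c(2)]] by (subst sum.reindex) auto
    also have "L2_set (\<lambda>y. ?U y - ?U (act t y)) Y + \<dots>
        \<le> K2 * sqrt ((1 - l) * ?U x / l) + K1 * sqrt ((1 - l) * ?U x / l)"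
      using K1(2)[OF l, of "act t ` Y" x] K2(2)[OF l Y, of x] Y by simp
    finally show "L2_set (\<lambda>y. ?U y - ?U (act (s \<otimes> t) y)) Y \<le> (K2 + K1) * sqrt ((1 - l) * ?U x / l)"
      by (simp add: distrib_right)
  qed (use K1 K2 in simp)
qed

text \<open>By \<open>emeasure_jump\<close>, the probability that the increment number
  \<open>n\<close> changes the cocycle at \<open>x\<close>.\<close>

definition jump_prob :: "'b \<Rightarrow> nat \<Rightarrow> real" where
  "jump_prob x n = measure_pmf.expectation (orbit_pmf x n) (\<lambda>y. measure_pmf.prob \<mu> {g. C g y \<noteq> 0})"

text \<open>With \<open>U = pmf (green l x)\<close>, ping-pong bounds \<open>U x\<close> by a
  multiple of \<open>sqrt ((1 - l) * U x / l)\<close>; squaring and cancelling \<open>U x\<close>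
  shows that it is of order \<open>1 - l\<close>, so the Green function stays bounded as
  \<open>l\<close> tends to 1. The maximum principle carries this to every point, and
  \<open>moment\<close> sums it over the points where an increment has nonzero cocycle.\<close>

lemma summable_jump_prob:
  assumes a: "a \<in> carrier G" and b: "b \<in> carrier G"
    and I: "x \<in> I" "act a ` I \<subseteq> I" "act b ` I \<subseteq> I" "act a ` I \<inter> act b ` I = {}"
  shows "summable (jump_prob x)"
proof -
  obtain K1 where K1: "K1 \<ge> 0" "\<And>l x Y. 0 < l \<Longrightarrow> l < 1 \<Longrightarrow> finite Y \<Longrightarrow>
     L2_set (\<lambda>y. pmf (green l x) y - pmf (green l x) (act a y)) Y \<le> K1 * sqrt ((1 - l) * pmf (green l x) x / l)"
    using dirichlet_bound[of a] a gen by blast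
  obtain K2 where K2: "K2 \<ge> 0" "\<And>l x Y. 0 < l \<Longrightarrow> l < 1 \<Longrightarrow> finite Y \<Longrightarrow>
     L2_set (\<lambda>y. pmf (green l x) y - pmf (green l x) (act b y)) Y \<le> K2 * sqrt ((1 - l) * pmf (green l x) x / l)"
    using dirichlet_bound[of b] b gen by blast
  define K where "K = max K1 K2"
  have K: "K \<ge> 0" using K1 by (simp add: K_def)
  have Ux: "pmf (green l x) x \<le> 16 * K\<^sup>2 * (1 - l) / l" if l: "0 < l" "l < 1" for l
  proof -
    let ?U = "pmf (green l x)" let ?k = "K * sqrt ((1 - l) * ?U x / l)"
    have s0: "0 \<le> sqrt ((1 - l) * ?U x / l)" using l by simp
    have "?U x \<le> 4 * ?k"
    proof (rule ping_pong_poincare[where U = ?U, OF _ _ inj_act[OF a] inj_act[OF b] I])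
      show "sum ?U Y \<le> 1" if "finite Y" for Y
        using measure_measure_pmf_finite[OF that, of "green l x"] measure_pmf.prob_le_1 by metis
      show "L2_set (\<lambda>y. ?U y - ?U (act a y)) Y \<le> ?k" if "finite Y" for Y
        using K1(2)[OF l that, of x] mult_right_mono[OF _ s0, of K1 K] by (simp add: K_def)
      show "L2_set (\<lambda>y. ?U y - ?U (act b y)) Y \<le> ?k" if "finite Y" for Y
        using K2(2)[OF l that, of x] mult_right_mono[OF _ s0, of K2 K] by (simp add: K_def)
    qed simp
    then have "(?U x)\<^sup>2 \<le> (4 * ?k)\<^sup>2" by (intro power_mono) auto
    also have "\<dots> = 16 * K\<^sup>2 * (1 - l) / l * ?U x" using l by (simp add: power_mult_distrib)
    finally have le: "?U x * ?U x \<le> 16 * K\<^sup>2 * (1 - l) / l * ?U x" by (simp add: power2_eq_square)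
    have "0 \<le> 16 * K\<^sup>2 * (1 - l) / l" using l by simp
    then show ?thesis using mult_right_le_imp_le[OF le] pmf_nonneg[of "green l x" x]
      by (cases "?U x = 0") (simp, linarith)
  qed
  define M where "M = measure_pmf.expectation \<mu> (\<lambda>g. real (card {y. C g y \<noteq> 0}))"
  have M0: "0 \<le> M" unfolding M_def by (auto intro!: integral_nonneg_AE)
  let ?b = "\<lambda>y. measure_pmf.prob \<mu> {g. C g y \<noteq> 0}"
  have jp: "ennreal (jump_prob x n) = (\<integral>\<^sup>+y. ?b y \<partial>orbit_pmf x n)" for n
    unfolding jump_prob_def by (rule nn_integral_eq_integral[symmetric])
      (auto intro!: measure_pmf.integrable_const_bound[where B = 1])
  have jp0: "0 \<le> jump_prob x n" for n unfolding jump_prob_def by (auto intro!: integral_nonneg_AE)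
  \<comment> \<open>\<open>l ^ N\<close> bounds the weights \<open>l ^ n\<close> with
    \<open>n < N\<close> from below, the further factor \<open>l\<close> clears a denominator, and
    \<open>1 - l\<close> cancels.\<close>
  have main: "(\<Sum>n<N. jump_prob x n) * l ^ (Suc N) \<le> 16 * K\<^sup>2 * M" if l: "0 < l" "l < 1" for l N
  proof -
    have "(\<integral>\<^sup>+y. ?b y \<partial>green l x) = (\<integral>\<^sup>+y. \<integral>\<^sup>+g. indicator {g. C g y \<noteq> 0} g \<partial>\<mu> \<partial>green l x)"
      by (simp add: measure_pmf.emeasure_eq_measure)
    also have "\<dots> = (\<integral>\<^sup>+g. \<integral>\<^sup>+y. indicator {g. C g y \<noteq> 0} g \<partial>green l x \<partial>\<mu>)" by (rule nn_integral_pmf_swap)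
    also have "\<dots> = (\<integral>\<^sup>+g. \<integral>\<^sup>+y. indicator {y. C g y \<noteq> 0} y \<partial>green l x \<partial>\<mu>)"
      by (simp add: indicator_def)
    also have "\<dots> = (\<integral>\<^sup>+g. ennreal (measure_pmf.prob (green l x) {y. C g y \<noteq> 0}) \<partial>\<mu>)"
      by (simp add: measure_pmf.emeasure_eq_measure)
    also have "\<dots> \<le> (\<integral>\<^sup>+g. ennreal (16 * K\<^sup>2 * (1 - l) / l * real (card {y. C g y \<noteq> 0})) \<partial>\<mu>)"
    proof (intro nn_integral_mono_AE, unfold AE_measure_pmf_iff, intro ballI ennreal_leI)
      fix g assume "g \<in> set_pmf \<mu>"
      then have fin: "finite {y. C g y \<noteq> 0}" using supp finite_C by blast
      have "measure_pmf.prob (green l x) {y. C g y \<noteq> 0} = (\<Sum>y\<in>{y. C g y \<noteq> 0}. pmf (green l x) y)"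
        by (rule measure_measure_pmf_finite[OF fin])
      also have "\<dots> \<le> real (card {y. C g y \<noteq> 0}) * (16 * K\<^sup>2 * (1 - l) / l)"
        using pmf_green_le[OF l, of x] Ux[OF l] by (intro sum_bounded_above) (meson order_trans)
      finally show "measure_pmf.prob (green l x) {y. C g y \<noteq> 0} \<le> 16 * K\<^sup>2 * (1 - l) / l * real (card {y. C g y \<noteq> 0})"
        by (simp add: mult.commute)
    qed
    also have "\<dots> = ennreal (16 * K\<^sup>2 * (1 - l) / l * M)"
      unfolding M_def using moment l
      by (subst nn_integral_eq_integral) (auto intro!: AE_I2)
    finally have up: "(\<integral>\<^sup>+y. ?b y \<partial>green l x) \<le> ennreal (16 * K\<^sup>2 * (1 - l) / l * M)" .
    have "ennreal ((1 - l) * l ^ N * (\<Sum>n<N. jump_prob x n)) \<le> (\<Sum>n<N. ennreal (l ^ n * (1 - l)) * ennreal (jump_prob x n))"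
    proof -
      have "(1 - l) * l ^ N * (\<Sum>n<N. jump_prob x n) \<le> (\<Sum>n<N. (l ^ n * (1 - l)) * jump_prob x n)"
        unfolding sum_distrib_left using l jp0
        by (intro sum_mono mult_right_mono) (auto intro: power_decreasing)
      then show ?thesis using l jp0 by (auto simp: ennreal_mult[symmetric] sum_nonneg intro!: ennreal_leI)
    qed
    also have "\<dots> \<le> (\<Sum>n. ennreal (l ^ n * (1 - l)) * ennreal (jump_prob x n))"
      by (rule sum_le_suminf) auto
    also have "\<dots> = (\<integral>\<^sup>+n. ennreal (jump_prob x n) \<partial>geometric_pmf (1 - l))"
      using l by (simp add: nn_integral_measure_pmf nn_integral_count_space_nat)
    also have "\<dots> = (\<integral>\<^sup>+y. ?b y \<partial>green l x)" unfolding green_def by (simp add: jp)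
    finally have "ennreal ((1 - l) * l ^ N * (\<Sum>n<N. jump_prob x n)) \<le> ennreal (16 * K\<^sup>2 * (1 - l) / l * M)"
      using up by (rule order_trans)
    then have "(1 - l) * l ^ N * (\<Sum>n<N. jump_prob x n) \<le> 16 * K\<^sup>2 * (1 - l) / l * M"
      using l M0 by (simp add: ennreal_le_iff)
    then have "(1 - l) * (l ^ N * (\<Sum>n<N. jump_prob x n)) \<le> (1 - l) * (16 * K\<^sup>2 * M / l)" by (simp add: mult_ac)
    then have "l ^ N * (\<Sum>n<N. jump_prob x n) \<le> 16 * K\<^sup>2 * M / l" using l by (subst (asm) mult_le_cancel_left_pos) auto
    then show ?thesis using l by (simp add: field_simps)
  qed
  have "(\<Sum>n<N. jump_prob x n) \<le> 16 * K\<^sup>2 * M" for N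
  proof -
    have "((\<lambda>l. (\<Sum>n<N. jump_prob x n) * l ^ (Suc N)) \<longlongrightarrow> (\<Sum>n<N. jump_prob x n) * 1 ^ (Suc N)) (at_left 1)"
      by (intro tendsto_intros)
    then have "(\<Sum>n<N. jump_prob x n) * 1 ^ (Suc N) \<le> 16 * K\<^sup>2 * M"
    proof (rule tendsto_upperbound)
      show "\<forall>\<^sub>F l in at_left 1. (\<Sum>n<N. jump_prob x n) * l ^ Suc N \<le> 16 * K\<^sup>2 * M"
        unfolding eventually_at_left_field using main by (intro exI[of _ 0]) auto
    qed simp
    then show ?thesis by simp
  qed
  then show ?thesis using jp0 by (intro summableI_nonneg_bounded) auto
qed


section \<open>The space of increments\<close>

abbreviation step_measure :: "'a measure" where
  "step_measure \<equiv> restrict_space (measure_pmf \<mu>) (carrier G)"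

abbreviation steps :: "(nat \<Rightarrow> 'a) measure" where
  "steps \<equiv> \<Pi>\<^sub>M n\<in>UNIV. step_measure"

lemma space_step_measure: "space step_measure = carrier G"
  by (simp add: space_restrict_space)

lemma sets_step_measure: "sets step_measure = sets (count_space (carrier G))"
  by (auto simp: sets_restrict_space)

lemma prob_space_step_measure: "prob_space step_measure"
  using supp by (intro prob_spaceI)
    (simp add: space_step_measure emeasure_restrict_space measure_pmf.emeasure_eq_1_AE AE_measure_pmf_iff subset_iff)

lemma sequence_space_step_measure: "sequence_space step_measure"
  unfolding sequence_space_def product_prob_space_def product_prob_space_axioms_def product_sigma_finite_def
  using prob_space_step_measure prob_space_imp_sigma_finite by blast

lemma prob_space_steps: "prob_space steps"
  using prob_space_step_measure by (rule prob_space_PiM)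

lemma space_steps: "y \<in> space steps \<longleftrightarrow> (\<forall>n. y n \<in> carrier G)"
  by (auto simp: space_PiM space_step_measure)

lemma nn_integral_step_measure: "(\<integral>\<^sup>+g. f g \<partial>step_measure) = (\<integral>\<^sup>+g. f g \<partial>measure_pmf \<mu>)"
proof -
  have "(\<integral>\<^sup>+g. f g \<partial>step_measure) = (\<integral>\<^sup>+g. f g * indicator (carrier G) g \<partial>measure_pmf \<mu>)"
    by (rule nn_integral_restrict_space) simp
  also have "\<dots> = (\<integral>\<^sup>+g. f g \<partial>measure_pmf \<mu>)"
    using supp by (intro nn_integral_cong_AE) (auto simp: AE_measure_pmf_iff indicator_def)
  finally show ?thesis .
qed

text \<open>Every element is a word in the countable support. Countability makes products of
  discrete sigma-algebras discrete and leaves countably many values for the limit of the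
  cocycle.\<close>

lemma countable_carrier: "countable (carrier G)"
proof -
  have "carrier G \<subseteq> (\<lambda>ws. foldr (\<otimes>) ws \<one>) ` lists (set_pmf \<mu>)"
  proof
    fix g assume "g \<in> carrier G"
    then have "g \<in> semigroup_generate G (set_pmf \<mu>)" by (simp add: gen)
    then show "g \<in> (\<lambda>ws. foldr (\<otimes>) ws \<one>) ` lists (set_pmf \<mu>)"
    proof (induction rule: semigroup_generate.induct)
      case (incl s) then show ?case using supp by (intro image_eqI[of _ _ "[s]"]) auto
    next
      case (mult s t)
      then obtain u v where uv: "u \<in> lists (set_pmf \<mu>)" "s = foldr (\<otimes>) u \<one>" "v \<in> lists (set_pmf \<mu>)" "t = foldr (\<otimes>) v \<one>"
        by blast
      have tc: "t \<in> carrier G" using mult.hyps gen by simp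
      have *: "foldr (\<otimes>) w \<one> \<otimes> t = foldr (\<otimes>) w t \<and> foldr (\<otimes>) w \<one> \<in> carrier G" if "w \<in> lists (set_pmf \<mu>)" for w
        using that supp tc by (induction w) (auto simp: m_assoc)
      have "s \<otimes> t = foldr (\<otimes>) (u @ v) \<one>" using *[OF uv(1)] uv by simp
      then show ?case using uv by (intro image_eqI[of _ _ "u @ v"]) auto
    qed
  qed
  then show ?thesis by (rule countable_subset) (simp add: countable_lists)
qed

lemma walk_closed: "(\<And>n. y n \<in> carrier G) \<Longrightarrow> walk G y n \<in> carrier G"
  by (induction n) auto

lemma measurable_step: "(\<lambda>y. y n) \<in> steps \<rightarrow>\<^sub>M count_space (carrier G)"
  using measurable_component_singleton[of n UNIV "\<lambda>_. step_measure"]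
  by (subst measurable_cong_sets[OF refl sets_step_measure, symmetric]) blast

lemma measurable_pair_step:
  assumes "f \<in> M \<rightarrow>\<^sub>M count_space (carrier G)" "h \<in> M \<rightarrow>\<^sub>M count_space (carrier G)"
  shows "(\<lambda>y. (f y, h y)) \<in> M \<rightarrow>\<^sub>M count_space (carrier G \<times> carrier G)"
  using measurable_Pair[OF assms] by (simp add: pair_measure_countable countable_carrier)

lemma measurable_walk_at: "(\<lambda>y. walk G y n) \<in> steps \<rightarrow>\<^sub>M count_space (carrier G)"
proof (induction n)
  case (Suc n)
  from measurable_compose[OF measurable_pair_step[OF measurable_step[of n] Suc], of "\<lambda>(a, b). a \<otimes> b" "count_space (carrier G)"]
  show ?case by (auto simp: case_prod_beta Pi_iff)
qed simp

lemma measurable_walk: "walk G \<in> steps \<rightarrow>\<^sub>M (\<Pi>\<^sub>M n\<in>UNIV. count_space (carrier G))"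
  by (rule measurable_PiM_single') (use measurable_walk_at in \<open>auto simp: measurable_def\<close>)

lemma sets_walk_at: "{y \<in> space steps. P (walk G y n)} \<in> sets steps"
proof -
  have "{y \<in> space steps. P (walk G y n)} = (\<lambda>y. walk G y n) -` {g \<in> carrier G. P g} \<inter> space steps"
    using walk_closed by (auto simp: space_steps)
  then show ?thesis using measurable_sets[OF measurable_walk_at, of "{g \<in> carrier G. P g}" n] by simp
qed

lemma sets_step_walk: "{y \<in> space steps. P (y n) (walk G y n)} \<in> sets steps"
proof -
  have eq: "{y \<in> space steps. P (y n) (walk G y n)}
      = (\<lambda>y. (y n, walk G y n)) -` {(g, h) \<in> carrier G \<times> carrier G. P g h} \<inter> space steps"
    using walk_closed by (auto simp: space_steps)
  show ?thesis unfolding eq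
    by (rule measurable_sets[OF measurable_pair_step[OF measurable_step measurable_walk_at]]) auto
qed

lemma walk_comb_seq:
  assumes "\<And>i. u i \<in> carrier G" "\<And>i. v i \<in> carrier G"
  shows "n \<le> m \<Longrightarrow> walk G (comb_seq m u v) n = walk G u n"
    and "walk G (comb_seq m u v) (n + m) = walk G v n \<otimes> walk G u m"
proof -
  show 1: "walk G (comb_seq m u v) n = walk G u n" if "n \<le> m" for n m
    using that by (induction n) (auto simp: comb_seq_def)
  show "walk G (comb_seq m u v) (n + m) = walk G v n \<otimes> walk G u m"
  proof (induction n)
    case 0 then show ?case using 1[of m m] walk_closed assms by simp
  next
    case (Suc n)
    then show ?case using comb_seq_add[of m u v n] walk_closed assms by (simp add: m_assoc)
  qed
qed

text \<open>Markov property at time \<open>m\<close>: two independent sequences of increments glued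
  at \<open>m\<close> again have the law \<open>steps\<close>, so an event that splits into
  conditions on the two parts has product measure.\<close>

lemma emeasure_steps_split:
  assumes A: "A \<in> sets steps" and B: "B \<in> sets steps" and D: "D \<in> sets steps"
    and eq: "\<And>u v. u \<in> space steps \<Longrightarrow> v \<in> space steps \<Longrightarrow> comb_seq m u v \<in> D \<longleftrightarrow> u \<in> A \<and> v \<in> B"
  shows "emeasure steps D = emeasure steps A * emeasure steps B"
proof -
  interpret Q: prob_space steps by (rule prob_space_steps)
  interpret sequence_space step_measure by (rule sequence_space_step_measure)
  have AB: "A \<subseteq> space steps" "B \<subseteq> space steps" using A B by (auto dest: sets.sets_into_space)
  have "emeasure steps D = emeasure (distr (steps \<Otimes>\<^sub>M steps) steps (\<lambda>(u, v). comb_seq m u v)) D"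
    by (simp only: PiM_comb_seq)
  also have "\<dots> = emeasure (steps \<Otimes>\<^sub>M steps) ((\<lambda>(u, v). comb_seq m u v) -` D \<inter> space (steps \<Otimes>\<^sub>M steps))"
    using D by (rule emeasure_distr[OF measurable_comb_seq])
  also have "(\<lambda>(u, v). comb_seq m u v) -` D \<inter> space (steps \<Otimes>\<^sub>M steps) = A \<times> B"
    using eq AB eq[OF subsetD[OF AB(1)] subsetD[OF AB(2)]] by (auto simp: space_pair_measure)
  also have "emeasure (steps \<Otimes>\<^sub>M steps) (A \<times> B) = emeasure steps A * emeasure steps B"
    using A B by (rule Q.emeasure_pair_measure_Times)
  finally show ?thesis .
qed

lemma emeasure_steps_first:
  assumes D: "D \<in> sets steps"
  shows "emeasure steps D = (\<integral>\<^sup>+g. emeasure steps {v \<in> space steps. case_nat g v \<in> D} \<partial>step_measure)"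
proof -
  interpret Q: prob_space steps by (rule prob_space_steps)
  interpret sequence_space step_measure by (rule sequence_space_step_measure)
  have m: "(\<lambda>(s, v). case_nat s v) \<in> step_measure \<Otimes>\<^sub>M steps \<rightarrow>\<^sub>M steps"
    unfolding split_beta' by measurable
  have "emeasure steps D = emeasure (distr (step_measure \<Otimes>\<^sub>M steps) steps (\<lambda>(s, v). case_nat s v)) D"
    by (simp only: PiM_iter)
  also have "\<dots> = emeasure (step_measure \<Otimes>\<^sub>M steps) ((\<lambda>(s, v). case_nat s v) -` D \<inter> space (step_measure \<Otimes>\<^sub>M steps))"
    using D by (rule emeasure_distr[OF m])
  also have "\<dots> = (\<integral>\<^sup>+g. emeasure steps (Pair g -` ((\<lambda>(s, v). case_nat s v) -` D \<inter> space (step_measure \<Otimes>\<^sub>M steps))) \<partial>step_measure)"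
    using measurable_sets[OF m D] by (rule Q.emeasure_pair_measure_alt)
  also have "\<dots> = (\<integral>\<^sup>+g. emeasure steps {v \<in> space steps. case_nat g v \<in> D} \<partial>step_measure)"
    by (intro nn_integral_cong arg_cong2[where f = emeasure] refl) (auto simp: space_pair_measure)
  finally show ?thesis .
qed

lemma walk_case_nat:
  assumes "g \<in> carrier G" "\<And>i. v i \<in> carrier G"
  shows "walk G (case_nat g v) (Suc n) = walk G v n \<otimes> g"
  by (induction n) (use assms walk_closed[of v] in \<open>auto simp: m_assoc\<close>)

text \<open>Prepending \<open>g\<close> turns \<open>walk G v n\<close> into
  \<open>walk G v n \<otimes> g\<close>, so after the first increment the walk restarts at the point
  \<open>act g x\<close>; the induction therefore generalises \<open>x\<close>.\<close>

lemma emeasure_jump: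
  "emeasure steps {y \<in> space steps. C (y n) (act (walk G y n) x) \<noteq> 0} = jump_prob x n"
proof -
  let ?b = "\<lambda>y. measure_pmf.prob \<mu> {g. C g y \<noteq> 0}"
  have jp: "ennreal (jump_prob x n) = (\<integral>\<^sup>+y. ?b y \<partial>orbit_pmf x n)" for x n
    unfolding jump_prob_def by (rule nn_integral_eq_integral[symmetric])
      (auto intro!: measure_pmf.integrable_const_bound[where B = 1])
  have jump_Suc: "ennreal (jump_prob x (Suc n)) = (\<integral>\<^sup>+g. jump_prob (act g x) n \<partial>\<mu>)" for x n
    unfolding jp orbit_pmf_Suc' by simp
  interpret Q: prob_space steps by (rule prob_space_steps)
  show ?thesis
  proof (induction n arbitrary: x)
    case 0
    have "{v \<in> space steps. case_nat g v \<in> {y \<in> space steps. C (y 0) x \<noteq> 0}}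
        = (if C g x \<noteq> 0 then space steps else {})" if "g \<in> carrier G" for g
      using that by (auto simp: space_steps split: nat.split)
    then have "emeasure steps {y \<in> space steps. C (y 0) x \<noteq> 0}
        = (\<integral>\<^sup>+g. indicator {g. C g x \<noteq> 0} g \<partial>step_measure)"
      by (subst emeasure_steps_first[OF sets_step_walk])
        (auto simp: space_step_measure Q.emeasure_space_1 intro!: nn_integral_cong)
    also have "\<dots> = ?b x" by (simp add: nn_integral_step_measure measure_pmf.emeasure_eq_measure)
    finally show ?case by (simp add: act_one jump_prob_def)
  next
    case (Suc n)
    have "emeasure steps {y \<in> space steps. C (y (Suc n)) (act (walk G y (Suc n)) x) \<noteq> 0}
       = (\<integral>\<^sup>+g. emeasure steps {v \<in> space steps. C (v n) (act (walk G v n) (act g x)) \<noteq> 0} \<partial>step_measure)"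
    proof (subst emeasure_steps_first[OF sets_step_walk], intro nn_integral_cong arg_cong2[where f = emeasure] refl)
      fix g assume "g \<in> space step_measure"
      then have g: "g \<in> carrier G" by (simp add: space_step_measure)
      have "C (case_nat g v (Suc n)) (act (walk G (case_nat g v) (Suc n)) x) = C (v n) (act (walk G v n) (act g x))"
        "case_nat g v \<in> space steps" if "v \<in> space steps" for v
        using that g walk_case_nat[OF g, of v n] walk_closed[of v n]
        by (auto simp: space_steps act_mult split: nat.split)
      then show "{v \<in> space steps. case_nat g v \<in> {y \<in> space steps. C (y (Suc n)) (act (walk G y (Suc n)) x) \<noteq> 0}}
          = {v \<in> space steps. C (v n) (act (walk G v n) (act g x)) \<noteq> 0}" by auto
    qed
    also have "\<dots> = jump_prob x (Suc n)" by (simp add: Suc nn_integral_step_measure jump_Suc)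
    finally show ?case .
  qed
qed

text \<open>A word in the support is spelled out with positive probability: reach \<open>t\<close>,
  then let an independent second part reach \<open>s\<close>.\<close>

lemma walk_hits:
  assumes "g \<in> carrier G"
  shows "\<exists>m. 0 < emeasure steps {y \<in> space steps. walk G y m = g}"
proof -
  interpret Q: sequence_space step_measure by (rule sequence_space_step_measure)
  have "g \<in> semigroup_generate G (set_pmf \<mu>)" using assms by (simp add: gen)
  then show ?thesis
  proof (induction rule: semigroup_generate.induct)
    case (incl s)
    then have s: "s \<in> carrier G" using supp by blast
    have "{y \<in> space steps. walk G y 1 = s} = {y \<in> space steps. y 0 \<in> {s}}"
      by (auto simp: space_steps)
    then have "emeasure steps {y \<in> space steps. walk G y 1 = s} = emeasure step_measure {s}"
      using s Q.emeasure_PiM_Collect_single[of 0 "{s}"] by (simp add: sets_step_measure)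
    also have "\<dots> = pmf \<mu> s" using s by (simp add: emeasure_restrict_space emeasure_pmf_single)
    finally show ?case using incl by (intro exI[of _ 1]) (simp add: pmf_positive)
  next
    case (mult s t)
    then obtain m n where m: "0 < emeasure steps {y \<in> space steps. walk G y m = t}"
      and n: "0 < emeasure steps {y \<in> space steps. walk G y n = s}" by blast
    let ?D = "{y \<in> space steps. walk G y m = t \<and> walk G y (n + m) = s \<otimes> t}"
    have c: "s \<in> carrier G" "t \<in> carrier G" using mult.hyps by (simp_all add: gen)
    have D: "?D \<in> sets steps"
      using sets.Int[OF sets_walk_at[of "\<lambda>g. g = t" m] sets_walk_at[of "\<lambda>g. g = s \<otimes> t" "n + m"]]
      by (simp add: Collect_conj_eq Int_ac)
    have "emeasure steps ?D = emeasure steps {y \<in> space steps. walk G y m = t} * emeasure steps {y \<in> space steps. walk G y n = s}"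
    proof (rule emeasure_steps_split[OF sets_walk_at sets_walk_at D, where m = m])
      fix u v assume "u \<in> space steps" "v \<in> space steps"
      then have uv: "\<And>i. u i \<in> carrier G" "\<And>i. v i \<in> carrier G" by (auto simp: space_steps)
      have "comb_seq m u v \<in> space steps" using uv by (auto simp: space_steps comb_seq_def)
      then show "comb_seq m u v \<in> ?D \<longleftrightarrow> u \<in> {y \<in> space steps. walk G y m = t} \<and> v \<in> {y \<in> space steps. walk G y n = s}"
        using walk_comb_seq(1)[of u v m m, OF uv] walk_comb_seq(2)[of u v m n, OF uv] uv c walk_closed[of v n] by (auto simp: space_steps)
    qed
    then have "0 < emeasure steps ?D" using m n by (simp add: ennreal_zero_less_mult_iff)
    also have "\<dots> \<le> emeasure steps {y \<in> space steps. walk G y (n + m) = s \<otimes> t}"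
      by (rule emeasure_mono[OF _ sets_walk_at]) auto
    finally show ?case by blast
  qed
qed

section \<open>The limit of the cocycle\<close>

text \<open>Eventual equality rather than convergence: once the changes stop, the cocycle is
  constant.\<close>

definition limit_event :: "'b \<Rightarrow> real \<Rightarrow> (nat \<Rightarrow> 'a) set" where
  "limit_event x c = {y \<in> space steps. \<forall>\<^sub>F n in sequentially. C (walk G y n) x = c}"

lemma sets_limit_event: "limit_event x c \<in> sets steps"
proof -
  have "limit_event x c = (\<Union>N. \<Inter>n\<in>{N..}. {y \<in> space steps. C (walk G y n) x = c})"
    by (auto simp: limit_event_def eventually_sequentially)
  also have "\<dots> \<in> sets steps"
    by (intro sets.countable_UN sets.countable_INT'' ) (auto intro!: sets_walk_at)
  finally show ?thesis .
qed

text \<open>If all these events had probability 0 or 1, one value \<open>c\<close> would be almost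
  sure, as only countably many values occur. Given that the walk is at \<open>g\<close> at time
  \<open>m\<close>, the limit is \<open>c\<close> exactly when the remaining walk has limit
  \<open>c - C g x\<close>, because \<open>g\<close> fixes \<open>x\<close>. That is a null event,
  yet the condition has positive probability.\<close>

lemma limit_event_intermediate:
  assumes sum: "summable (jump_prob x)" and g: "g \<in> carrier G" "act g x = x" "C g x \<noteq> 0"
  shows "\<exists>c. 0 < emeasure steps (limit_event x c) \<and> emeasure steps (limit_event x c) < 1"
proof -
  interpret Q: prob_space steps by (rule prob_space_steps)
  let ?J = "\<lambda>n. {y \<in> space steps. C (y n) (act (walk G y n) x) \<noteq> 0}"
  have jp0: "0 \<le> jump_prob x n" for n unfolding jump_prob_def by (auto intro!: integral_nonneg_AE)
  have mJ: "measure steps (?J n) = jump_prob x n" for n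
    using emeasure_jump[of n x] jp0[of n] by (simp add: measure_def)
  have "AE y in steps. \<forall>\<^sub>F n in sequentially. y \<in> space steps - ?J n"
  proof (rule borel_cantelli_AE1)
    show "?J n \<in> sets steps" for n by (rule sets_step_walk)
    show "emeasure steps (?J n) < \<infinity>" for n by (simp add: emeasure_jump)
    show "summable (\<lambda>n. measure steps (?J n))" using sum by (simp add: mJ)
  qed
  then have conv: "AE y in steps. \<exists>c\<in>(\<lambda>g. C g x) ` carrier G. y \<in> limit_event x c"
    using AE_space
  proof eventually_elim
    case (elim y)
    then have y: "\<And>i. y i \<in> carrier G" by (simp add: space_steps)
    obtain N where N: "\<And>n. n \<ge> N \<Longrightarrow> C (y n) (act (walk G y n) x) = 0"
      using elim unfolding eventually_sequentially by blast
    have step: "C (walk G y (Suc n)) x = C (walk G y n) x" if "n \<ge> N" for n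
      using N[OF that] y walk_closed[of y, OF y] by (simp add: C_mult)
    have "C (walk G y n) x = C (walk G y N) x" if "n \<ge> N" for n
      using that by (induction n rule: dec_induct) (auto simp del: walk.simps simp: step)
    then have "y \<in> limit_event x (C (walk G y N) x)"
      using elim unfolding limit_event_def eventually_sequentially by blast
    then show ?case using walk_closed[of y, OF y] by blast
  qed
  show ?thesis
  proof (rule ccontr)
    assume "\<not> ?thesis"
    then have 01: "emeasure steps (limit_event x c) = 0 \<or> emeasure steps (limit_event x c) = 1" for c
      using Q.emeasure_le_1[of "limit_event x c"] by (metis antisym_conv1 not_gr_zero)
    have "\<exists>c. emeasure steps (limit_event x c) = 1"
    proof (rule ccontr)
      assume "\<not> ?thesis"
      then have "limit_event x c \<in> null_sets steps" for c using 01[of c] sets_limit_event by (auto simp: null_sets_def)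
      then have "AE y in steps. y \<notin> limit_event x c" for c by (rule AE_not_in)
      then have "AE y in steps. \<forall>c\<in>(\<lambda>g. C g x) ` carrier G. y \<notin> limit_event x c"
        using countable_carrier by (subst AE_ball_countable) auto
      with conv have "AE y in steps. False" by eventually_elim blast
      then show False by simp
    qed
    then obtain c where c: "emeasure steps (limit_event x c) = 1" by blast
    have "limit_event x c \<inter> limit_event x (c - C g x) = {}"
    proof -
      have False if "y \<in> limit_event x c" "y \<in> limit_event x (c - C g x)" for y
      proof -
        have "\<forall>\<^sub>F n in sequentially. C (walk G y n) x = c \<and> C (walk G y n) x = c - C g x"
          using that by (auto simp: limit_event_def intro: eventually_conj)
        then have "\<forall>\<^sub>F n in sequentially. False" by eventually_elim (use g in auto)
        then show False by simp
      qed
      then show ?thesis by blast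
    qed
    then have "emeasure steps (limit_event x c) + emeasure steps (limit_event x (c - C g x))
        = emeasure steps (limit_event x c \<union> limit_event x (c - C g x))"
      by (intro plus_emeasure sets_limit_event)
    also have "\<dots> \<le> 1" by (rule Q.emeasure_le_1)
    finally have z: "emeasure steps (limit_event x (c - C g x)) = 0"
      using c 01[of "c - C g x"] by auto
    obtain m where m: "0 < emeasure steps {y \<in> space steps. walk G y m = g}" using walk_hits g by blast
    let ?D = "{y \<in> space steps. walk G y m = g} \<inter> limit_event x c"
    have D: "?D \<in> sets steps" using sets_walk_at sets_limit_event by (rule sets.Int)
    have "emeasure steps ?D = emeasure steps {y \<in> space steps. walk G y m = g} * emeasure steps (limit_event x (c - C g x))"
    proof (rule emeasure_steps_split[OF sets_walk_at sets_limit_event D, where m = m])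
      fix u v assume uv': "u \<in> space steps" "v \<in> space steps"
      then have uv: "\<And>i. u i \<in> carrier G" "\<And>i. v i \<in> carrier G" by (auto simp: space_steps)
      have sp: "comb_seq m u v \<in> space steps" using uv by (auto simp: space_steps comb_seq_def)
      have "comb_seq m u v \<in> limit_event x c \<longleftrightarrow> v \<in> limit_event x (c - C g x)" if "walk G u m = g"
      proof -
        have "C (walk G (comb_seq m u v) (n + m)) x = C (walk G v n) x + C g x" for n
          using walk_comb_seq(2)[of u v m n, OF uv] that g walk_closed[of v, OF uv(2)] by (simp add: C_mult)
        then have "(\<forall>\<^sub>F n in sequentially. C (walk G (comb_seq m u v) (n + m)) x = c)
            \<longleftrightarrow> (\<forall>\<^sub>F n in sequentially. C (walk G v n) x = c - C g x)" by (auto simp: algebra_simps)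
        then show ?thesis using sp uv'(2) unfolding limit_event_def
          using eventually_sequentially_seg[of "\<lambda>n. C (walk G (comb_seq m u v) n) x = c" m] by simp
      qed
      then show "comb_seq m u v \<in> ?D \<longleftrightarrow> u \<in> {y \<in> space steps. walk G y m = g} \<and> v \<in> limit_event x (c - C g x)"
        using walk_comb_seq(1)[of u v m m, OF uv] sp uv' by auto
    qed
    then have D0: "emeasure steps ?D = 0" using z by simp
    have "emeasure steps {y \<in> space steps. walk G y m = g} \<le> emeasure steps (?D \<union> (space steps - limit_event x c))"
      using D sets_limit_event by (intro emeasure_mono) auto
    also have "\<dots> \<le> emeasure steps ?D + emeasure steps (space steps - limit_event x c)"
      using D sets_limit_event by (intro emeasure_subadditive) auto
    also have "emeasure steps (space steps - limit_event x c) = 0"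
      using c sets_limit_event by (simp add: emeasure_compl Q.emeasure_space_1)
    finally show False using m D0 by simp
  qed
qed

section \<open>Transfer to the Poisson boundary\<close>

text \<open>Equivalent trajectories differ eventually by a shift of time, which preserves eventual
  values of the cocycle. So the trajectories with limit \<open>c\<close> form a union of classes,
  whose measure is that of \<open>limit_event x c\<close>.\<close>

theorem nontrivial_boundary:
  assumes ab: "a \<in> carrier G" "b \<in> carrier G"
    and I: "x \<in> I" "act a ` I \<subseteq> I" "act b ` I \<subseteq> I" "act a ` I \<inter> act b ` I = {}"
    and g: "g \<in> carrier G" "act g x = x" "C g x \<noteq> 0"
  shows "nontrivial_boundary G \<mu>"
proof -
  obtain c where c: "0 < emeasure steps (limit_event x c)" "emeasure steps (limit_event x c) < 1"
    using limit_event_intermediate[OF summable_jump_prob[OF ab I] g] by blast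
  let ?N = "\<Pi>\<^sub>M n\<in>(UNIV::nat set). count_space (carrier G)" and ?P = "walk_measure G \<mu>"
  let ?cls = "\<lambda>z. traj_equiv G `` {z}"
  have P: "?P = distr steps ?N (walk G)" by (simp add: walk_measure_def)
  have spP: "space ?P = {z. \<forall>n. z n \<in> carrier G}" by (auto simp: P space_PiM)
  have equiv: "equiv (space ?P) (traj_equiv G)" by (rule equiv_traj_equiv)
  define W where "W = {z \<in> space ?N. \<forall>\<^sub>F n in sequentially. C (z n) x = c}"
  have WP: "W \<subseteq> space ?P" by (auto simp: W_def P)
  have "{z \<in> space ?N. C (z n) x = c} \<in> sets ?N" for n
  proof -
    have "{z \<in> space ?N. C (z n) x = c} = (\<lambda>z. z n) -` {h \<in> carrier G. C h x = c} \<inter> space ?N"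
      by (auto simp: space_PiM)
    then show ?thesis
      using measurable_sets[OF measurable_component_singleton[of n UNIV "\<lambda>_. count_space (carrier G)"], of "{h \<in> carrier G. C h x = c}"] by simp
  qed
  moreover have "W = (\<Union>N. \<Inter>n\<in>{N..}. {z \<in> space ?N. C (z n) x = c})"
    by (auto simp: W_def eventually_sequentially)
  ultimately have W: "W \<in> sets ?N"
    by (auto intro!: sets.countable_UN sets.countable_INT'')
  have sat: "z' \<in> W" if zW: "z \<in> W" and zz: "(z, z') \<in> traj_equiv G" for z z'
  proof -
    have "(z', z) \<in> traj_equiv G" using zz equiv by (meson equivE symE)
    then obtain i0 :: nat and k :: int where k: "range z' \<subseteq> carrier G"
      "\<And>i. i > i0 \<Longrightarrow> 0 \<le> int i + k \<and> z' i = z (nat (int i + k))" unfolding traj_equiv_def by blast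
    obtain N where N: "\<And>n. n \<ge> N \<Longrightarrow> C (z n) x = c" using zW by (auto simp: W_def eventually_sequentially)
    \<comment> \<open>The threshold guarantees both \<open>n > i0\<close> and, after a backward
      shift when \<open>k\<close> is negative, an index of at least \<open>N\<close>.\<close>
    have "C (z' n) x = c" if "n \<ge> Suc i0 + N + nat (- k)" for n
    proof -
      have "nat (int n + k) \<ge> N" using that by linarith
      then show ?thesis using k(2)[of n] N that by simp
    qed
    then have "\<forall>\<^sub>F n in sequentially. C (z' n) x = c" unfolding eventually_sequentially by blast
    then show ?thesis using k(1) by (auto simp: W_def space_PiM)
  qed
  define B where "B = ?cls ` W"
  have BO: "B \<subseteq> space ?P // traj_equiv G" using WP by (auto simp: B_def intro: quotientI)
  have UB: "\<Union>B = W"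
  proof
    show "\<Union>B \<subseteq> W" using sat by (auto simp: B_def)
    show "W \<subseteq> \<Union>B" using equiv_class_self[OF equiv] WP by (auto simp: B_def)
  qed
  have Bs: "B \<in> sets (poisson_boundary G \<mu>)" unfolding sets_poisson_boundary using BO UB W by (simp add: P)
  have pre: "?cls -` B \<inter> space ?P = W"
  proof
    show "W \<subseteq> ?cls -` B \<inter> space ?P" using WP by (auto simp: B_def)
    show "?cls -` B \<inter> space ?P \<subseteq> W"
    proof
      fix z assume z: "z \<in> ?cls -` B \<inter> space ?P"
      then have "z \<in> ?cls z" using equiv_class_self[OF equiv] by blast
      then show "z \<in> W" using z UB by blast
    qed
  qed
  have "measure (poisson_boundary G \<mu>) B = measure ?P (?cls -` B \<inter> space ?P)"
  proof -
    let ?X = "sigma (space ?P // traj_equiv G) {B. B \<subseteq> space ?P // traj_equiv G \<and> ?cls -` B \<inter> space ?P \<in> sets ?P}"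
    have pb: "poisson_boundary G \<mu> = distr ?P ?X ?cls" by (simp add: poisson_boundary_def Let_def)
    have "?cls \<in> ?P \<rightarrow>\<^sub>M ?X" using measurable_poisson_boundary[of G \<mu>] unfolding pb by simp
    moreover have "B \<in> sets ?X" using Bs unfolding pb by simp
    ultimately show ?thesis unfolding pb by (rule measure_distr)
  qed
  also have "\<dots> = measure ?P W" by (simp only: pre)
  also have "\<dots> = measure steps (walk G -` W \<inter> space steps)"
    unfolding P using measurable_walk W by (rule measure_distr)
  also have "walk G -` W \<inter> space steps = limit_event x c"
    using walk_closed by (auto simp: W_def limit_event_def space_PiM space_steps)
  finally have eq: "measure (poisson_boundary G \<mu>) B = measure steps (limit_event x c)" .
  interpret Q: prob_space steps by (rule prob_space_steps)
  have "0 < measure steps (limit_event x c)" "measure steps (limit_event x c) < 1"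
    using c by (simp_all add: Q.emeasure_eq_measure ennreal_less_one_iff)
  then show ?thesis unfolding nontrivial_boundary_def using Bs eq by (intro bexI[of _ B]) simp_all
qed

end


section \<open>Piecewise projective homeomorphisms\<close>

text \<open>\<open>(num A x, den A x)\<close> is the image of the vector \<open>(x, 1)\<close> under
  \<open>A\<close>; at a fixed point \<open>x\<close> of \<open>A\<close>, \<open>den A x\<close> is
  the eigenvalue of that vector.\<close>

definition num :: "int^2^2 \<Rightarrow> real \<Rightarrow> real" where
  "num A x = real_of_int (A $ 1 $ 1) * x + real_of_int (A $ 1 $ 2)"

definition den :: "int^2^2 \<Rightarrow> real \<Rightarrow> real" where
  "den A x = real_of_int (A $ 2 $ 1) * x + real_of_int (A $ 2 $ 2)"

lemma moebius_Some: "moebius A (Some x) = (if den A x = 0 then None else Some (num A x / den A x))"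
  by (simp add: moebius_def num_def den_def)

lemma SL2Z_iff: "A \<in> SL2Z \<longleftrightarrow> A $ 1 $ 1 * A $ 2 $ 2 - A $ 1 $ 2 * A $ 2 $ 1 = 1"
  by (simp add: SL2Z_def det_2)

lemma SL2Z_real:
  assumes "A \<in> SL2Z"
  shows "real_of_int (A $ 1 $ 1) * real_of_int (A $ 2 $ 2) - real_of_int (A $ 1 $ 2) * real_of_int (A $ 2 $ 1) = 1"
  using assms unfolding SL2Z_iff by (metis of_int_1 of_int_diff of_int_mult)

lemma num_den_nonzero:
  assumes "A \<in> SL2Z" "den A x = 0" shows "num A x \<noteq> 0"
proof
  assume "num A x = 0"
  moreover have "real_of_int (A $ 1 $ 1) * den A x - real_of_int (A $ 2 $ 1) * num A x = 1"
    using SL2Z_real[OF assms(1)] by (simp add: num_def den_def algebra_simps)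
  ultimately show False using assms(2) by simp
qed

lemma num_den_diff:
  assumes "A \<in> SL2Z" "den A u \<noteq> 0" "den A v \<noteq> 0"
  shows "num A v / den A v - num A u / den A u = (v - u) / (den A u * den A v)"
proof -
  have "num A v * den A u - num A u * den A v
      = (real_of_int (A $ 1 $ 1) * real_of_int (A $ 2 $ 2) - real_of_int (A $ 1 $ 2) * real_of_int (A $ 2 $ 1)) * (v - u)"
    by (simp add: num_def den_def algebra_simps)
  also have "\<dots> = v - u" by (simp only: SL2Z_real[OF assms(1)] mult_1)
  finally show ?thesis using assms(2,3) by (simp add: diff_frac_eq mult.commute)
qed

definition adjugate2 :: "int^2^2 \<Rightarrow> int^2^2" where
  "adjugate2 A = vector [vector [A $ 2 $ 2, - A $ 1 $ 2], vector [- A $ 2 $ 1, A $ 1 $ 1]]"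

lemma adjugate2_SL2Z: "A \<in> SL2Z \<Longrightarrow> adjugate2 A \<in> SL2Z"
  by (simp add: SL2Z_iff adjugate2_def mult.commute)

lemma moebius_adjugate2:
  assumes A: "A \<in> SL2Z" and eq: "moebius A \<xi> = \<eta>"
  shows "moebius (adjugate2 A) \<eta> = \<xi>"
proof -
  define a b c d where "a = real_of_int (A $ 1 $ 1)" "b = real_of_int (A $ 1 $ 2)"
    "c = real_of_int (A $ 2 $ 1)" "d = real_of_int (A $ 2 $ 2)"
  note abcd = this
  have det: "a * d - b * c = 1" using SL2Z_real[OF A] by (simp add: abcd)
  have M: "moebius A None = (if c = 0 then None else Some (a / c))"
    "\<And>x. moebius A (Some x) = (if c * x + d = 0 then None else Some ((a * x + b) / (c * x + d)))"
    "moebius (adjugate2 A) None = (if c = 0 then None else Some (- d / c))"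
    "\<And>x. moebius (adjugate2 A) (Some x) = (if a - c * x = 0 then None else Some ((d * x - b) / (a - c * x)))"
    by (auto simp: moebius_def adjugate2_def abcd)
  show ?thesis
  proof (cases \<xi>)
    case None
    then show ?thesis using eq by (auto simp: M split: if_splits)
  next
    case (Some x)
    show ?thesis
    proof (cases "c * x + d = 0")
      case True
      then have "c \<noteq> 0" using det by auto
      then have "x = - d / c" using True by (simp add: field_simps)
      then show ?thesis using Some eq True \<open>c \<noteq> 0\<close> by (auto simp: M)
    next
      case False
      define y where "y = (a * x + b) / (c * x + d)"
      have 1: "a - c * y = 1 / (c * x + d)"
      proof -
        have "a - c * y = (a * (c * x + d) - c * (a * x + b)) / (c * x + d)" using False by (simp add: y_def diff_divide_distrib)
        also have "a * (c * x + d) - c * (a * x + b) = 1" using det by (simp add: algebra_simps)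
        finally show ?thesis .
      qed
      have 2: "d * y - b = x / (c * x + d)"
      proof -
        have "d * y - b = (d * (a * x + b) - b * (c * x + d)) / (c * x + d)" using False by (simp add: y_def diff_divide_distrib)
        also have "d * (a * x + b) - b * (c * x + d) = (a * d - b * c) * x" by (simp add: algebra_simps)
        finally show ?thesis using det by simp
      qed
      have "\<eta> = Some y" using Some eq False by (simp add: M y_def)
      then show ?thesis using Some False by (simp add: M 1 2)
    qed
  qed
qed

section \<open>Fixed points of hyperbolic elements\<close>

lemma P_Z_iff:
  "Some x \<in> P_Z \<longleftrightarrow> (\<exists>a b c d :: int. a * d - b * c = 1 \<and> \<bar>a + d\<bar> > 2 \<and>
      real_of_int a * x + real_of_int b = x * (real_of_int c * x + real_of_int d))"
proof
  assume "Some x \<in> P_Z"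
  then obtain p where "hyperbolic p" "psl_map p (Some x) = Some x" by (auto simp: P_Z_def)
  then obtain A where A: "A \<in> SL2Z" "\<bar>trace A\<bar> > 2" "moebius A (Some x) = Some x"
    unfolding hyperbolic_def PSL2Z_iff by (auto simp: psl_map_eq)
  then have "num A x = x * den A x" by (auto simp: moebius_Some field_simps split: if_splits)
  then show "\<exists>a b c d :: int. a * d - b * c = 1 \<and> \<bar>a + d\<bar> > 2 \<and>
      real_of_int a * x + real_of_int b = x * (real_of_int c * x + real_of_int d)"
    using A by (intro exI[of _ "A $ 1 $ 1"] exI[of _ "A $ 1 $ 2"] exI[of _ "A $ 2 $ 1"] exI[of _ "A $ 2 $ 2"])
      (auto simp: SL2Z_iff trace_def sum_2 num_def den_def)
next
  assume "\<exists>a b c d :: int. a * d - b * c = 1 \<and> \<bar>a + d\<bar> > 2 \<and>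
      real_of_int a * x + real_of_int b = x * (real_of_int c * x + real_of_int d)"
  then obtain a b c d :: int where *: "a * d - b * c = 1" "\<bar>a + d\<bar> > 2"
    "real_of_int a * x + real_of_int b = x * (real_of_int c * x + real_of_int d)" by blast
  define A :: "int^2^2" where "A = vector [vector [a, b], vector [c, d]]"
  have A: "A \<in> SL2Z" using * by (simp add: SL2Z_iff A_def)
  have tr: "trace A = a + d" by (simp add: trace_def sum_2 A_def)
  have neg: "trace (- A) = - (a + d)" by (simp add: trace_def sum_2 A_def)
  have nd: "num A x = x * den A x" using *(3) by (simp add: num_def den_def A_def)
  then have "den A x \<noteq> 0" using num_den_nonzero[OF A] by fastforce
  then have "moebius A (Some x) = Some x" using nd by (simp add: moebius_Some)
  moreover have "hyperbolic {A, - A}" unfolding hyperbolic_def PSL2Z_iff using A *(2) tr neg by auto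
  ultimately show "Some x \<in> P_Z" unfolding P_Z_def by (auto simp: psl_map_eq intro!: exI[of _ "{A, - A}"])
qed

lemma Ints_if_square_Ints:
  fixes y :: real
  assumes "y \<in> \<rat>" "y\<^sup>2 \<in> \<int>"
  shows "y \<in> \<int>"
proof -
  obtain p q :: int where pq: "q > 0" "coprime p q" "y = of_int p / of_int q"
    using assms(1) by (auto elim: Rats_cases')
  obtain n :: int where "y\<^sup>2 = of_int n" using assms(2) by (auto elim: Ints_cases)
  then have "(of_int (p\<^sup>2) :: real) = of_int (n * q\<^sup>2)"
    using pq by (simp add: power_divide field_simps)
  then have "q\<^sup>2 dvd p\<^sup>2" by (metis dvd_triv_right of_int_eq_iff)
  then have "q dvd p" by simp
  then have "q dvd 1" using coprime_common_divisor[OF pq(2)] by simp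
  then have "q = 1" using pq(1) by simp
  then show ?thesis using pq(3) by simp
qed

text \<open>\<open>y\<close> is the difference of the two eigenvalues, so its square is the
  discriminant \<open>(a + d) ^ 2 - 4\<close>. For rational \<open>x\<close> it is an integer, and
  two integer squares differ by 4 only as 4 and 0.\<close>

lemma rational_fixed_point:
  fixes a b c d :: int
  assumes x: "x \<in> \<rat>" and det: "a * d - b * c = 1"
    and fp: "real_of_int a * x + real_of_int b = x * (real_of_int c * x + real_of_int d)"
  shows "\<bar>a + d\<bar> = 2" "real_of_int (a + d) = 2 * (real_of_int c * x + real_of_int d)"
proof -
  define y where "y = 2 * (real_of_int c * x + real_of_int d) - real_of_int (a + d)"
  have "y\<^sup>2 = 4 * (real_of_int c * (x * (real_of_int c * x + real_of_int d) - real_of_int a * x)) + (real_of_int d - real_of_int a)\<^sup>2"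
    by (simp add: y_def power2_eq_square algebra_simps)
  also have "x * (real_of_int c * x + real_of_int d) - real_of_int a * x = real_of_int b"
    using fp by linarith
  also have "4 * (real_of_int c * real_of_int b) + (real_of_int d - real_of_int a)\<^sup>2
      = real_of_int ((a + d)\<^sup>2 - 4 * (a * d - b * c))"
    by (simp add: power2_eq_square algebra_simps)
  finally have y2: "y\<^sup>2 = real_of_int ((a + d)\<^sup>2 - 4)" using det by simp
  have "y \<in> \<rat>" using x by (simp add: y_def)
  moreover have "y\<^sup>2 \<in> \<int>" unfolding y2 by (rule Ints_of_int)
  ultimately have "y \<in> \<int>" by (rule Ints_if_square_Ints)
  then obtain k where k: "y = real_of_int k" by (auto elim: Ints_cases)
  then have "k\<^sup>2 = (a + d)\<^sup>2 - 4" using y2 by (metis of_int_eq_iff of_int_power)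
  then have sq: "(\<bar>a + d\<bar>)\<^sup>2 = (\<bar>k\<bar>)\<^sup>2 + 4" by simp
  have "\<bar>k\<bar> < \<bar>a + d\<bar>" by (rule power2_less_imp_less) (use sq in auto)
  moreover have k1: "(\<bar>k\<bar> + 1)\<^sup>2 = (\<bar>k\<bar>)\<^sup>2 + 2 * \<bar>k\<bar> + 1" by (simp add: power2_eq_square algebra_simps)
  \<comment> \<open>Parity: consecutive squares have an odd difference.\<close>
  moreover have "\<bar>a + d\<bar> \<noteq> \<bar>k\<bar> + 1"
  proof
    assume "\<bar>a + d\<bar> = \<bar>k\<bar> + 1"
    then have "2 * \<bar>k\<bar> + 1 = 4" using sq k1 by simp
    then show False by presburger
  qed
  ultimately have "\<bar>k\<bar> + 2 \<le> \<bar>a + d\<bar>" by linarith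
  then have "(\<bar>k\<bar> + 2)\<^sup>2 \<le> (\<bar>a + d\<bar>)\<^sup>2" by (intro power_mono) auto
  moreover have "(\<bar>k\<bar> + 2)\<^sup>2 = (\<bar>k\<bar>)\<^sup>2 + 4 * \<bar>k\<bar> + 4" by (simp add: power2_eq_square algebra_simps)
  ultimately have k0: "\<bar>k\<bar> = 0" using sq by simp
  then have "(\<bar>a + d\<bar>)\<^sup>2 = 2\<^sup>2" using sq by simp
  then show "\<bar>a + d\<bar> = 2" by (metis abs_ge_zero power2_eq_iff_nonneg zero_le_numeral)
  show "real_of_int (a + d) = 2 * (real_of_int c * x + real_of_int d)" using k k0 by (simp add: y_def)
qed

lemma P_Z_irrational: "Some x \<in> P_Z \<Longrightarrow> x \<notin> \<rat>"
  unfolding P_Z_iff using rational_fixed_point(1) by force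

text \<open>\<open>?e\<close>, \<open>?f\<close>, \<open>?g\<close>, \<open>?h\<close> are the
  entries of the conjugate by \<open>A\<close> of a hyperbolic matrix fixing \<open>x\<close>: trace
  and determinant are unchanged, and \<open>(num A x, den A x)\<close> is an eigenvector for the old
  eigenvalue \<open>?l\<close>. This keeps the break points of inverses inside
  \<open>P_Z\<close>.\<close>

lemma P_Z_moebius:
  assumes x: "Some x \<in> P_Z" and A: "A \<in> SL2Z" "den A x \<noteq> 0"
  shows "Some (num A x / den A x) \<in> P_Z"
proof -
  obtain a b c d :: int where *: "a * d - b * c = 1" "\<bar>a + d\<bar> > 2"
    "real_of_int a * x + real_of_int b = x * (real_of_int c * x + real_of_int d)"
    using x unfolding P_Z_iff by blast
  define p q r s where "p = A $ 1 $ 1" "q = A $ 1 $ 2" "r = A $ 2 $ 1" "s = A $ 2 $ 2"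
  note pqrs = this
  have det: "p * s - q * r = 1" using A by (simp add: SL2Z_iff pqrs)
  let ?e = "(p * a + q * c) * s - (p * b + q * d) * r"
  let ?f = "(p * b + q * d) * p - (p * a + q * c) * q"
  let ?g = "(r * a + s * c) * s - (r * b + s * d) * r"
  let ?h = "(r * b + s * d) * p - (r * a + s * c) * q"
  define y where "y = num A x / den A x"
  let ?l = "real_of_int c * x + real_of_int d"
  have "?e * ?h - ?f * ?g = (a * d - b * c) * ((p * s - q * r) * (p * s - q * r))" by (simp add: algebra_simps)
  then have 1: "?e * ?h - ?f * ?g = 1" by (simp only: det * mult_1)
  have "?e + ?h = (a + d) * (p * s - q * r)" by (simp add: algebra_simps)
  then have 2: "?e + ?h = a + d" by (simp only: det mult_1_right)
  have ND: "num A x = real_of_int p * x + real_of_int q" "den A x = real_of_int r * x + real_of_int s"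
    by (simp_all add: num_def den_def pqrs)
  have detr: "real_of_int p * real_of_int s - real_of_int q * real_of_int r = 1"
    using det by (metis of_int_1 of_int_diff of_int_mult)
  have "real_of_int ?e * num A x + real_of_int ?f * den A x
      = (real_of_int p * real_of_int s - real_of_int q * real_of_int r)
        * (real_of_int p * (real_of_int a * x + real_of_int b) + real_of_int q * ?l)"
    by (simp add: ND algebra_simps)
  also have "\<dots> = ?l * num A x" by (simp only: detr *(3)) (simp add: ND algebra_simps)
  finally have e3: "real_of_int ?e * num A x + real_of_int ?f * den A x = ?l * num A x" .
  have "real_of_int ?g * num A x + real_of_int ?h * den A x
      = (real_of_int p * real_of_int s - real_of_int q * real_of_int r)
        * (real_of_int r * (real_of_int a * x + real_of_int b) + real_of_int s * ?l)"
    by (simp add: ND algebra_simps)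
  also have "\<dots> = ?l * den A x" by (simp only: detr *(3)) (simp add: ND algebra_simps)
  finally have e4: "real_of_int ?g * num A x + real_of_int ?h * den A x = ?l * den A x" .
  have "real_of_int ?e * y + real_of_int ?f = (real_of_int ?e * num A x + real_of_int ?f * den A x) / den A x"
    using A(2) by (simp add: y_def add_divide_distrib del: of_int_diff of_int_add of_int_mult)
  then have y1: "real_of_int ?e * y + real_of_int ?f = ?l * y" by (simp only: e3) (simp add: y_def)
  have "real_of_int ?g * y + real_of_int ?h = (real_of_int ?g * num A x + real_of_int ?h * den A x) / den A x"
    using A(2) by (simp add: y_def add_divide_distrib del: of_int_diff of_int_add of_int_mult)
  then have y2: "real_of_int ?g * y + real_of_int ?h = ?l" using A(2) by (simp only: e4) simp
  have "real_of_int ?e * y + real_of_int ?f = y * (real_of_int ?g * y + real_of_int ?h)"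
    unfolding y1 y2 by (rule mult.commute)
  moreover have "\<bar>?e + ?h\<bar> > 2" by (simp only: 2 *(2))
  ultimately have "Some y \<in> P_Z" unfolding P_Z_iff using 1 by blast
  then show ?thesis by (simp add: y_def)
qed

section \<open>Elements of \<open>monod_HZ\<close> as maps of the line\<close>

text \<open>Elements of \<open>monod_HZ\<close> are bijective and fix \<open>None\<close>, so
  \<open>the\<close> never meets \<open>None\<close>.\<close>

definition on_line :: "(real option \<Rightarrow> real option) \<Rightarrow> real \<Rightarrow> real" where
  "on_line g x = the (g (Some x))"

text \<open>Nonvanishing of \<open>den\<close> excludes the default value of division by zero. At a
  point the matrix is determined up to sign, see \<open>germ_unique\<close>.\<close>

definition germ :: "int^2^2 \<Rightarrow> (real \<Rightarrow> real) \<Rightarrow> real filter \<Rightarrow> bool" where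
  "germ A f F \<longleftrightarrow> (\<forall>\<^sub>F t in F. den A t \<noteq> 0 \<and> f t = num A t / den A t)"

lemma topspace_proj_line: "topspace proj_line = UNIV"
  by (auto simp: image_def)

lemma monod_HZ_carrier: "g \<in> carrier monod_HZ \<longleftrightarrow>
    homeomorphic_map proj_line proj_line g \<and> g None = None \<and> piecewise_PSL2Z g"
  by (simp add: monod_HZ_def)

lemma monod_HZ_bij: "g \<in> carrier monod_HZ \<Longrightarrow> bij g"
  using homeomorphic_imp_injective_map[of proj_line proj_line g] homeomorphic_imp_surjective_map[of proj_line proj_line g]
  unfolding monod_HZ_carrier topspace_proj_line by (simp add: bij_def)

lemma apply_Some: "g \<in> carrier monod_HZ \<Longrightarrow> g (Some x) = Some (on_line g x)"
proof -
  assume g: "g \<in> carrier monod_HZ"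
  then have "g (Some x) \<noteq> g None" using monod_HZ_bij[OF g] by (simp add: bij_def inj_eq)
  then show ?thesis using g unfolding on_line_def monod_HZ_carrier by auto
qed

text \<open>A connected set avoiding \<open>F\<close> lies in a single component; no image there is
  infinite, so \<open>den\<close> does not vanish.\<close>

lemma piece_moebius:
  assumes g: "g \<in> carrier monod_HZ"
    and F: "\<forall>C\<in>connected_components_of (subtopology proj_line (- F)). \<exists>p\<in>PSL2Z. \<forall>\<xi>\<in>C. g \<xi> = psl_map p \<xi>"
    and X: "connected X" "X \<noteq> {}" "Some ` X \<inter> F = {}"
  shows "\<exists>A\<in>SL2Z. \<forall>t\<in>X. den A t \<noteq> 0 \<and> on_line g t = num A t / den A t"
proof -
  let ?Y = "subtopology proj_line (- F)"
  obtain x where x: "x \<in> X" using X by blast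
  have "connectedin proj_line (Some ` X)"
    using X(1) by (intro connectedin_continuous_map_image[OF continuous_map_Some]) simp
  then have con: "connectedin ?Y (Some ` X)" using X(3) by (auto simp: connectedin_subtopology)
  let ?C = "connected_component_of_set ?Y (Some x)"
  have "Some x \<in> topspace ?Y" using x X(3) by auto
  then have "?C \<in> connected_components_of ?Y" unfolding connected_components_of_def by (rule imageI)
  from bspec[OF F this] obtain p where p: "p \<in> PSL2Z" "\<forall>\<xi>\<in>?C. g \<xi> = psl_map p \<xi>" by (rule bexE)
  obtain A where A: "A \<in> SL2Z" "p = {A, - A}" using p(1) PSL2Z_iff by auto
  have sub: "Some ` X \<subseteq> ?C" using con x by (intro connected_component_of_maximal imageI)
  have "den A t \<noteq> 0 \<and> on_line g t = num A t / den A t" if "t \<in> X" for t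
  proof -
    have "Some (on_line g t) = moebius A (Some t)"
      using bspec[OF p(2), OF subsetD[OF sub imageI[OF that]]] unfolding A(2) psl_map_eq apply_Some[OF g] .
    then show ?thesis unfolding moebius_Some by (cases "den A t = 0") simp_all
  qed
  then show ?thesis using A(1) by blast
qed

lemma monod_HZ_germs:
  assumes g: "g \<in> carrier monod_HZ"
  obtains F where "finite F" "F \<subseteq> P_Z"
    "\<And>x. \<exists>A\<in>SL2Z. germ A (on_line g) (at_left x)"
    "\<And>x. \<exists>A\<in>SL2Z. germ A (on_line g) (at_right x)"
    "\<And>x. Some x \<notin> F \<Longrightarrow> \<exists>A\<in>SL2Z. germ A (on_line g) (at_left x) \<and> germ A (on_line g) (at_right x)"
    "\<exists>A\<in>SL2Z. germ A (on_line g) at_bot"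
proof -
  obtain F where F: "finite F" "F \<subseteq> P_Z"
    "\<forall>C\<in>connected_components_of (subtopology proj_line (- F)). \<exists>p\<in>PSL2Z. \<forall>\<xi>\<in>C. g \<xi> = psl_map p \<xi>"
    using g unfolding monod_HZ_carrier piecewise_PSL2Z_def by blast
  define B where "B = Some -` F"
  have finB: "finite B" unfolding B_def using F(1) by (intro finite_vimageI) auto
  have sep: "\<exists>d>0. \<forall>t\<in>B. t \<noteq> x \<longrightarrow> d \<le> \<bar>x - t\<bar>" for x
    using finite_set_avoid[OF finB, of x] by (simp add: dist_real_def)
  have pc: "\<exists>A\<in>SL2Z. \<forall>t\<in>X. den A t \<noteq> 0 \<and> on_line g t = num A t / den A t"
    if "connected X" "X \<noteq> {}" "X \<inter> B = {}" for X
    using piece_moebius[OF g F(3) that(1,2)] that(3) by (auto simp: B_def)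
  show ?thesis
  proof (rule that[OF F(1,2)])
    fix x
    obtain d where d: "d > 0" "\<And>t. t \<in> B \<Longrightarrow> t \<noteq> x \<Longrightarrow> d \<le> \<bar>x - t\<bar>" using sep by blast
    have "{x - d<..<x} \<inter> B = {}" "{x<..<x + d} \<inter> B = {}" using d(2) by force+
    then have "\<exists>A\<in>SL2Z. \<forall>t\<in>{x - d<..<x}. den A t \<noteq> 0 \<and> on_line g t = num A t / den A t"
      "\<exists>A\<in>SL2Z. \<forall>t\<in>{x<..<x + d}. den A t \<noteq> 0 \<and> on_line g t = num A t / den A t"
      using d(1) by (auto intro!: pc)
    then obtain A A' where
      "A \<in> SL2Z" "\<forall>t\<in>{x - d<..<x}. den A t \<noteq> 0 \<and> on_line g t = num A t / den A t"
      "A' \<in> SL2Z" "\<forall>t\<in>{x<..<x + d}. den A' t \<noteq> 0 \<and> on_line g t = num A' t / den A' t" by blast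
    then have "germ A (on_line g) (at_left x)" "germ A' (on_line g) (at_right x)"
      unfolding germ_def eventually_at_left_field eventually_at_right_field using d(1)
      by (intro exI[of _ "x - d"] exI[of _ "x + d"], simp)+
    with \<open>A \<in> SL2Z\<close> \<open>A' \<in> SL2Z\<close> show "\<exists>A\<in>SL2Z. germ A (on_line g) (at_left x)"
      "\<exists>A\<in>SL2Z. germ A (on_line g) (at_right x)" by blast+
    assume "Some x \<notin> F"
    then have "{x - d<..<x + d} \<inter> B = {}" using d(2) by (force simp: B_def)
    then have "\<exists>A\<in>SL2Z. \<forall>t\<in>{x - d<..<x + d}. den A t \<noteq> 0 \<and> on_line g t = num A t / den A t"
      using d(1) by (intro pc) auto
    then obtain A where "A \<in> SL2Z" "\<forall>t\<in>{x - d<..<x + d}. den A t \<noteq> 0 \<and> on_line g t = num A t / den A t" by blast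
    then show "\<exists>A\<in>SL2Z. germ A (on_line g) (at_left x) \<and> germ A (on_line g) (at_right x)"
      unfolding germ_def eventually_at_left_field eventually_at_right_field using d(1)
      by (intro bexI[of _ A] conjI exI[of _ "x - d"] exI[of _ "x + d"]) auto
  next
    \<comment> \<open>Inserting 0 keeps the set nonempty when there are no endpoints.\<close>
    define m where "m = Min (insert 0 B)"
    have "m \<le> t" if "t \<in> B" for t using that finB by (simp add: m_def)
    then have "{..<m} \<inter> B = {}" by force
    then have "\<exists>A\<in>SL2Z. \<forall>t\<in>{..<m}. den A t \<noteq> 0 \<and> on_line g t = num A t / den A t"
      by (intro pc) (auto intro: lt_ex)
    then show "\<exists>A\<in>SL2Z. germ A (on_line g) at_bot"
      unfolding germ_def eventually_at_bot_dense by blast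
  qed
qed

lemma germ_at_left_exists: "g \<in> carrier monod_HZ \<Longrightarrow> \<exists>A\<in>SL2Z. germ A (on_line g) (at_left x)"
  by (rule monod_HZ_germs)

lemma germ_at_right_exists: "g \<in> carrier monod_HZ \<Longrightarrow> \<exists>A\<in>SL2Z. germ A (on_line g) (at_right x)"
  by (rule monod_HZ_germs)

lemma germ_at_bot_exists: "g \<in> carrier monod_HZ \<Longrightarrow> \<exists>A\<in>SL2Z. germ A (on_line g) at_bot"
  by (rule monod_HZ_germs)

lemma two_sided_germ_exists:
  assumes "g \<in> carrier monod_HZ"
  shows "\<exists>F. finite F \<and> F \<subseteq> P_Z \<and>
    (\<forall>x. Some x \<notin> F \<longrightarrow> (\<exists>A\<in>SL2Z. germ A (on_line g) (at_left x) \<and> germ A (on_line g) (at_right x)))"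
  by (rule monod_HZ_germs[OF assms], rule exI, intro conjI allI impI; assumption | simp)

lemma continuous_on_line:
  assumes g: "g \<in> carrier monod_HZ"
  shows "continuous_on UNIV (on_line g)"
proof -
  have "continuous_map proj_line proj_line g"
    using g by (simp add: monod_HZ_carrier homeomorphic_imp_continuous_map)
  then have cont: "continuous_map euclideanreal proj_line (g \<circ> Some)"
    by (rule continuous_map_compose[OF continuous_map_Some])
  have "open (on_line g -` V)" if "open V" for V
  proof -
    have "openin proj_line (Some ` V)" using that by simp
    then have "openin euclideanreal {x \<in> topspace euclideanreal. (g \<circ> Some) x \<in> Some ` V}"
      using cont by (rule openin_continuous_map_preimage[rotated])
    moreover have "{x \<in> topspace euclideanreal. (g \<circ> Some) x \<in> Some ` V} = on_line g -` V"
      using apply_Some[OF g] by auto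
    ultimately show ?thesis by simp
  qed
  then show ?thesis by (simp add: continuous_on_open_vimage)
qed

text \<open>The equation \<open>f t * den A t = num A t\<close> passes to the limit without
  division; \<open>den A x = 0\<close> would then force \<open>num A x = 0\<close>, against
  determinant 1.\<close>

lemma germ_at_point:
  assumes A: "A \<in> SL2Z" and f: "isCont f x" and F: "F \<le> at x" "F \<noteq> bot" and gm: "germ A f F"
  shows "den A x \<noteq> 0" "f x = num A x / den A x"
proof -
  have lim: "(f \<longlongrightarrow> f x) F" "((\<lambda>t. t) \<longlongrightarrow> x) F"
    using f F(1) unfolding isCont_def by (auto intro: tendsto_mono tendsto_ident_at)
  have "((\<lambda>t. f t * den A t) \<longlongrightarrow> f x * den A x) F"
    unfolding den_def by (intro tendsto_intros lim)
  moreover have "((\<lambda>t. num A t) \<longlongrightarrow> num A x) F"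
    unfolding num_def by (intro tendsto_intros lim)
  moreover have "\<forall>\<^sub>F t in F. f t * den A t = num A t"
    using gm unfolding germ_def by eventually_elim auto
  ultimately have eq: "f x * den A x = num A x"
    using F(2) tendsto_unique[OF F(2)] tendsto_cong[of "\<lambda>t. f t * den A t" "num A" F] by blast
  show "den A x \<noteq> 0" using num_den_nonzero[OF A, of x] eq by auto
  then show "f x = num A x / den A x" using eq by (simp add: field_simps)
qed

lemma inj_on_line: "g \<in> carrier monod_HZ \<Longrightarrow> inj (on_line g)"
  using monod_HZ_bij[of g] apply_Some[of g] unfolding inj_def bij_def by (metis option.inject)

text \<open>A continuous injection is monotone in one direction. The direction is read off just
  right of \<open>x\<close>, where the map is Moebius of determinant 1 with \<open>den\<close> of
  constant sign, hence increasing.\<close>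

lemma strict_mono_on_line:
  assumes g: "g \<in> carrier monod_HZ"
  shows "strict_mono (on_line g)"
proof (rule strict_monoI)
  fix x y :: real assume xy: "x < y"
  let ?f = "on_line g"
  have mono3: "?f a < ?f u \<and> ?f u < ?f b \<or> ?f b < ?f u \<and> ?f u < ?f a" if "a < u" "u < b" for a u b
    using that continuous_on_subset[OF continuous_on_line[OF g], of "{a..b}"] inj_on_subset[OF inj_on_line[OF g], of "{a..b}"]
    by (intro continuous_inj_imp_mono) auto
  obtain A where A: "A \<in> SL2Z" "germ A ?f (at_right x)" using germ_at_right_exists[OF g] by blast
  obtain b0 where b0: "b0 > x" "\<And>t. x < t \<Longrightarrow> t < b0 \<Longrightarrow> den A t \<noteq> 0 \<and> ?f t = num A t / den A t"
    using A(2) unfolding germ_def eventually_at_right_field by blast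
  define b where "b = min b0 y"
  have b: "b > x" "\<And>t. x < t \<Longrightarrow> t < b \<Longrightarrow> den A t \<noteq> 0 \<and> ?f t = num A t / den A t \<and> t < y"
    using b0 xy by (auto simp: b_def)
  obtain u where u: "x < u" "u < b" using dense b by blast
  obtain v where v: "u < v" "v < b" using dense u by blast
  have cont: "continuous_on {u..v} (den A)" unfolding den_def by (intro continuous_intros)
  have nz: "den A t \<noteq> 0" if "u \<le> t" "t \<le> v" for t using b(2)[of t] that u v by simp
  have "\<not> (den A u \<le> 0 \<and> 0 \<le> den A v)" using IVT'[of "den A" u 0 v, OF _ _ _ cont] nz v by force
  moreover have "\<not> (den A v \<le> 0 \<and> 0 \<le> den A u)" using IVT2'[of "den A" v 0 u, OF _ _ _ cont] nz v by force
  ultimately have "0 < den A u * den A v" by (metis linorder_linear mult_neg_neg mult_pos_pos not_le)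
  then have "0 < (v - u) / (den A u * den A v)" using v by simp
  then have uv: "?f u < ?f v" using num_den_diff[OF A(1), of u v] b(2)[of u] b(2)[of v] u v by simp
  have "v < y" using b(2)[of v] u v by simp
  show "?f x < ?f y" using mono3[OF u(1) v(1)] mono3[of x v y] uv u v \<open>v < y\<close> by linarith
qed

lemma monod_HZ_mult: "g \<otimes>\<^bsub>monod_HZ\<^esub> h = g \<circ> h" and monod_HZ_one: "\<one>\<^bsub>monod_HZ\<^esub> = id"
  by (simp_all add: monod_HZ_def)

lemma on_line_comp: "h \<in> carrier monod_HZ \<Longrightarrow> on_line (g \<circ> h) x = on_line g (on_line h x)"
  unfolding on_line_def[of "g \<circ> h"] on_line_def[of g] comp_apply by (simp only: apply_Some)

lemma on_line_id: "on_line id x = x"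
  by (simp add: on_line_def)

lemma on_line_faithful:
  assumes "g \<in> carrier monod_HZ" "\<And>x. on_line g x = x"
  shows "g = id"
proof
  have "g None = None" using assms(1) by (simp add: monod_HZ_carrier)
  then show "g \<xi> = id \<xi>" for \<xi>
    by (cases \<xi>) (simp_all add: apply_Some[OF assms(1)] assms(2))
qed

text \<open>The endpoints of the inverse are the images of those of \<open>g\<close>, again in
  \<open>P_Z\<close> by \<open>P_Z_moebius\<close>. The inverse maps each of its pieces into a piece
  of \<open>g\<close>, on which the adjugate matrix describes it.\<close>

lemma monod_HZ_inverse:
  assumes g: "g \<in> carrier monod_HZ"
  shows "\<exists>h\<in>carrier monod_HZ. g \<circ> h = id \<and> h \<circ> g = id"
proof -
  have "homeomorphic_map proj_line proj_line g" using g by (simp only: monod_HZ_carrier)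
  then obtain h where "homeomorphic_maps proj_line proj_line g h" by (auto simp only: homeomorphic_map_maps)
  then have h: "homeomorphic_map proj_line proj_line h" "\<And>\<xi>. h (g \<xi>) = \<xi>" "\<And>\<xi>. g (h \<xi>) = \<xi>"
    unfolding homeomorphic_maps_map topspace_proj_line by simp_all
  obtain F where F: "finite F" "F \<subseteq> P_Z"
    "\<forall>C\<in>connected_components_of (subtopology proj_line (- F)). \<exists>p\<in>PSL2Z. \<forall>\<xi>\<in>C. g \<xi> = psl_map p \<xi>"
    using g unfolding monod_HZ_carrier piecewise_PSL2Z_def by blast
  have cont: "isCont (on_line g) x" for x
    using continuous_on_line[OF g] by (simp add: continuous_on_eq_continuous_at)
  have FP: "g ` F \<subseteq> P_Z"
  proof
    fix \<eta> assume "\<eta> \<in> g ` F"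
    then obtain x where x: "Some x \<in> F" "\<eta> = g (Some x)"
      using F(2) infinity_notin_P_Z by (metis image_iff not_None_eq subsetD)
    obtain A where A: "A \<in> SL2Z" "germ A (on_line g) (at_left x)" using germ_at_left_exists[OF g] by blast
    note * = germ_at_point[OF A(1) cont at_le[of _ UNIV, simplified] _ A(2)]
    have "den A x \<noteq> 0" "on_line g x = num A x / den A x" using * by (simp_all add: at_le)
    then show "\<eta> \<in> P_Z" using P_Z_moebius[OF _ A(1)] x F(2) apply_Some[OF g] by auto
  qed
  have "piecewise_PSL2Z h"
    unfolding piecewise_PSL2Z_def
  proof (intro exI[of _ "g ` F"] conjI ballI)
    show "finite (g ` F)" using F by simp
    show "g ` F \<subseteq> P_Z" by (rule FP)
    fix D assume D: "D \<in> connected_components_of (subtopology proj_line (- g ` F))"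
    have "connectedin (subtopology proj_line (- g ` F)) D" "D \<noteq> {}"
      using D connectedin_connected_components_of nonempty_connected_components_of by blast+
    then have con: "connectedin proj_line D" and sub: "D \<subseteq> - g ` F" by (auto simp: connectedin_subtopology)
    have hF: "h ` D \<subseteq> - F"
    proof (rule image_subsetI, rule ComplI)
      fix \<zeta> assume \<zeta>: "\<zeta> \<in> D" "h \<zeta> \<in> F"
      have "g (h \<zeta>) \<in> g ` F" using \<zeta>(2) by (rule imageI)
      then show False using sub \<zeta>(1) unfolding h(3) by blast
    qed
    have "connectedin proj_line (h ` D)"
      using homeomorphic_imp_continuous_map[OF h(1)] con by (rule connectedin_continuous_map_image)
    then have con': "connectedin (subtopology proj_line (- F)) (h ` D)"
      using hF unfolding connectedin_subtopology by (rule conjI)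
    obtain \<eta> where \<eta>: "\<eta> \<in> D" using \<open>D \<noteq> {}\<close> by blast
    let ?C = "connected_component_of_set (subtopology proj_line (- F)) (h \<eta>)"
    have "h \<eta> \<in> topspace (subtopology proj_line (- F))" unfolding topspace_subtopology topspace_proj_line using hF \<eta> by blast
    then have "?C \<in> connected_components_of (subtopology proj_line (- F))"
      unfolding connected_components_of_def by (rule imageI)
    from bspec[OF F(3) this] obtain p where p: "p \<in> PSL2Z" "\<forall>\<xi>\<in>?C. g \<xi> = psl_map p \<xi>" by (rule bexE)
    obtain A where A: "A \<in> SL2Z" "p = {A, - A}" using p(1) PSL2Z_iff by auto
    have hD: "h ` D \<subseteq> ?C" using con' \<eta> by (intro connected_component_of_maximal imageI)
    have "h \<zeta> = psl_map {adjugate2 A, - adjugate2 A} \<zeta>" if "\<zeta> \<in> D" for \<zeta>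
    proof -
      have eq: "moebius A (h \<zeta>) = \<zeta>" using bspec[OF p(2), OF subsetD[OF hD imageI[OF that]]] unfolding A(2) psl_map_eq h(3) by (rule sym)
      show ?thesis using moebius_adjugate2[OF A(1) eq] by (simp add: psl_map_eq)
    qed
    moreover have "{adjugate2 A, - adjugate2 A} \<in> PSL2Z" using adjugate2_SL2Z[OF A(1)] by (auto simp: PSL2Z_iff)
    ultimately show "\<exists>p\<in>PSL2Z. \<forall>\<xi>\<in>D. h \<xi> = psl_map p \<xi>" by blast
  qed
  moreover have "h None = None" using h(2)[of None] g by (simp add: monod_HZ_carrier)
  ultimately have "h \<in> carrier monod_HZ" using h(1) by (simp add: monod_HZ_carrier)
  then show ?thesis using h by (intro bexI[of _ h]) auto
qed


section \<open>One-sided derivatives and the jump cocycle\<close>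

lemma isCont_on_line: "g \<in> carrier monod_HZ \<Longrightarrow> isCont (on_line g) x"
  using continuous_on_line by (simp add: continuous_on_eq_continuous_at)

lemma germ_left:
  assumes g: "g \<in> carrier monod_HZ" and A: "A \<in> SL2Z" "germ A (on_line g) (at_left x)"
  shows "den A x \<noteq> 0" "on_line g x = num A x / den A x"
  using germ_at_point[OF A(1) isCont_on_line[OF g] _ _ A(2)] by (simp_all add: at_le)

lemma germ_right:
  assumes g: "g \<in> carrier monod_HZ" and A: "A \<in> SL2Z" "germ A (on_line g) (at_right x)"
  shows "den A x \<noteq> 0" "on_line g x = num A x / den A x"
  using germ_at_point[OF A(1) isCont_on_line[OF g] _ _ A(2)] by (simp_all add: at_le)

lemma has_derivative_germ:
  assumes A: "A \<in> SL2Z" "den A x \<noteq> 0" and fx: "f x = num A x / den A x" and gm: "germ A f (at x within X)"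
  shows "(f has_real_derivative 1 / (den A x)\<^sup>2) (at x within X)"
proof -
  have "((\<lambda>t. num A t / den A t) has_real_derivative
      (real_of_int (A $ 1 $ 1) * den A x - num A x * real_of_int (A $ 2 $ 1)) / (den A x * den A x)) (at x within X)"
    using A(2) unfolding num_def den_def by (auto intro!: derivative_eq_intros)
  moreover have "real_of_int (A $ 1 $ 1) * den A x - num A x * real_of_int (A $ 2 $ 1) = 1"
    using SL2Z_real[OF A(1)] by (simp add: num_def den_def algebra_simps)
  ultimately have D: "((\<lambda>t. num A t / den A t) has_real_derivative 1 / (den A x)\<^sup>2) (at x within X)"
    by (simp add: power2_eq_square)
  have "\<forall>\<^sub>F t in at x within X. f t = num A t / den A t"
    using gm unfolding germ_def by eventually_elim simp
  from has_field_derivative_cong_eventually[OF this fx] D show ?thesis by simp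
qed

definition dquot :: "(real \<Rightarrow> real) \<Rightarrow> real filter \<Rightarrow> real \<Rightarrow> real" where
  "dquot f F x = Lim F (\<lambda>t. (f t - f x) / (t - x))"

definition jump :: "(real option \<Rightarrow> real option) \<Rightarrow> real \<Rightarrow> real" where
  "jump g x = ln (dquot (on_line g) (at_right x) x) - ln (dquot (on_line g) (at_left x) x)"

lemma dquot_eq:
  assumes "(f has_real_derivative D) (at x within X)" "at x within X \<noteq> bot"
  shows "dquot f (at x within X) x = D"
  using assms unfolding dquot_def has_field_derivative_iff by (intro tendsto_Lim)

lemma on_line_one_sided_derivatives:
  assumes g: "g \<in> carrier monod_HZ"
  obtains A B where "A \<in> SL2Z" "germ A (on_line g) (at_left x)" "den A x \<noteq> 0" "on_line g x = num A x / den A x"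
    "(on_line g has_real_derivative 1 / (den A x)\<^sup>2) (at_left x)"
    "B \<in> SL2Z" "germ B (on_line g) (at_right x)" "den B x \<noteq> 0" "on_line g x = num B x / den B x"
    "(on_line g has_real_derivative 1 / (den B x)\<^sup>2) (at_right x)"
    "jump g x = ln (1 / (den B x)\<^sup>2) - ln (1 / (den A x)\<^sup>2)"
proof -
  obtain A B where A: "A \<in> SL2Z" "germ A (on_line g) (at_left x)" and B: "B \<in> SL2Z" "germ B (on_line g) (at_right x)"
    using germ_at_left_exists[OF g] germ_at_right_exists[OF g] by blast
  note A' = germ_left[OF g A] and B' = germ_right[OF g B]
  note dA = has_derivative_germ[OF A(1) A' A(2)] and dB = has_derivative_germ[OF B(1) B' B(2)]
  have "jump g x = ln (1 / (den B x)\<^sup>2) - ln (1 / (den A x)\<^sup>2)"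
    unfolding jump_def by (subst dquot_eq[OF dA], simp, subst dquot_eq[OF dB]) simp_all
  with A B A' B' dA dB that show ?thesis by blast
qed

text \<open>The chain rule on each side: \<open>on_line h\<close> is increasing, so it respects left
  and right, and the logarithms add.\<close>

lemma jump_comp:
  assumes g: "g \<in> carrier monod_HZ" and h: "h \<in> carrier monod_HZ"
  shows "jump (g \<circ> h) x = jump g (on_line h x) + jump h x"
proof -
  let ?y = "on_line h x"
  obtain A B where A: "den A ?y \<noteq> 0" "(on_line g has_real_derivative 1 / (den A ?y)\<^sup>2) (at_left ?y)"
    and B: "den B ?y \<noteq> 0" "(on_line g has_real_derivative 1 / (den B ?y)\<^sup>2) (at_right ?y)"
    and jg: "jump g ?y = ln (1 / (den B ?y)\<^sup>2) - ln (1 / (den A ?y)\<^sup>2)"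
    by (rule on_line_one_sided_derivatives[OF g, of ?y])
  obtain A' B' where A': "den A' x \<noteq> 0" "(on_line h has_real_derivative 1 / (den A' x)\<^sup>2) (at_left x)"
    and B': "den B' x \<noteq> 0" "(on_line h has_real_derivative 1 / (den B' x)\<^sup>2) (at_right x)"
    and jh: "jump h x = ln (1 / (den B' x)\<^sup>2) - ln (1 / (den A' x)\<^sup>2)"
    by (rule on_line_one_sided_derivatives[OF h, of x])
  have comp: "on_line (g \<circ> h) = on_line g \<circ> on_line h" using on_line_comp[OF h] by (simp add: fun_eq_iff)
  note sm = strict_mono_less[OF strict_mono_on_line[OF h]]
  have "(on_line (g \<circ> h) has_real_derivative 1 / (den A ?y)\<^sup>2 * (1 / (den A' x)\<^sup>2)) (at_left x)"
    unfolding comp by (rule DERIV_image_chain[OF DERIV_subset[OF A(2)] A'(2)]) (auto simp: sm)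
  then have l: "dquot (on_line (g \<circ> h)) (at_left x) x = 1 / (den A ?y)\<^sup>2 * (1 / (den A' x)\<^sup>2)"
    by (rule dquot_eq) simp
  have "(on_line (g \<circ> h) has_real_derivative 1 / (den B ?y)\<^sup>2 * (1 / (den B' x)\<^sup>2)) (at_right x)"
    unfolding comp by (rule DERIV_image_chain[OF DERIV_subset[OF B(2)] B'(2)]) (auto simp: sm)
  then have r: "dquot (on_line (g \<circ> h)) (at_right x) x = 1 / (den B ?y)\<^sup>2 * (1 / (den B' x)\<^sup>2)"
    by (rule dquot_eq) simp
  show ?thesis unfolding jump_def[of "g \<circ> h"] l r jg jh using A(1) B(1) A'(1) B'(1)
    by (simp add: ln_mult ln_div)
qed

section \<open>Uniqueness of germs, and break points\<close>

text \<open>Agreement at \<open>t\<close> is a quadratic equation whose coefficients are, up to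
  sign, the off-diagonal entries of the inverse of \<open>B\<close> times \<open>A\<close> and the
  difference of its diagonal entries. Infinitely many solutions make this matrix a scalar
  \<open>k\<close>, and determinant 1 makes \<open>k\<close> a sign.\<close>

lemma SL2Z_eq_of_frequently:
  assumes A: "A \<in> SL2Z" and B: "B \<in> SL2Z"
    and fr: "\<exists>\<^sub>F t in at x within X. den A t \<noteq> 0 \<and> den B t \<noteq> 0 \<and> num A t / den A t = num B t / den B t"
  shows "B = A \<or> B = - A"
proof -
  define a b c d where "a = A $ 1 $ 1" "b = A $ 1 $ 2" "c = A $ 2 $ 1" "d = A $ 2 $ 2"
  define e f g h where "e = B $ 1 $ 1" "f = B $ 1 $ 2" "g = B $ 2 $ 1" "h = B $ 2 $ 2"
  note defs = \<open>a = A $ 1 $ 1\<close> \<open>b = A $ 1 $ 2\<close> \<open>c = A $ 2 $ 1\<close> \<open>d = A $ 2 $ 2\<close>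
    \<open>e = B $ 1 $ 1\<close> \<open>f = B $ 1 $ 2\<close> \<open>g = B $ 2 $ 1\<close> \<open>h = B $ 2 $ 2\<close>
  have detA: "a * d - b * c = 1" and detB: "e * h - f * g = 1" using A B by (simp_all add: SL2Z_iff defs)
  define p :: "real poly" where "p = [:of_int (b * h - f * d), of_int (a * h + b * g - e * d - f * c), of_int (a * g - e * c):]"
  have root: "poly p t = 0" if "den A t \<noteq> 0 \<and> den B t \<noteq> 0 \<and> num A t / den A t = num B t / den B t" for t
  proof -
    have "num A t * den B t = num B t * den A t" using that frac_eq_eq by blast
    then show ?thesis by (simp add: p_def num_def den_def defs algebra_simps)
  qed
  have "infinite {t. poly p t = 0}"
  proof
    assume fin: "finite {t. poly p t = 0}"
    obtain r where r: "r > 0" "\<And>t. poly p t = 0 \<Longrightarrow> t \<noteq> x \<Longrightarrow> r \<le> dist x t"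
      using finite_set_avoid[OF fin, of x] by blast
    have "\<exists>\<^sub>F t in at x within X. poly p t = 0" using fr by (rule frequently_elim1) (rule root)
    moreover have "\<forall>\<^sub>F t in at x within X. poly p t \<noteq> 0"
      unfolding eventually_at using r by (intro exI[of _ r]) (auto simp: dist_commute not_le[symmetric])
    ultimately show False by (simp add: frequently_def)
  qed
  then have "p = 0" using poly_roots_finite by blast
  then have "real_of_int (b * h - f * d) = 0" "real_of_int (a * h + b * g - e * d - f * c) = 0" "real_of_int (a * g - e * c) = 0"
    unfolding p_def by (simp_all only: pCons_eq_0_iff)
  then have e1: "b * h - f * d = 0" and e2: "a * h + b * g - e * d - f * c = 0" and e3: "a * g - e * c = 0"
    by (simp_all only: of_int_eq_0_iff)
  define k where "k = h * a - f * c"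
  have k2: "k = d * e - b * g" using e2 by (simp add: k_def algebra_simps)
  have "k * k = (h * a - f * c) * (d * e - b * g)" using k2 by (simp add: k_def)
  also have "\<dots> = (a * d - b * c) * (e * h - f * g) + (b * h - f * d) * (e * c - a * g)"
    by (simp add: algebra_simps)
  finally have kk: "k * k = 1" by (simp add: detA detB e1)
  have ka: "a = k * e"
  proof -
    have "k * e = a * (e * h - f * g) + f * (a * g - e * c)" by (simp add: k_def algebra_simps)
    then show ?thesis by (simp add: detB e3)
  qed
  have kc: "c = k * g"
  proof -
    have "k * g = c * (e * h - f * g) + h * (a * g - e * c)" by (simp add: k_def algebra_simps)
    then show ?thesis by (simp add: detB e3)
  qed
  have kb: "b = k * f"
  proof -
    have "k * f = b * (e * h - f * g) - e * (b * h - f * d)" by (simp add: k2 algebra_simps)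
    then show ?thesis by (simp add: detB e1)
  qed
  have kd: "d = k * h"
  proof -
    have "k * h = d * (e * h - f * g) - g * (b * h - f * d)" by (simp add: k2 algebra_simps)
    then show ?thesis by (simp add: detB e1)
  qed
  have "k = 1 \<or> k = - 1" using kk by (simp add: zmult_eq_1_iff)
  then show ?thesis using ka kb kc kd by (auto simp: vec_eq_iff forall_2 defs)
qed

lemma germ_psl_map:
  assumes g: "g \<in> carrier monod_HZ" and p: "p = {A, - A}"
  shows "(\<forall>\<^sub>F \<eta> in filtermap Some F. g \<eta> = psl_map p \<eta>) \<longleftrightarrow> germ A (on_line g) F"
proof -
  have "g (Some t) = psl_map p (Some t) \<longleftrightarrow> den A t \<noteq> 0 \<and> on_line g t = num A t / den A t" for t
    unfolding p psl_map_eq apply_Some[OF g] moebius_Some by (cases "den A t = 0") simp_all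
  then show ?thesis by (simp only: eventually_filtermap germ_def)
qed

lemma germ_unique:
  assumes "A \<in> SL2Z" "B \<in> SL2Z" "germ A f (at x within X)" "germ B f (at x within X)" "at x within X \<noteq> bot"
  shows "B = A \<or> B = - A"
proof (rule SL2Z_eq_of_frequently[OF assms(1,2)])
  have "\<forall>\<^sub>F t in at x within X. den A t \<noteq> 0 \<and> den B t \<noteq> 0 \<and> num A t / den A t = num B t / den B t"
    using assms(3,4) unfolding germ_def by eventually_elim auto
  then show "\<exists>\<^sub>F t in at x within X. den A t \<noteq> 0 \<and> den B t \<noteq> 0 \<and> num A t / den A t = num B t / den B t"
    using assms(5) by (rule eventually_frequently[rotated])
qed

lemma nhds_Some:
  "left_nhds (Some x) = filtermap Some (at_left x)" "right_nhds (Some x) = filtermap Some (at_right x)"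
  by (simp_all add: left_nhds_def right_nhds_def)

lemma finite_break_points:
  assumes g: "g \<in> carrier monod_HZ"
  shows "finite (break_points g)"
proof -
  obtain F where F: "finite F" 
    "\<And>x. Some x \<notin> F \<Longrightarrow> \<exists>A\<in>SL2Z. germ A (on_line g) (at_left x) \<and> germ A (on_line g) (at_right x)"
    using two_sided_germ_exists[OF g] by blast
  have "break_points g \<subseteq> insert None F"
  proof
    fix \<xi> assume \<xi>: "\<xi> \<in> break_points g"
    show "\<xi> \<in> insert None F"
    proof (rule ccontr)
      assume n: "\<xi> \<notin> insert None F"
      then obtain x where x: "\<xi> = Some x" by (cases \<xi>) auto
      obtain p q where pq: "p \<in> PSL2Z" "q \<in> PSL2Z" "p \<noteq> q"
        "\<forall>\<^sub>F \<eta> in filtermap Some (at_left x). g \<eta> = psl_map p \<eta>"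
        "\<forall>\<^sub>F \<eta> in filtermap Some (at_right x). g \<eta> = psl_map q \<eta>"
        using \<xi> unfolding x break_points_def mem_Collect_eq nhds_Some by blast
      obtain P where P: "P \<in> SL2Z" "p = {P, - P}" using pq(1) PSL2Z_iff by auto
      obtain Q where Q: "Q \<in> SL2Z" "q = {Q, - Q}" using pq(2) PSL2Z_iff by auto
      have gP: "germ P (on_line g) (at_left x)" using pq(4) unfolding germ_psl_map[OF g P(2)] .
      have gQ: "germ Q (on_line g) (at_right x)" using pq(5) unfolding germ_psl_map[OF g Q(2)] .
      obtain A where A: "A \<in> SL2Z" "germ A (on_line g) (at_left x)" "germ A (on_line g) (at_right x)"
        using F(2)[of x] n x by blast
      have "P = A \<or> P = - A" by (rule germ_unique[OF A(1) P(1) A(2) gP]) simp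
      moreover have "Q = A \<or> Q = - A" by (rule germ_unique[OF A(1) Q(1) A(3) gQ]) simp
      ultimately show False using pq(3) P(2) Q(2) by auto
    qed
  qed
  then show ?thesis using F(1) finite_subset by blast
qed

lemma jump_break_points:
  assumes g: "g \<in> carrier monod_HZ"
  shows "Some ` {x. jump g x \<noteq> 0} \<subseteq> break_points g"
proof
  fix \<xi> assume "\<xi> \<in> Some ` {x. jump g x \<noteq> 0}"
  then obtain x where x: "\<xi> = Some x" "jump g x \<noteq> 0" by blast
  obtain A B where A: "A \<in> SL2Z" "germ A (on_line g) (at_left x)" and B: "B \<in> SL2Z" "germ B (on_line g) (at_right x)"
    and j: "jump g x = ln (1 / (den B x)\<^sup>2) - ln (1 / (den A x)\<^sup>2)"
    by (rule on_line_one_sided_derivatives[OF g, of x])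
  have "{A, - A} \<noteq> {B, - B}"
  proof
    assume "{A, - A} = {B, - B}"
    then have "B = A \<or> B = - A" by auto
    then have "(den B x)\<^sup>2 = (den A x)\<^sup>2" by (auto simp: den_def power2_eq_square algebra_simps)
    then show False using x(2) j by simp
  qed
  moreover have "{A, - A} \<in> PSL2Z" "{B, - B} \<in> PSL2Z" using A(1) B(1) by (auto simp: PSL2Z_iff)
  moreover have "\<forall>\<^sub>F \<eta> in left_nhds \<xi>. g \<eta> = psl_map {A, - A} \<eta>"
    unfolding x nhds_Some germ_psl_map[OF g refl] by (rule A(2))
  moreover have "\<forall>\<^sub>F \<eta> in right_nhds \<xi>. g \<eta> = psl_map {B, - B} \<eta>"
    unfolding x nhds_Some germ_psl_map[OF g refl] by (rule B(2))
  ultimately show "\<xi> \<in> break_points g" unfolding break_points_def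
    by (intro CollectI bexI[of _ "{A, - A}"] bexI[of _ "{B, - B}"] conjI)
qed

lemma finite_jump:
  assumes "g \<in> carrier monod_HZ" shows "finite {x. jump g x \<noteq> 0}"
  by (rule finite_imageD[OF finite_subset[OF jump_break_points[OF assms] finite_break_points[OF assms]]]) simp

lemma card_jump_le_Br:
  assumes "g \<in> carrier monod_HZ" shows "card {x. jump g x \<noteq> 0} \<le> Br g"
proof -
  have "card {x. jump g x \<noteq> 0} = card (Some ` {x. jump g x \<noteq> 0})" by (simp add: card_image)
  also have "\<dots> \<le> Br g" unfolding Br_def
    by (rule card_mono[OF finite_break_points[OF assms] jump_break_points[OF assms]])
  finally show ?thesis .
qed

section \<open>The axioms of the line action\<close>

text \<open>The identity map comes from a matrix in \<open>SL2Z\<close> too, so frequent agreement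
  with it already determines the left germ.\<close>

lemma on_line_fixed_accumulate:
  assumes g: "g \<in> carrier monod_HZ" and fr: "\<exists>\<^sub>F t in at_left x. on_line g t = t"
  shows "\<forall>\<^sub>F t in at_left x. on_line g t = t"
proof -
  obtain A where A: "A \<in> SL2Z" "germ A (on_line g) (at_left x)" using germ_at_left_exists[OF g] by blast
  have I: "(mat 1 :: int^2^2) \<in> SL2Z" by (simp add: SL2Z_iff mat_def)
  have ndI: "num (mat 1) t = t" "den (mat 1) t = 1" for t by (simp_all add: num_def den_def mat_def)
  have "\<exists>\<^sub>F t in at_left x. den (mat 1) t \<noteq> 0 \<and> den A t \<noteq> 0 \<and> num (mat 1) t / den (mat 1) t = num A t / den A t"
    by (rule frequently_rev_mp[OF fr]) (use A(2) in \<open>auto simp: germ_def ndI elim!: eventually_mono\<close>)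
  then have "A = mat 1 \<or> A = - mat 1" by (rule SL2Z_eq_of_frequently[OF I A(1)])
  then have "num A t / den A t = t" for t by (auto simp: num_def den_def mat_def)
  then show ?thesis using A(2) unfolding germ_def by (auto elim: eventually_mono)
qed

lemma int_combination_irrational:
  fixes m n :: int
  assumes "x \<notin> \<rat>" "real_of_int m * x + real_of_int n = 0"
  shows "m = 0" "n = 0"
proof -
  show "m = 0"
  proof (rule ccontr)
    assume "m \<noteq> 0"
    then have "x = - real_of_int n / real_of_int m" using assms(2) by (simp add: field_simps)
    then show False using assms(1) by simp
  qed
  then show "n = 0" using assms(2) by simp
qed

text \<open>The commutator \<open>AB - BA\<close> kills the common eigenvector \<open>(x, 1)\<close>, so it vanishes for irrational
  \<open>x\<close>; for rational \<open>x\<close> both matrices are unipotent up to sign.\<close>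

lemma SL2Z_common_fixed_point_commute:
  assumes A: "A \<in> SL2Z" "num A x = x * den A x" and B: "B \<in> SL2Z" "num B x = x * den B x"
  shows "A ** B = B ** A"
proof -
  define a b c d where "a = A $ 1 $ 1" "b = A $ 1 $ 2" "c = A $ 2 $ 1" "d = A $ 2 $ 2"
  define e f g h where "e = B $ 1 $ 1" "f = B $ 1 $ 2" "g = B $ 2 $ 1" "h = B $ 2 $ 2"
  note defs = \<open>a = A $ 1 $ 1\<close> \<open>b = A $ 1 $ 2\<close> \<open>c = A $ 2 $ 1\<close> \<open>d = A $ 2 $ 2\<close>
    \<open>e = B $ 1 $ 1\<close> \<open>f = B $ 1 $ 2\<close> \<open>g = B $ 2 $ 1\<close> \<open>h = B $ 2 $ 2\<close>
  have det: "a * d - b * c = 1" "e * h - f * g = 1" using A B by (simp_all add: SL2Z_iff defs)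
  have fp: "real_of_int a * x + real_of_int b = x * (real_of_int c * x + real_of_int d)"
    "real_of_int e * x + real_of_int f = x * (real_of_int g * x + real_of_int h)"
    using A(2) B(2) by (simp_all add: num_def den_def defs)
  have "b * g = f * c \<and> f * (a - d) = b * (e - h) \<and> c * (e - h) = g * (a - d)"
  proof (cases "x \<in> \<rat>")
    case True
    define l m where "l = real_of_int c * x + real_of_int d" "m = real_of_int g * x + real_of_int h"
    have "real_of_int a - real_of_int d = 2 * (real_of_int c * x)"
      using rational_fixed_point(2)[OF True det(1) fp(1)] by simp
    then have 1: "real_of_int (a - d) = 2 * (real_of_int c * x)" by simp
    have "real_of_int e - real_of_int h = 2 * (real_of_int g * x)"
      using rational_fixed_point(2)[OF True det(2) fp(2)] by simp
    then have 2: "real_of_int (e - h) = 2 * (real_of_int g * x)" by simp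
    have "real_of_int b = real_of_int c * x * x - real_of_int (a - d) * x"
      using fp(1) by (simp add: algebra_simps)
    then have 3: "real_of_int b = - (real_of_int c * x * x)" unfolding 1 by simp
    have "real_of_int f = real_of_int g * x * x - real_of_int (e - h) * x"
      using fp(2) by (simp add: algebra_simps)
    then have 4: "real_of_int f = - (real_of_int g * x * x)" unfolding 2 by simp
    have "real_of_int (b * g) = real_of_int (f * c)" "real_of_int (f * (a - d)) = real_of_int (b * (e - h))"
      "real_of_int (c * (e - h)) = real_of_int (g * (a - d))"
      unfolding of_int_mult 1 2 3 4 by (simp_all add: algebra_simps)
    then show ?thesis by (simp only: of_int_eq_iff)
  next
    case False
    let ?l = "real_of_int c * x + real_of_int d" and ?m = "real_of_int g * x + real_of_int h"
    have "real_of_int (c * (e - h) - g * (a - d)) * x + real_of_int (f * c - b * g)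
        = real_of_int c * (real_of_int e * x + real_of_int f) + real_of_int d * ?m
          - real_of_int g * (real_of_int a * x + real_of_int b) - real_of_int h * ?l"
      by (simp add: algebra_simps)
    also have "\<dots> = 0" unfolding fp by (simp add: algebra_simps)
    finally have 1: "c * (e - h) - g * (a - d) = 0" "f * c - b * g = 0"
      using int_combination_irrational[OF False] by blast+
    have "real_of_int (b * g - f * c) * x + real_of_int (f * (a - d) - b * (e - h))
        = real_of_int a * (real_of_int e * x + real_of_int f) + real_of_int b * ?m
          - real_of_int e * (real_of_int a * x + real_of_int b) - real_of_int f * ?l"
      by (simp add: algebra_simps)
    also have "\<dots> = 0"
    proof -
      have "real_of_int a * (x * ?m) + real_of_int b * ?m = (real_of_int a * x + real_of_int b) * ?m"
        "real_of_int e * (x * ?l) + real_of_int f * ?l = (real_of_int e * x + real_of_int f) * ?l"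
        by (simp_all add: algebra_simps)
      then show ?thesis unfolding fp by (simp add: algebra_simps)
    qed
    finally have "f * (a - d) - b * (e - h) = 0" using int_combination_irrational[OF False] by blast
    then show ?thesis using 1 by simp
  qed
  then show ?thesis
    by (simp add: vec_eq_iff forall_2 matrix_matrix_mult_def sum_2 defs algebra_simps)
qed

lemma num_den_mult:
  assumes "den B t \<noteq> 0"
  shows "num (A ** B) t = num A (num B t / den B t) * den B t" "den (A ** B) t = den A (num B t / den B t) * den B t"
proof -
  have "num (A ** B) t = real_of_int (A $ 1 $ 1) * num B t + real_of_int (A $ 1 $ 2) * den B t"
    "den (A ** B) t = real_of_int (A $ 2 $ 1) * num B t + real_of_int (A $ 2 $ 2) * den B t"
    by (simp_all add: num_def den_def matrix_matrix_mult_def sum_2 algebra_simps)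
  then show "num (A ** B) t = num A (num B t / den B t) * den B t" "den (A ** B) t = den A (num B t / den B t) * den B t"
    using assms by (simp_all add: num_def[of A] den_def[of A] distrib_right)
qed

lemma germ_comp:
  assumes A: "germ A f F" and B: "germ B g F" and lim: "filterlim g F F"
  shows "\<forall>\<^sub>F t in F. f (g t) = num (A ** B) t / den (A ** B) t"
  using B[unfolded germ_def] filterlim_iff[THEN iffD1, OF lim, rule_format, OF A[unfolded germ_def]]
  by eventually_elim (simp add: num_den_mult)

lemma on_line_right_germs_commute:
  assumes f: "f \<in> carrier monod_HZ" and g: "g \<in> carrier monod_HZ"
    and fx: "on_line f x = x" and gx: "on_line g x = x"
  shows "\<forall>\<^sub>F t in at_right x. on_line f (on_line g t) = on_line g (on_line f t)"
proof -
  have lim: "filterlim (on_line k) (at_right x) (at_right x)" if k: "k \<in> carrier monod_HZ" "on_line k x = x" for k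
    unfolding filterlim_at
  proof
    show "\<forall>\<^sub>F t in at_right x. on_line k t \<in> {x<..} \<and> on_line k t \<noteq> x"
      using eventually_at_right_less[of x]
    proof eventually_elim
      case (elim t)
      then have "on_line k x < on_line k t" using strict_mono_less[OF strict_mono_on_line[OF k(1)]] by blast
      then show ?case using k(2) by simp
    qed
    show "(on_line k \<longlongrightarrow> x) (at_right x)"
      using isCont_on_line[OF k(1), of x] unfolding isCont_def k(2) by (rule filterlim_mono) (auto simp: at_le)
  qed
  obtain A where A: "A \<in> SL2Z" "germ A (on_line f) (at_right x)" using germ_at_right_exists[OF f] by blast
  obtain B where B: "B \<in> SL2Z" "germ B (on_line g) (at_right x)" using germ_at_right_exists[OF g] by blast
  have "num A x = x * den A x" using germ_right[OF f A] fx by (simp add: field_simps)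
  moreover have "num B x = x * den B x" using germ_right[OF g B] gx by (simp add: field_simps)
  ultimately have comm: "A ** B = B ** A" using SL2Z_common_fixed_point_commute A(1) B(1) by blast
  show ?thesis
    using germ_comp[OF A(2) B(2) lim[OF g gx]] germ_comp[OF B(2) A(2) lim[OF f fx]]
    by eventually_elim (simp add: comm)
qed

lemma filterlim_on_line_at_bot:
  assumes g: "g \<in> carrier monod_HZ"
  shows "filterlim (on_line g) at_bot at_bot"
  unfolding filterlim_at_bot eventually_at_bot_linorder
proof
  fix z
  obtain h where h: "h \<in> carrier monod_HZ" "g \<circ> h = id" using monod_HZ_inverse[OF g] by blast
  have eq: "on_line g (on_line h z) = z" using on_line_comp[OF h(1), of g z] h(2) on_line_id by simp
  have "on_line g t \<le> z" if "t \<le> on_line h z" for t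
    using strict_mono_less_eq[OF strict_mono_on_line[OF g], of t "on_line h z"] that eq by simp
  then show "\<exists>N. \<forall>n\<le>N. on_line g n \<le> z" by blast
qed

text \<open>If the lower left entry \<open>c\<close> were nonzero,
  \<open>num A t / den A t = a / c - 1 / (c * den A t)\<close> would be bounded near minus infinity,
  against \<open>filterlim_on_line_at_bot\<close>. With \<open>c = 0\<close>, the integer diagonal
  entries are both 1 or both -1.\<close>

lemma on_line_translation_at_bot:
  assumes g: "g \<in> carrier monod_HZ"
  shows "\<exists>n. \<forall>\<^sub>F t in at_bot. on_line g t = t + n"
proof -
  obtain A where A: "A \<in> SL2Z" "germ A (on_line g) at_bot" using germ_at_bot_exists[OF g] by blast
  define a b c d where "a = real_of_int (A $ 1 $ 1)" "b = real_of_int (A $ 1 $ 2)"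
    "c = real_of_int (A $ 2 $ 1)" "d = real_of_int (A $ 2 $ 2)"
  note abcd = this
  have det: "a * d - b * c = 1" using SL2Z_real[OF A(1)] by (simp add: abcd)
  have nd: "num A t = a * t + b" "den A t = c * t + d" for t by (simp_all add: num_def den_def abcd)
  have c0: "A $ 2 $ 1 = 0"
  proof (rule ccontr)
    assume "A $ 2 $ 1 \<noteq> 0"
    then have c1: "1 \<le> \<bar>c\<bar>" unfolding abcd by linarith
    \<comment> \<open>The threshold ensures \<open>\<bar>c * t + d\<bar> \<ge> 1\<close>, since
      \<open>\<bar>c\<bar> \<ge> 1\<close>.\<close>
    have bound: "\<bar>num A t / den A t\<bar> \<le> \<bar>a\<bar> + 1" if t: "t \<le> - (\<bar>d\<bar> + 1)" for t
    proof -
      have "\<bar>t\<bar> * 1 \<le> \<bar>t\<bar> * \<bar>c\<bar>" using c1 by (intro mult_left_mono) auto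
      then have "\<bar>t\<bar> \<le> \<bar>c * t\<bar>" unfolding abs_mult by (simp only: mult_1_right mult.commute)
      then have D: "1 \<le> \<bar>c * t + d\<bar>" using t by linarith
      then have nz: "c * t + d \<noteq> 0" "c \<noteq> 0" using c1 by auto
      define e where "e = c * t + d"
      have "c * num A t = a * e - (a * d - b * c)" by (simp add: nd e_def algebra_simps)
      then have "c * num A t = a * e - 1" by (simp only: det)
      moreover have "e \<noteq> 0" "c \<noteq> 0" using nz by (simp_all add: e_def)
      ultimately have "num A t / e = a / c - 1 / (c * e)" by (simp add: field_simps)
      then have "num A t / den A t = a / c - 1 / (c * (c * t + d))" by (simp add: nd(2) e_def)
      also have "\<bar>\<dots>\<bar> \<le> \<bar>a / c\<bar> + \<bar>1 / (c * (c * t + d))\<bar>" by (rule abs_triangle_ineq4)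
      also have "\<bar>a / c\<bar> \<le> \<bar>a\<bar>"
        using c1 mult_left_mono[of 1 "\<bar>c\<bar>" "\<bar>a\<bar>"] by (simp add: abs_divide divide_le_eq)
      also have "\<bar>1 / (c * (c * t + d))\<bar> \<le> 1"
        using mult_mono[OF c1 D] by (simp add: abs_divide abs_mult divide_le_eq)
      finally show ?thesis by simp
    qed
    have "\<forall>\<^sub>F t in at_bot. on_line g t \<le> - (\<bar>a\<bar> + 2)"
      using filterlim_on_line_at_bot[OF g] unfolding filterlim_at_bot by blast
    moreover have "\<forall>\<^sub>F t in at_bot. t \<le> - (\<bar>d\<bar> + 1)" by (rule eventually_le_at_bot)
    ultimately have "\<forall>\<^sub>F t::real in at_bot. False" using A(2)[unfolded germ_def]
    proof eventually_elim
      case (elim t)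
      then show ?case using bound[OF elim(2)] unfolding abs_le_iff by linarith
    qed
    then show False by simp
  qed
  then have "A $ 1 $ 1 * A $ 2 $ 2 = 1" using A(1) by (simp add: SL2Z_iff)
  then have ad: "a = d" "d = 1 \<or> d = - 1" unfolding abcd by (auto simp: zmult_eq_1_iff)
  have c: "c = 0" using c0 by (simp add: abcd)
  have "\<forall>\<^sub>F t in at_bot. on_line g t = t + b / d"
    using A(2)[unfolded germ_def] by eventually_elim (use ad c in \<open>auto simp: nd\<close>)
  then show ?thesis by blast
qed

lemma on_line_germs_commute_at_bot:
  assumes f: "f \<in> carrier monod_HZ" and g: "g \<in> carrier monod_HZ"
  shows "\<forall>\<^sub>F t in at_bot. on_line f (on_line g t) = on_line g (on_line f t)"
proof -
  obtain m where m: "\<forall>\<^sub>F t in at_bot. on_line f t = t + m" using on_line_translation_at_bot[OF f] by blast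
  obtain n where n: "\<forall>\<^sub>F t in at_bot. on_line g t = t + n" using on_line_translation_at_bot[OF g] by blast
  show ?thesis
    using m n filterlim_iff[THEN iffD1, OF filterlim_on_line_at_bot[OF g], rule_format, OF m]
      filterlim_iff[THEN iffD1, OF filterlim_on_line_at_bot[OF f], rule_format, OF n]
    by eventually_elim simp
qed

text \<open>With a trivial left germ, zero jump makes the eigenvalue \<open>den B x\<close> of the
  right germ a sign. The germs differ, so \<open>x\<close> is an endpoint of a piece and irrational;
  the integer linear relations between \<open>x\<close> and 1 then force \<open>B\<close> to be the
  identity up to sign.\<close>

lemma jump_nonzero:
  assumes g: "g \<in> carrier monod_HZ" and gx: "on_line g x = x"
    and left: "\<forall>\<^sub>F t in at_left x. on_line g t = t" and right: "\<not> (\<forall>\<^sub>F t in at_right x. on_line g t = t)"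
  shows "jump g x \<noteq> 0"
proof
  assume j0: "jump g x = 0"
  have I: "(mat 1 :: int^2^2) \<in> SL2Z" by (simp add: SL2Z_iff mat_def)
  have ndI: "num (mat 1) t = t" "den (mat 1) t = 1" for t by (simp_all add: num_def den_def mat_def)
  have gI: "germ (mat 1) (on_line g) (at_left x)" using left by (simp add: germ_def ndI)
  have neq: "germ (- mat 1) h F \<longleftrightarrow> germ (mat 1) h F" for h F
    by (simp add: germ_def num_def den_def mat_def)
  have nI: "\<not> germ (mat 1) (on_line g) (at_right x)" using right by (simp add: germ_def ndI)
  obtain F where F: "F \<subseteq> P_Z"
    "\<And>x. Some x \<notin> F \<Longrightarrow> \<exists>A\<in>SL2Z. germ A (on_line g) (at_left x) \<and> germ A (on_line g) (at_right x)"
    using two_sided_germ_exists[OF g] by blast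
  have "Some x \<in> F"
  proof (rule ccontr)
    assume "Some x \<notin> F"
    then obtain A where A: "A \<in> SL2Z" "germ A (on_line g) (at_left x)" "germ A (on_line g) (at_right x)" using F(2) by blast
    have "A = mat 1 \<or> A = - mat 1" by (rule germ_unique[OF I A(1) gI A(2)]) simp
    then show False using A(3) nI neq by auto
  qed
  then have irr: "x \<notin> \<rat>" using F(1) P_Z_irrational by blast
  obtain A B where A: "A \<in> SL2Z" "germ A (on_line g) (at_left x)"
    and B: "B \<in> SL2Z" "germ B (on_line g) (at_right x)" "den B x \<noteq> 0" "on_line g x = num B x / den B x"
    and j: "jump g x = ln (1 / (den B x)\<^sup>2) - ln (1 / (den A x)\<^sup>2)"
    by (rule on_line_one_sided_derivatives[OF g, of x])
  have "A = mat 1 \<or> A = - mat 1" by (rule germ_unique[OF I A(1) gI A(2)]) simp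
  then have "(den A x)\<^sup>2 = 1" by (auto simp: den_def mat_def)
  then have "ln (1 / (den B x)\<^sup>2) = 0" using j j0 by simp
  then have "(den B x)\<^sup>2 = 1" using B(3) by (simp add: ln_div)
  then have "den B x = 1 \<or> den B x = - 1" by (simp add: power2_eq_1_iff)
  then obtain s :: int where s: "s = 1 \<or> s = - 1" "den B x = real_of_int s" by (metis of_int_1 of_int_minus)
  then have "real_of_int (B $ 2 $ 1) * x + real_of_int (B $ 2 $ 2 - s) = 0" by (simp add: den_def)
  note r2 = int_combination_irrational[OF irr this]
  have "num B x = x * real_of_int s" using B(3,4) gx s(2) by (simp add: field_simps)
  then have "real_of_int (B $ 1 $ 1 - s) * x + real_of_int (B $ 1 $ 2) = 0" by (simp add: num_def algebra_simps)
  note r1 = int_combination_irrational[OF irr this]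
  have "B = mat 1 \<or> B = - mat 1" using r1 r2 s(1) by (auto simp: vec_eq_iff forall_2 mat_def)
  then show False using B(2) nI neq by auto
qed

section \<open>Conclusion for subgroups\<close>

text \<open>\<open>inv\<close> is a definite description over the carrier of
  \<open>monod_HZ\<close>. Existence and uniqueness of inverse functions give it its meaning, after
  which closure of \<open>H\<close> under \<open>inv\<close> supplies inverses.\<close>

lemma group_subgroup_monod_HZ:
  assumes H: "subgroup H monod_HZ"
  shows "group (monod_HZ\<lparr>carrier := H\<rparr>)"
proof (rule groupI; simp add: monod_HZ_mult monod_HZ_one o_assoc)
  have sub: "H \<subseteq> carrier monod_HZ" by (rule subgroup.subset[OF H])
  show "g \<circ> h \<in> H" if "g \<in> H" "h \<in> H" for g h
    using subgroup.m_closed[OF H that] by (simp add: monod_HZ_mult)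
  show "id \<in> H" using subgroup.one_closed[OF H] by (simp add: monod_HZ_one)
  show "\<exists>h\<in>H. h \<circ> g = id" if g: "g \<in> H" for g
  proof -
    obtain h where h: "h \<in> carrier monod_HZ" "g \<circ> h = id" "h \<circ> g = id"
      using monod_HZ_inverse sub g by blast
    have "inv\<^bsub>monod_HZ\<^esub> g = h"
      unfolding m_inv_def monod_HZ_mult monod_HZ_one
    proof (rule the_equality)
      fix k assume "k \<in> carrier monod_HZ \<and> g \<circ> k = id \<and> k \<circ> g = id"
      then show "k = h" using h by (metis comp_assoc comp_id id_comp)
    qed (use h in blast)
    then show ?thesis using subgroup.m_inv_closed[OF H g] h by auto
  qed
qed

lemma line_action_subgroup:
  assumes "group G" "carrier G \<subseteq> carrier monod_HZ" "\<And>g h. g \<otimes>\<^bsub>G\<^esub> h = g \<circ> h" "\<one>\<^bsub>G\<^esub> = id"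
  shows "line_action G on_line jump"
proof -
  interpret group G by fact
  have c: "g \<in> carrier monod_HZ" if "g \<in> carrier G" for g using that assms(2) by blast
  show ?thesis
  proof
    fix g h x assume gh: "g \<in> carrier G" "h \<in> carrier G"
    show "on_line (g \<otimes>\<^bsub>G\<^esub> h) x = on_line g (on_line h x)" using gh c by (simp add: assms on_line_comp)
    show "jump (g \<otimes>\<^bsub>G\<^esub> h) x = jump g (on_line h x) + jump h x" using gh c by (simp add: assms jump_comp)
    show "\<forall>\<^sub>F t in at_bot. on_line g (on_line h t) = on_line h (on_line g t)"
      using gh c by (blast intro: on_line_germs_commute_at_bot)
    show "\<forall>\<^sub>F t in at_right x. on_line g (on_line h t) = on_line h (on_line g t)"
      if "on_line g x = x" "on_line h x = x"
      using gh c that by (blast intro: on_line_right_germs_commute)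
  next
    fix x show "on_line \<one>\<^bsub>G\<^esub> x = x" by (simp add: assms on_line_id)
  next
    fix g assume g: "g \<in> carrier G"
    show "on_line g x < on_line g y" if "x < y" for x y
      using strict_mono_on_line[OF c[OF g]] that by (simp add: strict_mono_def)
    show "g = \<one>\<^bsub>G\<^esub>" if "\<And>x. on_line g x = x" using on_line_faithful[OF c[OF g] that] by (simp add: assms)
    show "\<forall>\<^sub>F t in at_left x. on_line g t = t" if "\<exists>\<^sub>F t in at_left x. on_line g t = t" for x
      using on_line_fixed_accumulate[OF c[OF g] that] .
    show "finite {x. jump g x \<noteq> 0}" using finite_jump[OF c[OF g]] .
    show "jump g x \<noteq> 0" if "on_line g x = x" "\<forall>\<^sub>F t in at_left x. on_line g t = t"
      "\<not> (\<forall>\<^sub>F t in at_right x. on_line g t = t)" for x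
      using jump_nonzero[OF c[OF g] that] .
  qed
qed

text \<open>Solvability fails on a finitely generated \<open>?K\<close>, while the walk lives on all
  of \<open>H\<close>: the ping-pong pair and the element with nonzero jump are found in
  \<open>?K\<close> and used as elements of \<open>H\<close>.\<close>

theorem theorem1p2:
  fixes H :: "(real option \<Rightarrow> real option) set"
    and \<mu> :: "(real option \<Rightarrow> real option) pmf"
  assumes "subgroup H monod_HZ"
    and "\<not> locally_solvable (monod_HZ\<lparr>carrier := H\<rparr>)"
    and "set_pmf \<mu> \<subseteq> H"
    and "semigroup_generate monod_HZ (set_pmf \<mu>) = H"
    and "(\<lambda>g. real (Br g) * pmf \<mu> g) summable_on H"
  shows "nontrivial_boundary (monod_HZ\<lparr>carrier := H\<rparr>) \<mu>"
proof -
  let ?G = "monod_HZ\<lparr>carrier := H\<rparr>"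
  interpret G: group ?G by (rule group_subgroup_monod_HZ[OF assms(1)])
  have HM: "H \<subseteq> carrier monod_HZ" by (rule subgroup.subset[OF assms(1)])
  obtain S where S: "finite S" "S \<subseteq> H" "\<not> solvable (subgroup_generated ?G S)"
    using assms(2) by (auto simp: locally_solvable_def)
  let ?K = "subgroup_generated ?G S"
  have K: "?K = ?G\<lparr>carrier := generate ?G S\<rparr>" using S(2) by (simp add: subgroup_generated_def Int_absorb1)
  have gK: "group ?K" by (rule G.group_subgroup_generated)
  have sub: "subgroup (generate ?G S) ?G" using S(2) by (intro G.generate_is_subgroup) simp
  have KH: "carrier ?K \<subseteq> H" unfolding K using subgroup.subset[OF sub] by simp
  have SK: "S \<subseteq> carrier ?K" unfolding K by (auto intro: generate.incl)
  have gen_K: "carrier ?K = generate ?K S"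
    using G.generate_consistent[OF _ sub, of S] SK unfolding K by simp
  interpret L: line_action ?K on_line jump
    by (rule line_action_subgroup[OF gK]) (use KH HM in \<open>auto simp: K monod_HZ_mult monod_HZ_one\<close>)
  obtain x where x: "x \<in> L.Phi" "L.ping_pong x"
    using L.not_solvable_imp_ping_pong[OF S(1) SK gen_K S(3)] by blast
  obtain a b I where ab: "a \<in> H" "b \<in> H" and I: "x \<in> I" "on_line a ` I \<subseteq> I" "on_line b ` I \<subseteq> I"
    "on_line a ` I \<inter> on_line b ` I = {}" using x(2) KH unfolding L.ping_pong_def by blast
  obtain g where g: "g \<in> H" "on_line g x = x" "jump g x \<noteq> 0"
    using x(1) L.C_nonzero KH unfolding L.Phi_def by blast
  interpret W: line_action ?G on_line jump
    by (rule line_action_subgroup[OF G.group_axioms]) (use HM in \<open>auto simp: monod_HZ_mult monod_HZ_one\<close>)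
  have Br: "integrable (measure_pmf \<mu>) (\<lambda>g. real (Br g))"
  proof -
    \<comment> \<open>Outside \<open>H\<close> the summand vanishes with \<open>pmf \<mu> g\<close>,
      so summability over \<open>H\<close> becomes integrability against
      \<open>\<mu>\<close>.\<close>
    have "(\<lambda>g. norm (pmf \<mu> g * real (Br g))) summable_on UNIV"
      using assms(5) by (rule summable_on_cong_neutral[THEN iffD1, rotated -1])
        (use assms(3) in \<open>auto simp: set_pmf_iff mult.commute\<close>)
    then have "integrable (count_space UNIV) (\<lambda>g. pmf \<mu> g * real (Br g))"
      unfolding abs_summable_equivalent by (simp add: abs_summable_on_def)
    then show ?thesis by (simp add: measure_pmf_eq_density integrable_density)
  qed
  have moment: "integrable (measure_pmf \<mu>) (\<lambda>g. real (card {x. jump g x \<noteq> 0}))"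
  proof (rule Bochner_Integration.integrable_bound[OF Br])
    show "AE g in measure_pmf \<mu>. norm (real (card {x. jump g x \<noteq> 0})) \<le> norm (real (Br g))"
      using card_jump_le_Br HM assms(3) by (auto simp: AE_measure_pmf_iff)
  qed simp
  have gen: "semigroup_generate ?G (set_pmf \<mu>) = carrier ?G"
  proof -
    \<comment> \<open>Both structures share their multiplication, which is all that
      \<open>semigroup_generate\<close> refers to.\<close>
    have "g \<in> semigroup_generate ?G T \<longleftrightarrow> g \<in> semigroup_generate monod_HZ T" for g T
    proof
      assume "g \<in> semigroup_generate ?G T"
      then show "g \<in> semigroup_generate monod_HZ T"
        by (induction rule: semigroup_generate.induct) (auto intro: semigroup_generate.intros)
    next
      assume "g \<in> semigroup_generate monod_HZ T"
      then show "g \<in> semigroup_generate ?G T"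
      proof (induction rule: semigroup_generate.induct)
        case (mult s t) then show ?case using semigroup_generate.mult[of s ?G T t] by simp
      qed (rule semigroup_generate.incl)
    qed
    then show ?thesis using assms(4) by auto
  qed
  interpret R: cocycle_walk ?G on_line jump \<mu>
    by unfold_locales (use W.act_mult W.act_one W.C_mult W.finite_C assms(3) gen moment in auto)
  show ?thesis using R.nontrivial_boundary[of a b x I g] ab I g by simp
qed

end
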